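(* Let $\{P,T,E,N\}$ be an $\mathbf{AIP}_{\mathcal S(\mathcal U,\mathcal Y)}$-admissible data set and let $\mathcal R_\Sigma$ be the Redheffer transform associated with the Schur-class function $\Sigma$ constructed from $\{P,T,E,N\}$ as in the context. Assume that $T^*$ is injective. Then $\mathcal R_\Sigma:\mathcal S(\widetilde\Delta,\widetilde\Delta_* )\to\mathcal S(\mathcal U,\mathcal Y)$ is injective, and for every $\mathcal E\in\mathcal S(\widetilde\Delta,\widetilde\Delta_* )$, with $S=\mathcal R_\Sigma[\mathcal E]$ and $G(z)=\Sigma_{12}(z)(I-\mathcal E(z)\Sigma_{22}(z))^{-1}$, the multiplication operator $M_G:\mathcal H(K_{\mathcal E})\to\mathcal H(K_S)$ has trivial kernel. If in addition $P=M_{F^S}^{[*]}M_{F^S}$, then $M_G$ is an isometry.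
   Context: Notation. $\mathcal X,\mathcal U,\mathcal Y$ are complex Hilbert spaces; $\mathcal L(\cdot,\cdot)$ denotes bounded operators; $\mathbb D$ is the open unit disk; $\mathrm{Hol}_{\mathcal Y}(\mathbb D)$ is the space of $\mathcal Y$-valued holomorphic functions on $\mathbb D$. The Schur class $\mathcal S(\mathcal U,\mathcal Y)$ is the set of analytic functions on $\mathbb D$ whose values are contractions in $\mathcal L(\mathcal U,\mathcal Y)$. For $S\in\mathcal S(\mathcal U,\mathcal Y)$, $\mathcal H(K_S)$ is the reproducing kernel Hilbert space of $\mathcal Y$-valued functions with kernel $K_S(z,\zeta)=\frac{I-S(z)S(\zeta)^*}{1-z\bar\zeta}$; $A^{[*]}$ is the adjoint of an operator $A$ into $\mathcal H(K_S)$ with respect to the inner product of $\mathcal H(K_S)$. $M_F$ denotes multiplication by $F$. $(E,T)$ is an analytic output pair if $\mathcal O_{E,T}:x\mapsto E(I-zT)^{-1}x=\sum_{n\ge0}z^nET^nx$ maps $\mathcal X$ into $\mathrm{Hol}_{\mathcal Y}(\mathbb D)$. $F^S(z)=(E-S(z)N)(I-zT)^{-1}$ and $M_{F^S}=\mathcal O_{E,T}-M_S\mathcal O_{N,T}:x\mapsto F^Sx$; for $S=\mathcal R_\Sigma[\mathcal E]$ it maps $\mathcal X$ into $\mathcal H(K_S)$. A set $\{P,T,E,N\}$ with $P,T\in\mathcal L(\mathcal X)$, $E\in\mathcal L(\mathcal X,\mathcal Y)$, $N\in\mathcal L(\mathcal X,\mathcal U)$ is $\mathbf{AIP}_{\mathcal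 S(\mathcal U,\mathcal Y)}$-admissible if $(E,T)$ and $(N,T)$ are analytic output pairs, $P$ is positive semidefinite, and $P-T^*PT=E^*E-N^*N$. Construction of $\Sigma$. Put $\mathcal X_0=\overline{\mathrm{Ran}}\,P^{1/2}$; $P^{1/2}$ is regarded as an operator $\mathcal X\to\mathcal X_0$ or $\mathcal X_0\to\mathcal X$ as needed. There is a unique isometry $V$ from $\mathcal D_V=\overline{\mathrm{Ran}}\begin{bmatrix}P^{1/2}\\ N\end{bmatrix}\subseteq\mathcal X_0\oplus\mathcal U$ onto $\mathcal R_V=\overline{\mathrm{Ran}}\begin{bmatrix}P^{1/2}T\\ E\end{bmatrix}\subseteq\mathcal X_0\oplus\mathcal Y$ with $V\begin{bmatrix}P^{1/2}x\\ Nx\end{bmatrix}=\begin{bmatrix}P^{1/2}Tx\\ Ex\end{bmatrix}$ for $x\in\mathcal X$. Let $\Delta=(\mathcal X_0\oplus\mathcal U)\ominus\mathcal D_V$, $\Delta_*=(\mathcal X_0\oplus\mathcal Y)\ominus\mathcal R_V$, with unitary maps $\mathbf i:\Delta\to\widetilde\Delta$, $\mathbf i_*:\Delta_*\to\widetilde\Delta_*$ onto isomorphic copies. The unitary operator $\mathbf U:\mathcal X_0\oplus\mathcal U\oplus\widetilde\Delta_*\to\mathcal X_0\oplus\mathcal Y\oplus\widetilde\Delta$ acts as $V$ from $\mathcal D_V$ onto $\mathcal R_V$, as $\mathbf i$ from $\Delta$ onto $\widetilde\Delta$, and as $\mathbf i_*^*$ from $\widetilde\Delta_*$ onto $\Delta_*$.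 Write $$\mathbf U=\begin{bmatrix}A&B_1&B_2\\ C_1&D_{11}&D_{12}\\ C_2&D_{21}&0\end{bmatrix},\qquad \Sigma(z)=\begin{bmatrix}\Sigma_{11}(z)&\Sigma_{12}(z)\\ \Sigma_{21}(z)&\Sigma_{22}(z)\end{bmatrix}=\begin{bmatrix}D_{11}&D_{12}\\ D_{21}&0\end{bmatrix}+z\begin{bmatrix}C_1\\ C_2\end{bmatrix}(I-zA)^{-1}\begin{bmatrix}B_1&B_2\end{bmatrix},$$ with $\Sigma(z):\mathcal U\oplus\widetilde\Delta_*\to\mathcal Y\oplus\widetilde\Delta$. For $\mathcal E\in\mathcal S(\widetilde\Delta,\widetilde\Delta_* )$ the Redheffer transform is $\mathcal R_\Sigma[\mathcal E]=\Sigma_{11}+\Sigma_{12}(I-\mathcal E\Sigma_{22})^{-1}\mathcal E\Sigma_{21}\in\mathcal S(\mathcal U,\mathcal Y)$. *)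

theory Defs
  imports "HOL-Analysis.Analysis"
begin

section \<open>Complex Hilbert spaces\<close>

text \<open>Inner products are linear in the first and conjugate-linear in the second argument.
  Positive definiteness of \<open>cinner\<close> follows from \<open>norm_eq_sqrt_cinner\<close> and the norm axioms.
  The zero space is allowed.\<close>

class chilbert = banach +
  fixes scaleC :: "complex \<Rightarrow> 'a \<Rightarrow> 'a" (infixr "*\<^sub>C" 75)
    and cinner :: "'a \<Rightarrow> 'a \<Rightarrow> complex"
  assumes scaleC_add_right: "a *\<^sub>C (x + y) = a *\<^sub>C x + a *\<^sub>C y"
    and scaleC_add_left: "(a + b) *\<^sub>C x = a *\<^sub>C x + b *\<^sub>C x"
    and scaleC_scaleC: "a *\<^sub>C (b *\<^sub>C x) = (a * b) *\<^sub>C x"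
    and scaleR_scaleC: "r *\<^sub>R x = complex_of_real r *\<^sub>C x"
    and cinner_commute: "cinner x y = cnj (cinner y x)"
    and cinner_add_left: "cinner (x + y) w = cinner x w + cinner y w"
    and cinner_scaleC_left: "cinner (a *\<^sub>C x) y = a * cinner x y"
    and norm_eq_sqrt_cinner: "norm x = sqrt (Re (cinner x x))"

instantiation prod :: (chilbert, chilbert) chilbert
begin

definition "a *\<^sub>C x = (a *\<^sub>C fst x, a *\<^sub>C snd x)"

definition "cinner x y = cinner (fst x) (fst y) + cinner (snd x) (snd y)"

instance
proof
  fix a b :: complex and r :: real and x y w :: "'a \<times> 'b"
  show "a *\<^sub>C (x + y) = a *\<^sub>C x + a *\<^sub>C y"
    by (simp add: scaleC_prod_def scaleC_add_right)
  show "(a + b) *\<^sub>C x = a *\<^sub>C x + b *\<^sub>C x"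
    by (simp add: scaleC_prod_def scaleC_add_left)
  show "a *\<^sub>C (b *\<^sub>C x) = (a * b) *\<^sub>C x"
    by (simp add: scaleC_prod_def scaleC_scaleC)
  show "r *\<^sub>R x = complex_of_real r *\<^sub>C x"
    by (simp add: scaleC_prod_def scaleR_prod_def scaleR_scaleC)
  show "cinner x y = cnj (cinner y x)"
    by (simp add: cinner_prod_def cinner_commute[of "fst x"] cinner_commute[of "snd x"])
  show "cinner (x + y) w = cinner x w + cinner y w"
    by (simp add: cinner_prod_def cinner_add_left)
  show "cinner (a *\<^sub>C x) y = a * cinner x y"
    by (simp add: cinner_prod_def scaleC_prod_def cinner_scaleC_left algebra_simps)
  have sq: "Re (cinner v v) = (norm v)\<^sup>2" for v :: "'c::chilbert"
  proof -
    have "0 \<le> sqrt (Re (cinner v v))"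
      by (simp flip: norm_eq_sqrt_cinner)
    then show ?thesis
      by (simp add: norm_eq_sqrt_cinner)
  qed
  show "norm x = sqrt (Re (cinner x x))"
    by (simp add: cinner_prod_def norm_prod_def sq)
qed

end


section \<open>Operators\<close>

definition bounded_clinear :: "('a::chilbert \<Rightarrow> 'b::chilbert) \<Rightarrow> bool" where
  "bounded_clinear f \<longleftrightarrow> bounded_linear f \<and> (\<forall>c x. f (c *\<^sub>C x) = c *\<^sub>C f x)"

definition cadjoint :: "('a::chilbert \<Rightarrow> 'b::chilbert) \<Rightarrow> 'b \<Rightarrow> 'a" where
  "cadjoint f y = (THE x. \<forall>v. cinner (f v) y = cinner v x)"

definition positive_semidef :: "('a::chilbert \<Rightarrow> 'a) \<Rightarrow> bool" where
  "positive_semidef P \<longleftrightarrow>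
     bounded_clinear P \<and> (\<forall>x. Im (cinner (P x) x) = 0 \<and> 0 \<le> Re (cinner (P x) x))"

definition psd_sqrt :: "('a::chilbert \<Rightarrow> 'a) \<Rightarrow> 'a \<Rightarrow> 'a" where
  "psd_sqrt P = (SOME Q. positive_semidef Q \<and> (\<forall>x. Q (Q x) = P x))"

definition orth_compl :: "'a::chilbert set \<Rightarrow> 'a set" where
  "orth_compl M = {x. \<forall>m\<in>M. cinner x m = 0}"

text \<open>The orthogonal projection onto a closed subspace \<open>M\<close>.\<close>

definition orth_proj :: "'a::chilbert set \<Rightarrow> 'a \<Rightarrow> 'a" where
  "orth_proj M x = (THE p. p \<in> M \<and> x - p \<in> orth_compl M)"

text \<open>\<open>f\<close> is a linear isometry of the subspace \<open>M\<close> onto \<open>M'\<close>, i.e. unitary as a map from \<open>M\<close>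
  to \<open>M'\<close>; its values outside \<open>M\<close> are irrelevant.\<close>

definition unitary_onto :: "'a::chilbert set \<Rightarrow> 'b::chilbert set \<Rightarrow> ('a \<Rightarrow> 'b) \<Rightarrow> bool" where
  "unitary_onto M M' f \<longleftrightarrow>
     (\<forall>x\<in>M. \<forall>y\<in>M. f (x + y) = f x + f y) \<and>
     (\<forall>c. \<forall>x\<in>M. f (c *\<^sub>C x) = c *\<^sub>C f x) \<and>
     (\<forall>x\<in>M. norm (f x) = norm x) \<and>
     f ` M = M'"


section \<open>Functions on the unit disk\<close>

text \<open>Functions on the disk are elements of \<open>extensional disk\<close>, so that equality of functions is
  equality on the disk.\<close>

abbreviation disk :: "complex set" where
  "disk \<equiv> ball 0 1"

definition holomorphic_vec :: "(complex \<Rightarrow> 'a::chilbert) \<Rightarrow> bool" where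
  "holomorphic_vec f \<longleftrightarrow>
     (\<forall>z\<in>disk. \<exists>l. ((\<lambda>w. inverse (w - z) *\<^sub>C (f w - f z)) \<longlongrightarrow> l) (at z))"

text \<open>Complex differentiability with respect to the operator norm.\<close>

definition holomorphic_op :: "(complex \<Rightarrow> 'a::chilbert \<Rightarrow> 'b::chilbert) \<Rightarrow> bool" where
  "holomorphic_op F \<longleftrightarrow>
     (\<forall>z\<in>disk. \<exists>L. bounded_clinear L \<and>
        ((\<lambda>w. onorm (\<lambda>x. inverse (w - z) *\<^sub>C (F w x - F z x) - L x)) \<longlongrightarrow> 0) (at z))"

definition schur_class :: "(complex \<Rightarrow> 'a::chilbert \<Rightarrow> 'b::chilbert) set" where
  "schur_class = {S \<in> extensional disk.
     (\<forall>z\<in>disk. bounded_clinear (S z) \<and> onorm (S z) \<le> 1) \<and> holomorphic_op S}"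

definition mult_op ::
  "(complex \<Rightarrow> 'a::chilbert \<Rightarrow> 'b::chilbert) \<Rightarrow> (complex \<Rightarrow> 'a) \<Rightarrow> complex \<Rightarrow> 'b" where
  "mult_op F f = (\<lambda>z\<in>disk. F z (f z))"


section \<open>Reproducing kernel Hilbert spaces\<close>

text \<open>\<open>H\<close> with the inner product \<open>ip\<close> is the reproducing kernel Hilbert space of functions on the
  disk with kernel \<open>K\<close>. By the reproducing property and completeness, \<open>H\<close> and the
  restriction of \<open>ip\<close> to \<open>H \<times> H\<close> are uniquely determined by \<open>K\<close>; for the positive kernels
  \<open>schur_kernel S\<close> below they exist by the Moore-Aronszajn theorem.\<close>

definition ip_norm :: "('f \<Rightarrow> 'f \<Rightarrow> complex) \<Rightarrow> 'f \<Rightarrow> real" where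
  "ip_norm ip f = sqrt (Re (ip f f))"

definition function_hilbert_space ::
  "(complex \<Rightarrow> 'a::chilbert) set \<Rightarrow> ((complex \<Rightarrow> 'a) \<Rightarrow> (complex \<Rightarrow> 'a) \<Rightarrow> complex) \<Rightarrow> bool" where
  "function_hilbert_space H ip \<longleftrightarrow>
     H \<subseteq> extensional disk \<and>
     (\<lambda>z\<in>disk. 0) \<in> H \<and>
     (\<forall>f\<in>H. \<forall>g\<in>H. (\<lambda>z\<in>disk. f z + g z) \<in> H) \<and>
     (\<forall>c. \<forall>f\<in>H. (\<lambda>z\<in>disk. c *\<^sub>C f z) \<in> H) \<and>
     (\<forall>f\<in>H. \<forall>g\<in>H. ip f g = cnj (ip g f)) \<and>
     (\<forall>f\<in>H. \<forall>g\<in>H. \<forall>h\<in>H. ip (\<lambda>z\<in>disk. f z + g z) h = ip f h + ip g h) \<and>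
     (\<forall>c. \<forall>f\<in>H. \<forall>g\<in>H. ip (\<lambda>z\<in>disk. c *\<^sub>C f z) g = c * ip f g) \<and>
     (\<forall>f\<in>H. 0 \<le> Re (ip f f)) \<and>
     (\<forall>f\<in>H. ip f f = 0 \<longrightarrow> f = (\<lambda>z\<in>disk. 0)) \<and>
     (\<forall>F. (\<forall>n. F n \<in> H) \<and>
          (\<forall>e>0. \<exists>n0. \<forall>m\<ge>n0. \<forall>n\<ge>n0. ip_norm ip (\<lambda>z\<in>disk. F m z - F n z) < e) \<longrightarrow>
          (\<exists>f\<in>H. (\<lambda>n. ip_norm ip (\<lambda>z\<in>disk. F n z - f z)) \<longlonglongrightarrow> 0))"

definition is_rkhs ::
  "(complex \<Rightarrow> complex \<Rightarrow> 'a::chilbert \<Rightarrow> 'a) \<Rightarrow>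
   (complex \<Rightarrow> 'a) set \<Rightarrow> ((complex \<Rightarrow> 'a) \<Rightarrow> (complex \<Rightarrow> 'a) \<Rightarrow> complex) \<Rightarrow> bool" where
  "is_rkhs K H ip \<longleftrightarrow>
     function_hilbert_space H ip \<and>
     (\<forall>\<zeta>\<in>disk. \<forall>y. (\<lambda>z\<in>disk. K z \<zeta> y) \<in> H \<and>
        (\<forall>f\<in>H. ip f (\<lambda>z\<in>disk. K z \<zeta> y) = cinner (f \<zeta>) y))"

definition schur_kernel ::
  "(complex \<Rightarrow> 'a::chilbert \<Rightarrow> 'b::chilbert) \<Rightarrow> complex \<Rightarrow> complex \<Rightarrow> 'b \<Rightarrow> 'b" where
  "schur_kernel S z \<zeta> y = inverse (1 - z * cnj \<zeta>) *\<^sub>C (y - S z (cadjoint (S \<zeta>) y))"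

text \<open>The adjoint of an operator \<open>M\<close> from a Hilbert space into a function space with inner
  product \<open>ip\<close>.\<close>

definition ip_adjoint ::
  "((complex \<Rightarrow> 'b) \<Rightarrow> (complex \<Rightarrow> 'b) \<Rightarrow> complex) \<Rightarrow>
   ('a::chilbert \<Rightarrow> complex \<Rightarrow> 'b) \<Rightarrow> (complex \<Rightarrow> 'b) \<Rightarrow> 'a" where
  "ip_adjoint ip M f = (THE x. \<forall>v. ip (M v) f = cinner v x)"


section \<open>Admissible data\<close>

text \<open>The spectral radius of \<open>T\<close> may exceed 1, so \<open>E (I - z T)\<^sup>-\<^sup>1 x\<close> is understood as the
  power series.\<close>

definition observability ::
  "('x::chilbert \<Rightarrow> 'y::chilbert) \<Rightarrow> ('x \<Rightarrow> 'x) \<Rightarrow> 'x \<Rightarrow> complex \<Rightarrow> 'y" where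
  "observability E T x = (\<lambda>z\<in>disk. \<Sum>n. z ^ n *\<^sub>C E ((T ^^ n) x))"

definition analytic_output_pair ::
  "('x::chilbert \<Rightarrow> 'y::chilbert) \<Rightarrow> ('x \<Rightarrow> 'x) \<Rightarrow> bool" where
  "analytic_output_pair E T \<longleftrightarrow>
     (\<forall>x. (\<forall>z\<in>disk. summable (\<lambda>n. z ^ n *\<^sub>C E ((T ^^ n) x))) \<and>
          holomorphic_vec (observability E T x))"

definition aip_admissible ::
  "('x::chilbert \<Rightarrow> 'x) \<Rightarrow> ('x \<Rightarrow> 'x) \<Rightarrow> ('x \<Rightarrow> 'y::chilbert) \<Rightarrow> ('x \<Rightarrow> 'u::chilbert) \<Rightarrow> bool" where
  "aip_admissible P T E N \<longleftrightarrow>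
     bounded_clinear P \<and> bounded_clinear T \<and> bounded_clinear E \<and> bounded_clinear N \<and>
     analytic_output_pair E T \<and> analytic_output_pair N T \<and>
     positive_semidef P \<and>
     (\<forall>x. P x - cadjoint T (P (T x)) = cadjoint E (E x) - cadjoint N (N x))"

text \<open>The operator \<open>x \<mapsto> F\<^sup>S x\<close> where \<open>F\<^sup>S(z) = (E - S(z) N) (I - z T)\<^sup>-\<^sup>1\<close>.\<close>

definition M_FS ::
  "('x::chilbert \<Rightarrow> 'x) \<Rightarrow> ('x \<Rightarrow> 'y::chilbert) \<Rightarrow> ('x \<Rightarrow> 'u::chilbert) \<Rightarrow>
   (complex \<Rightarrow> 'u \<Rightarrow> 'y) \<Rightarrow> 'x \<Rightarrow> complex \<Rightarrow> 'y" where
  "M_FS T E N S x = (\<lambda>z\<in>disk. observability E T x z - S z (observability N T x z))"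


section \<open>The unitary colligation and its characteristic function\<close>

definition aip_X0 :: "('x::chilbert \<Rightarrow> 'x) \<Rightarrow> 'x set" where
  "aip_X0 P = closure (range (psd_sqrt P))"

definition aip_DV :: "('x::chilbert \<Rightarrow> 'x) \<Rightarrow> ('x \<Rightarrow> 'u::chilbert) \<Rightarrow> ('x \<times> 'u) set" where
  "aip_DV P N = closure (range (\<lambda>x. (psd_sqrt P x, N x)))"

definition aip_RV ::
  "('x::chilbert \<Rightarrow> 'x) \<Rightarrow> ('x \<Rightarrow> 'x) \<Rightarrow> ('x \<Rightarrow> 'y::chilbert) \<Rightarrow> ('x \<times> 'y) set" where
  "aip_RV P T E = closure (range (\<lambda>x. (psd_sqrt P (T x), E x)))"

definition aip_V ::
  "('x::chilbert \<Rightarrow> 'x) \<Rightarrow> ('x \<Rightarrow> 'x) \<Rightarrow> ('x \<Rightarrow> 'y::chilbert) \<Rightarrow> ('x \<Rightarrow> 'u::chilbert) \<Rightarrow>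
   'x \<times> 'u \<Rightarrow> 'x \<times> 'y" where
  "aip_V P T E N = (SOME V. unitary_onto (aip_DV P N) (aip_RV P T E) V \<and>
     (\<forall>x. V (psd_sqrt P x, N x) = (psd_sqrt P (T x), E x)))"

definition aip_Delta :: "('x::chilbert \<Rightarrow> 'x) \<Rightarrow> ('x \<Rightarrow> 'u::chilbert) \<Rightarrow> ('x \<times> 'u) set" where
  "aip_Delta P N = (aip_X0 P \<times> UNIV) \<inter> orth_compl (aip_DV P N)"

definition aip_Delta_star ::
  "('x::chilbert \<Rightarrow> 'x) \<Rightarrow> ('x \<Rightarrow> 'x) \<Rightarrow> ('x \<Rightarrow> 'y::chilbert) \<Rightarrow> ('x \<times> 'y) set" where
  "aip_Delta_star P T E = (aip_X0 P \<times> UNIV) \<inter> orth_compl (aip_RV P T E)"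

text \<open>The unitary operator from \<open>X\<^sub>0 \<oplus> \<U> \<oplus> \<Delta>\<^sub>*\<close> to \<open>X\<^sub>0 \<oplus> \<Y> \<oplus> \<Delta>\<close>, where the copies of the defect
  spaces are the types \<open>'e\<close> and \<open>'d\<close>. Only first components in \<open>X\<^sub>0\<close> are meaningful. The adjoint
  of the unitary map \<open>j\<close> is its inverse.\<close>

definition aip_U ::
  "('x::chilbert \<Rightarrow> 'x) \<Rightarrow> ('x \<Rightarrow> 'x) \<Rightarrow> ('x \<Rightarrow> 'y::chilbert) \<Rightarrow> ('x \<Rightarrow> 'u::chilbert) \<Rightarrow>
   ('x \<times> 'u \<Rightarrow> 'd::chilbert) \<Rightarrow> ('x \<times> 'y \<Rightarrow> 'e::chilbert) \<Rightarrow>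
   'x \<times> 'u \<times> 'e \<Rightarrow> 'x \<times> 'y \<times> 'd" where
  "aip_U P T E N i j = (\<lambda>(h, u, e).
     let p = orth_proj (aip_DV P N) (h, u);
         q = aip_V P T E N p + inv_into (aip_Delta_star P T E) j e
     in (fst q, snd q, i ((h, u) - p)))"

text \<open>For a colligation \<open>U\<close> with blocks \<open>A, B, C, D\<close> and state space \<open>X0\<close>, the function
  \<open>D + z C (I - z A)\<^sup>-\<^sup>1 B\<close>, with \<open>I - z A\<close> inverted as an operator on \<open>X0\<close>.\<close>

definition transfer_function ::
  "'x::chilbert set \<Rightarrow> ('x \<times> 'a::chilbert \<Rightarrow> 'x \<times> 'b::chilbert) \<Rightarrow> complex \<Rightarrow> 'a \<Rightarrow> 'b" where
  "transfer_function X0 U z a =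
     (let A = (\<lambda>h. fst (U (h, 0))); B = (\<lambda>a. fst (U (0, a)));
          C = (\<lambda>h. snd (U (h, 0))); D = (\<lambda>a. snd (U (0, a)))
      in D a + z *\<^sub>C C (inv_into X0 (\<lambda>h. h - z *\<^sub>C A h) (B a)))"

definition aip_Sigma ::
  "('x::chilbert \<Rightarrow> 'x) \<Rightarrow> ('x \<Rightarrow> 'x) \<Rightarrow> ('x \<Rightarrow> 'y::chilbert) \<Rightarrow> ('x \<Rightarrow> 'u::chilbert) \<Rightarrow>
   ('x \<times> 'u \<Rightarrow> 'd::chilbert) \<Rightarrow> ('x \<times> 'y \<Rightarrow> 'e::chilbert) \<Rightarrow>
   complex \<Rightarrow> 'u \<times> 'e \<Rightarrow> 'y \<times> 'd" where
  "aip_Sigma P T E N i j = transfer_function (aip_X0 P) (aip_U P T E N i j)"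


section \<open>The Redheffer transform\<close>

definition block11 :: "(complex \<Rightarrow> 'u \<times> 'e::zero \<Rightarrow> 'y \<times> 'd) \<Rightarrow> complex \<Rightarrow> 'u \<Rightarrow> 'y" where
  "block11 Sg z u = fst (Sg z (u, 0))"

definition block12 :: "(complex \<Rightarrow> 'u::zero \<times> 'e \<Rightarrow> 'y \<times> 'd) \<Rightarrow> complex \<Rightarrow> 'e \<Rightarrow> 'y" where
  "block12 Sg z e = fst (Sg z (0, e))"

definition block21 :: "(complex \<Rightarrow> 'u \<times> 'e::zero \<Rightarrow> 'y \<times> 'd) \<Rightarrow> complex \<Rightarrow> 'u \<Rightarrow> 'd" where
  "block21 Sg z u = snd (Sg z (u, 0))"

definition block22 :: "(complex \<Rightarrow> 'u::zero \<times> 'e \<Rightarrow> 'y \<times> 'd) \<Rightarrow> complex \<Rightarrow> 'e \<Rightarrow> 'd" where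
  "block22 Sg z e = snd (Sg z (0, e))"

text \<open>\<open>G(z) = \<Sigma>\<^sub>1\<^sub>2(z) (I - \<E>(z) \<Sigma>\<^sub>2\<^sub>2(z))\<^sup>-\<^sup>1\<close>\<close>

definition redheffer_G ::
  "(complex \<Rightarrow> 'u::chilbert \<times> 'e::chilbert \<Rightarrow> 'y::chilbert \<times> 'd::chilbert) \<Rightarrow>
   (complex \<Rightarrow> 'd \<Rightarrow> 'e) \<Rightarrow> complex \<Rightarrow> 'e \<Rightarrow> 'y" where
  "redheffer_G Sg \<E> z e = block12 Sg z (inv (\<lambda>v. v - \<E> z (block22 Sg z v)) e)"

definition redheffer ::
  "(complex \<Rightarrow> 'u::chilbert \<times> 'e::chilbert \<Rightarrow> 'y::chilbert \<times> 'd::chilbert) \<Rightarrow>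
   (complex \<Rightarrow> 'd \<Rightarrow> 'e) \<Rightarrow> complex \<Rightarrow> 'u \<Rightarrow> 'y" where
  "redheffer Sg \<E> = (\<lambda>z\<in>disk. \<lambda>u.
     block11 Sg z u + block12 Sg z (inv (\<lambda>v. v - \<E> z (block22 Sg z v)) (\<E> z (block21 Sg z u))))"

end

theory Submission
  imports Defs "HOL-Complex_Analysis.Complex_Analysis" "HOL-Library.Function_Algebras"
begin

text \<open>Write \<open>X\<^sub>0\<close> for the state space of the unitary colligation \<open>U\<close> and close it by the feedback
  \<open>e = e\<^sub>0 + \<E>(z) d\<close>. With initial state \<open>x\<close>, input \<open>u\<close> and \<open>e\<^sub>0\<close>, the output is
  \<open>H(z) x + S(z) u + G(z) e\<^sub>0\<close>. Unitarity of \<open>U\<close> gives the kernel identity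
  \<open>K\<^sub>S(\<omega>,\<zeta>) = H(\<omega>) H(\<zeta>)\<^sup>* + G(\<omega>) K\<^sub>\<E>(\<omega>,\<zeta>) G(\<zeta>)\<^sup>*\<close>, so that \<open>(x, f) \<mapsto> H x + G f\<close> is a
  coisometry from \<open>X\<^sub>0 \<oplus> H(K\<^sub>\<E>)\<close> onto \<open>H(K\<^sub>S)\<close>.

  If the output of the loop vanishes for \<open>x = 0\<close> and \<open>u = 0\<close>, then pairing \<open>U\<close> with the trajectories
  of the data shows that the state \<open>h(z)\<close> satisfies \<open>T\<^sup>* P\<^sup>1\<^sup>/\<^sup>2 h(z) = z P\<^sup>1\<^sup>/\<^sup>2 h(z)\<close>. Comparison of
  Taylor coefficients and injectivity of \<open>T\<^sup>*\<close> force \<open>h = 0\<close>, hence all signals vanish. This gives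
  the trivial kernel of \<open>M\<^sub>G\<close>, and applied to the difference of two loops it gives
  \<open>\<E>\<^sub>1 d = \<E>\<^sub>2 d\<close> for all signals \<open>d\<close> that occur; near \<open>0\<close> these are dense.

  Finally \<open>F\<^sup>S = H P\<^sup>1\<^sup>/\<^sup>2\<close>, so \<open>P = M\<^sub>F\<^sup>* M\<^sub>F\<close> says that the coisometry is isometric on \<open>X\<^sub>0 \<oplus> 0\<close>. Its
  kernel is then contained in \<open>0 \<oplus> H(K\<^sub>\<E>)\<close>, where it is trivial, so it is unitary.\<close>

section \<open>Complex Hilbert spaces\<close>

text \<open>The inverses in \<open>\<Sigma>\<close>, \<open>G\<close> and the Redheffer transform
  are evaluated once and then replaced by a relation between the signals of the loop. This relation
  is linear and has exactly one solution, bounded locally uniformly in z; linearity and holomorphy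
  of all responses follow from that. Solvability rests on \<open>D22 = 0\<close>: it gives
  \<open>\<Sigma>22(z)\<close> norm at most |z|, so feedback by any contraction is a strict
  contraction. Density is restricted to a neighbourhood of 0 for this reason: a vector orthogonal to
  the range of \<open>\<Sigma>21(z)\<close> leads to w in the range of the root of P with w =
  conj(z) T' w, T' the adjoint of T. This forces w = 0 as long as |z| times the norm of T is below
  1, and admissibility puts no bound on that norm. The identity theorem carries the equality of the
  two parameters to the whole disk. The function spaces are given by axioms, so that the response to
  \<open>(x, f)\<close> lies in \<open>H(K_S)\<close> has to be proved. The adjoint of the
  coisometry is therefore constructed on kernel functions, where it is explicit, and the rest
  follows by projection onto a closed subspace.\<close>

lemma scaleC_zero_left [simp]: "0 *\<^sub>C (x::'a::chilbert) = 0"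
  using scaleR_scaleC[of 0 x] by simp

lemma scaleC_one [simp]: "1 *\<^sub>C (x::'a::chilbert) = x"
  using scaleR_scaleC[of 1 x] by simp

lemma scaleC_zero_right [simp]: "a *\<^sub>C (0::'a::chilbert) = 0"
  using scaleC_scaleC[of a 0 "0::'a"] by simp

lemma scaleC_minus_left [simp]: "(- a) *\<^sub>C (x::'a::chilbert) = - (a *\<^sub>C x)"
  using scaleC_add_left[of a "-a" x]
  by (simp only: add.right_inverse scaleC_zero_left) (metis minus_unique)

lemma scaleC_minus_right [simp]: "a *\<^sub>C (- x::'a::chilbert) = - (a *\<^sub>C x)"
  using scaleC_add_right[of a x "-x"]
  by (simp only: add.right_inverse scaleC_zero_right) (metis minus_unique)

lemma scaleC_diff_right: "a *\<^sub>C (x - y::'a::chilbert) = a *\<^sub>C x - a *\<^sub>C y"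
  using scaleC_add_right[of a x "-y"] by simp

lemma scaleC_diff_left: "(a - b) *\<^sub>C (x::'a::chilbert) = a *\<^sub>C x - b *\<^sub>C x"
  using scaleC_add_left[of a "-b" x] by simp

lemma cinner_add_right: "cinner x (y + w) = cinner x y + cinner x (w::'a::chilbert)"
  by (metis cinner_add_left cinner_commute complex_cnj_add)

lemma cinner_scaleC_right: "cinner x (a *\<^sub>C y) = cnj a * cinner x (y::'a::chilbert)"
  by (metis cinner_commute cinner_scaleC_left complex_cnj_mult)

lemma cinner_zero_left [simp]: "cinner 0 (y::'a::chilbert) = 0"
  using cinner_scaleC_left[of 0 0 y] by simp

lemma cinner_zero_right [simp]: "cinner y (0::'a::chilbert) = 0"
  by (metis cinner_zero_left cinner_commute complex_cnj_zero)

lemma cinner_minus_left [simp]: "cinner (- x) (y::'a::chilbert) = - cinner x y"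
  using cinner_add_left[of x "-x" y]
  by (simp only: add.right_inverse cinner_zero_left) (metis minus_unique)

lemma cinner_minus_right [simp]: "cinner x (- y::'a::chilbert) = - cinner x y"
  using cinner_scaleC_right[of x "-1" y] by simp

lemma cinner_diff_left: "cinner (x - y) (w::'a::chilbert) = cinner x w - cinner y w"
  using cinner_add_left[of x "-y" w] by simp

lemma cinner_diff_right: "cinner w (x - y::'a::chilbert) = cinner w x - cinner w y"
  using cinner_add_right[of w x "-y"] by simp

lemma cinner_self: "cinner x x = complex_of_real ((norm (x::'a::chilbert))\<^sup>2)"
proof (rule complex_eqI)
  have "0 \<le> sqrt (Re (cinner x x))"
    by (simp flip: norm_eq_sqrt_cinner)
  then show "Re (cinner x x) = Re (complex_of_real ((norm x)\<^sup>2))"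
    by (simp add: norm_eq_sqrt_cinner)
  show "Im (cinner x x) = Im (complex_of_real ((norm x)\<^sup>2))"
    using arg_cong[OF cinner_commute[of x x], of Im] by simp
qed
lemma norm_scaleC [simp]: "norm (a *\<^sub>C (x::'a::chilbert)) = cmod a * norm x"
proof -
  have "complex_of_real ((norm (a *\<^sub>C x))\<^sup>2) = complex_of_real ((cmod a * norm x)\<^sup>2)"
    using cinner_self[of "a *\<^sub>C x"] complex_norm_square[of a]
    by (simp add: cinner_scaleC_left cinner_scaleC_right cinner_self[of x] power_mult_distrib complex_norm_square
        mult.commute[of a "cnj a"] flip: mult.assoc)
  then have "(norm (a *\<^sub>C x))\<^sup>2 = (cmod a * norm x)\<^sup>2"
    by (simp only: of_real_eq_iff)
  then show ?thesis by simp
qed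

lemma norm_add_sq: "(norm (x + y::'a::chilbert))\<^sup>2 = (norm x)\<^sup>2 + (norm y)\<^sup>2 + 2 * Re (cinner x y)"
proof -
  have "Re (cinner (x + y) (x + y)) = Re (cinner x x) + Re (cinner y y) + 2 * Re (cinner x y)"
    using cinner_commute[of y x] by (simp add: cinner_add_left cinner_add_right)
  then show ?thesis by (simp add: cinner_self)
qed

lemma norm_diff_sq: "(norm (x - y::'a::chilbert))\<^sup>2 = (norm x)\<^sup>2 + (norm y)\<^sup>2 - 2 * Re (cinner x y)"
  using norm_add_sq[of x "- y"] by simp

lemma norm_Pair_sq: "(norm (a, b))\<^sup>2 = (norm a)\<^sup>2 + (norm b)\<^sup>2"
  by (simp add: norm_Pair)

lemma norm_add_orth: "cinner x y = 0 \<Longrightarrow> (norm (x + y::'a::chilbert))\<^sup>2 = (norm x)\<^sup>2 + (norm y)\<^sup>2"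
  by (simp add: norm_add_sq)

lemma cinner_eq_zero_iff [simp]: "cinner x x = 0 \<longleftrightarrow> x = (0::'a::chilbert)"
  by (simp add: cinner_self)

lemma cinner_eqI: "(\<And>v. cinner v x = cinner v y) \<Longrightarrow> x = (y::'a::chilbert)"
  using cinner_eq_zero_iff[of "x - y"] by (simp add: cinner_diff_right)

lemma Cauchy_Schwarz_cinner: "cmod (cinner x y) \<le> norm x * norm (y::'a::chilbert)"
proof (cases "y = 0")
  case False
  define c where "c = cinner x y / complex_of_real ((norm y)\<^sup>2)"
  have "0 \<le> (norm (x - c *\<^sub>C y))\<^sup>2" by simp
  also have "\<dots> = Re (cinner (x - c *\<^sub>C y) (x - c *\<^sub>C y))"
    by (simp add: cinner_self)
  also have "cinner (x - c *\<^sub>C y) (x - c *\<^sub>C y)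
      = cinner x x - cnj c * cinner x y - c * cinner y x + c * cnj c * cinner y y"
    by (simp add: cinner_diff_left cinner_diff_right cinner_scaleC_left cinner_scaleC_right algebra_simps)
  also have "cinner y x = cnj (cinner x y)" by (rule cinner_commute)
  also have "cinner x x - cnj c * cinner x y - c * cnj (cinner x y) + c * cnj c * cinner y y
      = complex_of_real ((norm x)\<^sup>2 - (cmod (cinner x y))\<^sup>2 / (norm y)\<^sup>2)"
    using False complex_norm_square[of "cinner x y"]
    by (simp add: c_def cinner_self field_simps power2_eq_square)
  finally have "(cmod (cinner x y))\<^sup>2 \<le> (norm x * norm y)\<^sup>2"
    using False by (simp add: field_simps power_mult_distrib)
  then show ?thesis by (rule power2_le_imp_le) simp
qed simp

lemma bounded_bilinear_cinner: "bounded_bilinear (cinner :: 'a::chilbert \<Rightarrow> 'a \<Rightarrow> complex)"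
proof
  fix a a' b b' :: 'a and r :: real
  show "cinner (r *\<^sub>R a) b = r *\<^sub>R cinner a b"
    by (simp add: scaleR_scaleC cinner_scaleC_left scaleR_conv_of_real)
  show "cinner a (r *\<^sub>R b) = r *\<^sub>R cinner a b"
    by (simp add: scaleR_scaleC cinner_scaleC_right scaleR_conv_of_real)
  show "\<exists>K. \<forall>a b::'a. cmod (cinner a b) \<le> norm a * norm b * K"
    using Cauchy_Schwarz_cinner by (intro exI[of _ 1]) auto
qed (simp_all add: cinner_add_left cinner_add_right)

lemma bounded_bilinear_scaleC: "bounded_bilinear (scaleC :: complex \<Rightarrow> 'a::chilbert \<Rightarrow> 'a)"
proof
  fix a :: complex and b :: 'a and r :: real
  show "(r *\<^sub>R a) *\<^sub>C b = r *\<^sub>R a *\<^sub>C b"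
    by (simp add: scaleR_scaleC scaleC_scaleC scaleR_conv_of_real)
  show "a *\<^sub>C r *\<^sub>R b = r *\<^sub>R a *\<^sub>C b"
    by (simp add: scaleR_scaleC scaleC_scaleC mult.commute)
  show "\<exists>K. \<forall>a (b::'a). norm (a *\<^sub>C b) \<le> norm a * norm b * K"
    by (intro exI[of _ 1]) auto
qed (simp_all add: scaleC_add_left scaleC_add_right)

lemmas tendsto_cinner [tendsto_intros] = bounded_bilinear.tendsto[OF bounded_bilinear_cinner]
lemmas tendsto_scaleC [tendsto_intros] = bounded_bilinear.tendsto[OF bounded_bilinear_scaleC]
lemmas continuous_on_cinner [continuous_intros] =
  bounded_bilinear.continuous_on[OF bounded_bilinear_cinner]
lemmas continuous_on_scaleC [continuous_intros] =
  bounded_bilinear.continuous_on[OF bounded_bilinear_scaleC]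

section \<open>Bounded complex-linear maps\<close>

lemma bounded_clinearI:
  assumes "\<And>x y. f (x + y) = f x + f y" and "\<And>c x. f (c *\<^sub>C x) = c *\<^sub>C f x"
    and "\<And>x. norm (f x) \<le> K * norm x"
  shows "bounded_clinear f"
  unfolding bounded_clinear_def
  by (auto intro!: bounded_linear_intro[of _ K] simp: assms scaleR_scaleC mult.commute)

lemma bounded_clinear_bounded_linear: "bounded_clinear f \<Longrightarrow> bounded_linear f"
  by (simp add: bounded_clinear_def)

lemma bounded_clinear_add: "bounded_clinear f \<Longrightarrow> f (x + y) = f x + f y"
  by (simp add: bounded_clinear_def bounded_linear.axioms linear_add)

lemma bounded_clinear_diff: "bounded_clinear f \<Longrightarrow> f (x - y) = f x - f y"
  by (simp add: bounded_clinear_def bounded_linear.axioms linear_diff)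

lemma bounded_clinear_zero: "bounded_clinear f \<Longrightarrow> f 0 = 0"
  by (simp add: bounded_clinear_def bounded_linear.axioms linear_0)

lemma bounded_clinear_scaleC: "bounded_clinear f \<Longrightarrow> f (c *\<^sub>C x) = c *\<^sub>C f x"
  by (simp add: bounded_clinear_def)

lemma bounded_clinear_tendsto:
  "bounded_clinear f \<Longrightarrow> (g \<longlongrightarrow> a) F \<Longrightarrow> ((\<lambda>x. f (g x)) \<longlongrightarrow> f a) F"
  by (rule bounded_linear.tendsto[OF bounded_clinear_bounded_linear])

lemma bounded_clinear_compose:
  "bounded_clinear f \<Longrightarrow> bounded_clinear g \<Longrightarrow> bounded_clinear (\<lambda>x. f (g x))"
  by (auto simp: bounded_clinear_def intro: bounded_linear_compose)

lemma bounded_clinear_contraction: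
  "bounded_clinear f \<Longrightarrow> onorm f \<le> 1 \<Longrightarrow> norm (f x) \<le> norm x"
  using onorm[OF bounded_clinear_bounded_linear, of f x] mult_right_mono[of "onorm f" 1 "norm x"]
  by simp

section \<open>Complex-linear subspaces and their closures\<close>

definition csubspace :: "'a::chilbert set \<Rightarrow> bool" where
  "csubspace M \<longleftrightarrow> 0 \<in> M \<and> (\<forall>x\<in>M. \<forall>y\<in>M. x + y \<in> M) \<and> (\<forall>c. \<forall>x\<in>M. c *\<^sub>C x \<in> M)"

lemma csubspace_zero: "csubspace M \<Longrightarrow> 0 \<in> M"
  and csubspace_add: "csubspace M \<Longrightarrow> x \<in> M \<Longrightarrow> y \<in> M \<Longrightarrow> x + y \<in> M"
  and csubspace_scaleC: "csubspace M \<Longrightarrow> x \<in> M \<Longrightarrow> c *\<^sub>C x \<in> M"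
  by (auto simp: csubspace_def)

lemma csubspace_diff: "csubspace M \<Longrightarrow> x \<in> M \<Longrightarrow> y \<in> M \<Longrightarrow> x - y \<in> M"
  using csubspace_add[of M x "- y"] csubspace_scaleC[of M y "-1"] by simp

lemma csubspace_closure:
  assumes "csubspace M"
  shows "csubspace (closure M)"
  unfolding csubspace_def
proof (intro conjI ballI allI)
  show "0 \<in> closure M"
    using assms closure_subset by (auto simp: csubspace_def)
  fix x assume "x \<in> closure M"
  then obtain f where f: "\<And>n. f n \<in> M" "f \<longlonglongrightarrow> x"
    by (auto simp: closure_sequential)
  show "c *\<^sub>C x \<in> closure M" for c
    unfolding closure_sequential
    using f assms by (intro exI[of _ "\<lambda>n. c *\<^sub>C f n"]) (auto intro!: tendsto_intros csubspace_scaleC)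
  fix y assume "y \<in> closure M"
  then obtain g where g: "\<And>n. g n \<in> M" "g \<longlonglongrightarrow> y"
    by (auto simp: closure_sequential)
  show "x + y \<in> closure M"
    unfolding closure_sequential
    using f g assms by (intro exI[of _ "\<lambda>n. f n + g n"]) (auto intro!: tendsto_intros csubspace_add)
qed

lemma csubspace_range: "bounded_clinear f \<Longrightarrow> csubspace (range f)"
  unfolding csubspace_def
  by (auto simp flip: bounded_clinear_add bounded_clinear_scaleC)
    (simp add: image_iff, metis bounded_clinear_zero)

lemma csubspace_orth_compl: "csubspace (orth_compl M)"
  by (auto simp: csubspace_def orth_compl_def cinner_add_left cinner_scaleC_left)

lemma csubspace_Int: "csubspace M \<Longrightarrow> csubspace M' \<Longrightarrow> csubspace (M \<inter> M')"
  by (auto simp: csubspace_def)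

lemma csubspace_Times_UNIV: "csubspace M \<Longrightarrow> csubspace (M \<times> UNIV)"
  by (auto simp: csubspace_def scaleC_prod_def zero_prod_def)

lemma bounded_clinear_Pair:
  "bounded_clinear f \<Longrightarrow> bounded_clinear g \<Longrightarrow> bounded_clinear (\<lambda>x. (f x, g x))"
  by (auto simp: bounded_clinear_def scaleC_prod_def intro: bounded_linear_Pair)

lemma cinner_Pair [simp]: "cinner (a, b) (c, d) = cinner a c + cinner b d"
  by (simp add: cinner_prod_def)

lemma scaleC_Pair [simp]: "a *\<^sub>C (b, c) = (a *\<^sub>C b, a *\<^sub>C c)"
  by (simp add: scaleC_prod_def)

section \<open>The Riesz representation theorem\<close>

text \<open>A Hilbert space structure on a subset of an additive group: it covers closed subspaces of
  a Hilbert space as well as spaces of functions.\<close>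

locale ip_space_on =
  fixes V :: "'v::ab_group_add set" and sc :: "complex \<Rightarrow> 'v \<Rightarrow> 'v" and ip :: "'v \<Rightarrow> 'v \<Rightarrow> complex"
  assumes zero_in: "0 \<in> V"
    and add_in: "x \<in> V \<Longrightarrow> y \<in> V \<Longrightarrow> x + y \<in> V"
    and sc_in: "x \<in> V \<Longrightarrow> sc c x \<in> V"
    and ip_commute: "x \<in> V \<Longrightarrow> y \<in> V \<Longrightarrow> ip x y = cnj (ip y x)"
    and ip_add_left: "x \<in> V \<Longrightarrow> y \<in> V \<Longrightarrow> w \<in> V \<Longrightarrow> ip (x + y) w = ip x w + ip y w"
    and ip_sc_left: "x \<in> V \<Longrightarrow> y \<in> V \<Longrightarrow> ip (sc c x) y = c * ip x y"
    and ip_nonneg: "x \<in> V \<Longrightarrow> 0 \<le> Re (ip x x)"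
    and ip_eq_0: "x \<in> V \<Longrightarrow> ip x x = 0 \<Longrightarrow> x = 0"
begin

text \<open>The locale has no module axioms for \<open>sc\<close>; equations between vectors come
  from definiteness instead, here from the fact that \<open>x + sc (-1) x\<close> has inner product
  0 with itself.\<close>

lemma uminus_sc: assumes x: "x \<in> V" shows "- x = sc (-1) x"
proof (rule minus_unique)
  let ?y = "x + sc (-1) x"
  have y: "?y \<in> V" by (intro add_in sc_in x)
  have "ip ?y ?y = ip x ?y + (-1) * ip x ?y"
    using ip_add_left[OF x sc_in[OF x] y] ip_sc_left[OF x y] by simp
  then show "?y = 0" using ip_eq_0[OF y] by simp
qed

lemma uminus_in: "x \<in> V \<Longrightarrow> - x \<in> V"
  by (simp add: uminus_sc sc_in)

lemma diff_in: "x \<in> V \<Longrightarrow> y \<in> V \<Longrightarrow> x - y \<in> V"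
  using add_in[of x "- y"] uminus_in by simp

lemma ip_diff_left: "x \<in> V \<Longrightarrow> y \<in> V \<Longrightarrow> w \<in> V \<Longrightarrow> ip (x - y) w = ip x w - ip y w"
  using ip_add_left[of x "- y" w] ip_sc_left[of y w "-1"] by (simp add: uminus_in uminus_sc[symmetric])

lemma ip_add_right: "x \<in> V \<Longrightarrow> y \<in> V \<Longrightarrow> w \<in> V \<Longrightarrow> ip w (x + y) = ip w x + ip w y"
  using ip_commute[of w "x + y"] ip_commute[of w x] ip_commute[of w y]
  by (simp add: ip_add_left add_in)

lemma ip_diff_right: "x \<in> V \<Longrightarrow> y \<in> V \<Longrightarrow> w \<in> V \<Longrightarrow> ip w (x - y) = ip w x - ip w y"
  using ip_commute[of w "x - y"] ip_commute[of w x] ip_commute[of w y]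
  by (simp add: ip_diff_left diff_in)

lemma ip_sc_right: "x \<in> V \<Longrightarrow> y \<in> V \<Longrightarrow> ip y (sc c x) = cnj c * ip y x"
  using ip_commute[of y "sc c x"] ip_commute[of y x] by (simp add: ip_sc_left sc_in)

lemma ip_zero_left: "y \<in> V \<Longrightarrow> ip 0 y = 0"
  using ip_diff_left[of y y y] by simp

lemma ip_zero_right: "y \<in> V \<Longrightarrow> ip y 0 = 0"
  using ip_diff_right[of y y y] by simp

lemma ip_self: "x \<in> V \<Longrightarrow> ip x x = complex_of_real (Re (ip x x))"
  using arg_cong[OF ip_commute[of x x], of Im] by (simp add: complex_eq_iff)

lemma Re_ip_add:
  "x \<in> V \<Longrightarrow> y \<in> V \<Longrightarrow> Re (ip (x + y) (x + y)) = Re (ip x x) + Re (ip y y) + 2 * Re (ip x y)"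
  using arg_cong[OF ip_commute[of x y], of Re]
  by (simp add: ip_add_left ip_add_right add_in)

lemma Re_ip_diff:
  "x \<in> V \<Longrightarrow> y \<in> V \<Longrightarrow> Re (ip (x - y) (x - y)) = Re (ip x x) + Re (ip y y) - 2 * Re (ip x y)"
  using arg_cong[OF ip_commute[of x y], of Re]
  by (simp add: ip_diff_left ip_diff_right diff_in)

lemma Re_ip_sc: "x \<in> V \<Longrightarrow> Re (ip (sc c x) (sc c x)) = (cmod c)\<^sup>2 * Re (ip x x)"
proof -
  assume x: "x \<in> V"
  have "ip (sc c x) (sc c x) = complex_of_real ((cmod c)\<^sup>2) * ip x x"
    using x by (simp add: ip_sc_left ip_sc_right sc_in complex_norm_square flip: mult.assoc del: of_real_power)
  then show ?thesis by (simp del: of_real_power)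
qed

lemma ip_norm_nonneg: "x \<in> V \<Longrightarrow> 0 \<le> ip_norm ip x"
  by (simp add: ip_norm_def ip_nonneg)

lemma ip_norm_sq: "x \<in> V \<Longrightarrow> (ip_norm ip x)\<^sup>2 = Re (ip x x)"
  by (simp add: ip_norm_def ip_nonneg)

lemma ip_norm_eq_0: "x \<in> V \<Longrightarrow> ip_norm ip x = 0 \<Longrightarrow> x = 0"
  using ip_self[of x] ip_eq_0[of x] by (simp add: ip_norm_def)

lemma Cauchy_Schwarz:
  assumes x: "x \<in> V" and y: "y \<in> V"
  shows "cmod (ip x y) \<le> ip_norm ip x * ip_norm ip y"
proof (cases "y = 0")
  case True
  then show ?thesis using x by (simp add: ip_zero_right ip_norm_def zero_in)
next
  case False
  define r where "r = Re (ip y y)"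
  have r: "r > 0"
    using False ip_eq_0[OF y] ip_self[OF y] ip_nonneg[OF y] unfolding r_def by (metis less_eq_real_def of_real_0)
  define c where "c = ip x y / complex_of_real r"
  have "0 \<le> Re (ip (x - sc c y) (x - sc c y))"
    by (intro ip_nonneg diff_in sc_in x y)
  also have "\<dots> = Re (ip x x) + (cmod c)\<^sup>2 * r - 2 * Re (ip x (sc c y))"
    by (simp add: Re_ip_diff x y sc_in Re_ip_sc r_def)
  also have "ip x (sc c y) = complex_of_real ((cmod (ip x y))\<^sup>2 / r)"
    using r by (simp add: ip_sc_right x y c_def complex_norm_square mult.commute del: of_real_power)
  also have "(cmod c)\<^sup>2 * r = (cmod (ip x y))\<^sup>2 / r"
    using r by (simp add: c_def norm_divide power_divide field_simps power2_eq_square)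
  finally have "(cmod (ip x y))\<^sup>2 \<le> Re (ip x x) * r"
    using r by (simp add: field_simps)
  then have "(cmod (ip x y))\<^sup>2 \<le> (ip_norm ip x * ip_norm ip y)\<^sup>2"
    by (simp add: power_mult_distrib ip_norm_sq x y r_def)
  then show ?thesis
    by (rule power2_le_imp_le) (simp add: ip_norm_nonneg x y)
qed

lemma ip_norm_triangle:
  assumes x: "x \<in> V" and y: "y \<in> V"
  shows "ip_norm ip (x + y) \<le> ip_norm ip x + ip_norm ip y"
proof -
  have "Re (ip x y) \<le> ip_norm ip x * ip_norm ip y"
    using Cauchy_Schwarz[OF x y] complex_Re_le_cmod order_trans by blast
  then have "(ip_norm ip (x + y))\<^sup>2 \<le> (ip_norm ip x + ip_norm ip y)\<^sup>2"
    by (simp add: ip_norm_sq x y add_in Re_ip_add power2_sum)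
  then show ?thesis by (rule power2_le_imp_le) (simp add: ip_norm_nonneg x y)
qed

lemma ip_norm_minus_commute:
  assumes x: "x \<in> V" and y: "y \<in> V"
  shows "ip_norm ip (x - y) = ip_norm ip (y - x)"
  using Re_ip_sc[OF diff_in[OF x y], of "-1"] uminus_sc[OF diff_in[OF x y]] by (simp add: ip_norm_def)

lemma ip_norm_Cauchy:
  assumes F: "\<And>n. F n \<in> V" and f: "f \<in> V" and lim: "(\<lambda>n. ip_norm ip (F n - f)) \<longlonglongrightarrow> 0" and e: "e > 0"
  shows "\<exists>n0. \<forall>m\<ge>n0. \<forall>n\<ge>n0. ip_norm ip (F m - F n) < e"
proof -
  obtain n0 where n0: "\<And>n. n \<ge> n0 \<Longrightarrow> ip_norm ip (F n - f) < e / 2"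
    using LIMSEQ_D[OF lim, of "e / 2"] e by (auto simp: ip_norm_nonneg diff_in F f)
  show ?thesis
  proof (intro exI allI impI)
    fix m n assume "m \<ge> n0" "n \<ge> n0"
    then have "ip_norm ip (F m - f) + ip_norm ip (f - F n) < e"
      using n0[of m] n0[of n] ip_norm_minus_commute[OF f F, of n] by simp
    moreover have "ip_norm ip (F m - F n) \<le> ip_norm ip (F m - f) + ip_norm ip (f - F n)"
      using ip_norm_triangle[of "F m - f" "f - F n"] diff_in F f by simp
    ultimately show "ip_norm ip (F m - F n) < e" by linarith
  qed
qed

lemma tendsto_ip_right:
  assumes F: "\<And>n. F n \<in> V" and f: "f \<in> V" and h: "h \<in> V"
    and lim: "(\<lambda>n. ip_norm ip (F n - f)) \<longlonglongrightarrow> 0"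
  shows "(\<lambda>n. ip h (F n)) \<longlonglongrightarrow> ip h f"
proof (rule Lim_transform)
  show "(\<lambda>n. ip h f) \<longlonglongrightarrow> ip h f" by simp
  have "(\<lambda>n. ip_norm ip h * ip_norm ip (F n - f)) \<longlonglongrightarrow> ip_norm ip h * 0"
    by (intro tendsto_intros lim)
  then have "(\<lambda>n. ip_norm ip h * ip_norm ip (F n - f)) \<longlonglongrightarrow> 0" by simp
  moreover have "\<forall>n. norm (ip h (F n - f)) \<le> ip_norm ip h * ip_norm ip (F n - f)"
    by (intro allI Cauchy_Schwarz diff_in F f h)
  ultimately have "(\<lambda>n. ip h (F n - f)) \<longlonglongrightarrow> 0"
    by (metis (no_types, lifting) Lim_null_comparison always_eventually)
  then show "(\<lambda>n. ip h (F n) - ip h f) \<longlonglongrightarrow> 0"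
    by (simp add: ip_diff_right F f h)
qed

lemma tendsto_ip_left:
  assumes F: "\<And>n. F n \<in> V" and f: "f \<in> V" and h: "h \<in> V"
    and lim: "(\<lambda>n. ip_norm ip (F n - f)) \<longlonglongrightarrow> 0"
  shows "(\<lambda>n. ip (F n) h) \<longlonglongrightarrow> ip f h"
  using tendsto_cnj[OF tendsto_ip_right[OF assms]] by (simp flip: ip_commute add: F f h)

end

locale hilbert_on = ip_space_on +
  assumes complete:
    "(\<And>n::nat. F n \<in> V) \<Longrightarrow> (\<And>e. e > 0 \<Longrightarrow> \<exists>n0. \<forall>m\<ge>n0. \<forall>n\<ge>n0. ip_norm ip (F m - F n) < e) \<Longrightarrow>
      \<exists>f\<in>V. (\<lambda>n. ip_norm ip (F n - f)) \<longlonglongrightarrow> 0"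
begin

text \<open>The representing vector minimises \<open>\<parallel>v\<parallel>\<^sup>2 - 2 Re (\<phi> v)\<close>; minimising sequences are Cauchy by
  the parallelogram law.\<close>

theorem Riesz:
  assumes add: "\<And>v w. v \<in> V \<Longrightarrow> w \<in> V \<Longrightarrow> \<phi> (v + w) = \<phi> v + \<phi> w"
    and sc: "\<And>c v. v \<in> V \<Longrightarrow> \<phi> (sc c v) = c * \<phi> v"
    and bd: "\<And>v. v \<in> V \<Longrightarrow> cmod (\<phi> v) \<le> C * ip_norm ip v"
  shows "\<exists>p\<in>V. \<forall>v\<in>V. \<phi> v = ip v p"
proof -
  define J where "J v = Re (ip v v) - 2 * Re (\<phi> v)" for v
  define m where "m = Inf (J ` V)"
  have low: "- C\<^sup>2 \<le> J v" if v: "v \<in> V" for v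
  proof -
    have "Re (\<phi> v) \<le> C * ip_norm ip v"
      using bd[OF v] complex_Re_le_cmod order_trans by blast
    moreover have "0 \<le> (ip_norm ip v - C)\<^sup>2" by simp
    ultimately show ?thesis
      using ip_norm_sq[OF v] by (simp add: J_def power2_diff algebra_simps)
  qed
  have bdd: "bdd_below (J ` V)"
    using low by (intro bdd_belowI[of _ "- C\<^sup>2"]) auto
  have m_le: "m \<le> J v" if "v \<in> V" for v
    unfolding m_def using bdd that by (intro cInf_lower) auto
  have "\<exists>v\<in>V. J v < m + inverse (real (Suc n))" for n
    using cInf_lessD[of "J ` V" "m + inverse (real (Suc n))"] zero_in by (auto simp: m_def)
  then obtain F where F: "\<And>n. F n \<in> V" and JF: "\<And>n. J (F n) < m + inverse (real (Suc n))"
    by metis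
  \<comment> \<open>Parallelogram law, with the value of \<open>J\<close> at the midpoint of u and v
    bounded below by m.\<close>
  have par: "Re (ip (u - v) (u - v)) \<le> 2 * J u + 2 * J v - 4 * m" if u: "u \<in> V" and v: "v \<in> V" for u v
  proof -
    have "m \<le> J (sc (1/2) (u + v))" by (intro m_le sc_in add_in u v)
    also have "\<dots> = Re (ip (u + v) (u + v)) / 4 - Re (\<phi> u) - Re (\<phi> v)"
      using u v by (simp add: J_def Re_ip_sc sc add add_in power_divide add_divide_distrib)
    finally show ?thesis
      using u v by (simp add: Re_ip_add Re_ip_diff J_def field_simps)
  qed
  have "\<exists>p\<in>V. (\<lambda>n. ip_norm ip (F n - p)) \<longlonglongrightarrow> 0"
  proof (rule complete[OF F])
    fix e :: real assume e: "e > 0"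
    obtain n0 :: nat where n0: "inverse (real (Suc n0)) < e\<^sup>2 / 4"
      using e reals_Archimedean[of "e\<^sup>2 / 4"] by auto
    show "\<exists>n0. \<forall>m\<ge>n0. \<forall>n\<ge>n0. ip_norm ip (F m - F n) < e"
    proof (intro exI allI impI)
      fix k n assume kn: "k \<ge> n0" "n \<ge> n0"
      have "inverse (real (Suc k)) \<le> inverse (real (Suc n0))"
        "inverse (real (Suc n)) \<le> inverse (real (Suc n0))"
        using kn by (simp_all add: le_imp_inverse_le)
      then have "Re (ip (F k - F n) (F k - F n)) < e\<^sup>2"
        using par[OF F F, of k n] JF[of k] JF[of n] n0 by linarith
      then show "ip_norm ip (F k - F n) < e"
        unfolding ip_norm_def using e by (simp add: real_less_lsqrt)
    qed
  qed
  then obtain p where p: "p \<in> V" and lim: "(\<lambda>n. ip_norm ip (F n - p)) \<longlonglongrightarrow> 0" by blast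
  show ?thesis
  proof (intro bexI[of _ p] ballI p)
    fix v assume v: "v \<in> V"
    define D where "D = ip v p - \<phi> v"
    \<comment> \<open>Moving the minimiser by \<open>sc c v\<close> changes \<open>J\<close> by the
      linear term \<open>-2 s |D|^2\<close> and a quadratic term at most \<open>s |D|^2\<close>,
      because \<open>s * Re (ip v v) \<le> 1\<close>. The \<open>+ 1\<close> keeps s defined for v =
      0.\<close>
    define s where "s = 1 / (Re (ip v v) + 1)"
    define c where "c = - complex_of_real s * cnj D"
    have s: "s > 0" "s * Re (ip v v) \<le> 1"
      using ip_nonneg[OF v] by (auto simp: s_def field_simps)
    \<comment> \<open>The variation is made at \<open>F n\<close>, whose value of \<open>J\<close>
      is within \<open>1 / (n + 1)\<close> of the infimum; the limit in n then moves it to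
      p.\<close>
    have ge: "0 \<le> (cmod c)\<^sup>2 * Re (ip v v) + 2 * Re (ip (sc c v) (F n)) - 2 * Re (c * \<phi> v)
        + inverse (real (Suc n))" for n
    proof -
      have "m \<le> J (F n + sc c v)" by (intro m_le add_in sc_in v F)
      also have "\<dots> = J (F n) + (cmod c)\<^sup>2 * Re (ip v v) + 2 * Re (ip (F n) (sc c v)) - 2 * Re (c * \<phi> v)"
        unfolding J_def using F v by (simp add: Re_ip_add Re_ip_sc sc_in add sc)
      also have "Re (ip (F n) (sc c v)) = Re (ip (sc c v) (F n))"
        using arg_cong[OF ip_commute[OF F[of n] sc_in[OF v, of c]], of Re] by simp
      finally show ?thesis using JF[of n] by simp
    qed
    have "(\<lambda>n. (cmod c)\<^sup>2 * Re (ip v v) + 2 * Re (ip (sc c v) (F n)) - 2 * Re (c * \<phi> v)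
        + inverse (real (Suc n)))
      \<longlonglongrightarrow> (cmod c)\<^sup>2 * Re (ip v v) + 2 * Re (ip (sc c v) p) - 2 * Re (c * \<phi> v) + 0"
      by (intro tendsto_intros tendsto_ip_right[OF F p sc_in[OF v] lim] LIMSEQ_inverse_real_of_nat)
    then have "0 \<le> (cmod c)\<^sup>2 * Re (ip v v) + 2 * Re (ip (sc c v) p) - 2 * Re (c * \<phi> v) + 0"
      by (rule LIMSEQ_le_const) (use ge in blast)
    also have "\<dots> = (cmod c)\<^sup>2 * Re (ip v v) + 2 * Re (c * D)"
      using v p by (simp add: ip_sc_left D_def algebra_simps)
    also have "c * D = - complex_of_real (s * (cmod D)\<^sup>2)"
      using complex_norm_square[of D] by (simp add: c_def algebra_simps)
    also have "(cmod c)\<^sup>2 = s\<^sup>2 * (cmod D)\<^sup>2"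
      using s by (simp add: c_def norm_mult power_mult_distrib)
    finally have "2 * (s * (cmod D)\<^sup>2) \<le> s * (cmod D)\<^sup>2 * (s * Re (ip v v))"
      by (simp add: power2_eq_square algebra_simps)
    also have "\<dots> \<le> s * (cmod D)\<^sup>2 * 1"
      using s by (intro mult_left_mono) auto
    finally have "s * (cmod D)\<^sup>2 \<le> 0" by simp
    then have "D = 0" using s by (simp add: mult_le_0_iff)
    then show "\<phi> v = ip v p" by (simp add: D_def)
  qed
qed

lemma closed_subspace:
  assumes "M \<subseteq> V" "0 \<in> M" "\<And>x y. x \<in> M \<Longrightarrow> y \<in> M \<Longrightarrow> x + y \<in> M" "\<And>c x. x \<in> M \<Longrightarrow> sc c x \<in> M"
    and closed: "\<And>F f. (\<And>n::nat. F n \<in> M) \<Longrightarrow> f \<in> V \<Longrightarrow> (\<lambda>n. ip_norm ip (F n - f)) \<longlonglongrightarrow> 0 \<Longrightarrow> f \<in> M"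
  shows "hilbert_on M sc ip"
proof
  fix F assume F: "\<And>n::nat. F n \<in> M"
    and C: "\<And>e. e > 0 \<Longrightarrow> \<exists>n0. \<forall>m\<ge>n0. \<forall>n\<ge>n0. ip_norm ip (F m - F n) < e"
  then obtain f where "f \<in> V" "(\<lambda>n. ip_norm ip (F n - f)) \<longlonglongrightarrow> 0"
    using complete[of F] assms(1) by blast
  then show "\<exists>f\<in>M. (\<lambda>n. ip_norm ip (F n - f)) \<longlonglongrightarrow> 0"
    using closed[of F] F by blast
qed (use assms(1-4) in \<open>auto simp: subset_iff intro: ip_commute ip_add_left ip_sc_left ip_nonneg ip_eq_0\<close>)

text \<open>Riesz on M for the functional that pairs with q; p is the orthogonal projection of q
  onto M, described by inner products only.\<close>

lemma projection:
  assumes M: "hilbert_on M sc ip" and sub: "M \<subseteq> V" and q: "q \<in> V"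
  shows "\<exists>p\<in>M. \<forall>v\<in>M. ip v q = ip v p"
proof -
  interpret M: hilbert_on M sc ip by (rule M)
  show ?thesis
    by (rule M.Riesz[of _ "ip_norm ip q"])
      (use sub q in \<open>auto simp: ip_add_left ip_sc_left subset_iff mult.commute[of "ip_norm ip q"] intro!: Cauchy_Schwarz\<close>)
qed

end

section \<open>Adjoints, orthogonal projections and isometries\<close>

lemma ip_norm_cinner [simp]: "ip_norm cinner x = norm (x::'a::chilbert)"
  by (simp add: ip_norm_def cinner_self)

lemma hilbert_on_closed_csubspace:
  assumes "csubspace M" "closed M"
  shows "hilbert_on M scaleC cinner"
proof
  fix F assume F: "\<And>n::nat. F n \<in> M"
    and C: "\<And>e. e > 0 \<Longrightarrow> \<exists>n0. \<forall>m\<ge>n0. \<forall>n\<ge>n0. ip_norm cinner (F m - F n) < e"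
  have "Cauchy F" unfolding Cauchy_def dist_norm using C by simp
  then obtain f where f: "F \<longlonglongrightarrow> f" using Cauchy_convergent convergentD by blast
  have "f \<in> M" using closed_sequentially[OF assms(2)] F f by blast
  then show "\<exists>f\<in>M. (\<lambda>n. ip_norm cinner (F n - f)) \<longlonglongrightarrow> 0"
    using f by (auto simp: tendsto_norm_zero_iff LIM_zero_iff)
qed (use assms in \<open>auto simp: csubspace_def cinner_add_left cinner_scaleC_left cinner_self intro: cinner_commute\<close>)

lemma Riesz_chilbert:
  fixes M :: "'a::chilbert set"
  assumes "csubspace M" "closed M"
    and "\<And>v w. v \<in> M \<Longrightarrow> w \<in> M \<Longrightarrow> \<phi> (v + w) = \<phi> v + \<phi> w"
    and "\<And>c v. v \<in> M \<Longrightarrow> \<phi> (c *\<^sub>C v) = c * \<phi> v"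
    and "\<And>v. v \<in> M \<Longrightarrow> cmod (\<phi> v) \<le> C * norm v"
  shows "\<exists>p\<in>M. \<forall>v\<in>M. \<phi> v = cinner v p"
proof -
  interpret M: hilbert_on M scaleC cinner by (rule hilbert_on_closed_csubspace) fact+
  show ?thesis by (rule M.Riesz[of \<phi> C]) (use assms in auto)
qed

lemma csubspace_UNIV [simp]: "csubspace UNIV"
  by (simp add: csubspace_def)

text \<open>Riesz provides a vector that fits the definite description, and vectors with the same
  inner products are equal.\<close>

lemma cadjoint:
  assumes f: "bounded_clinear f"
  shows "cinner (f v) y = cinner v (cadjoint f y)"
proof -
  have "\<exists>p\<in>UNIV. \<forall>v\<in>UNIV. cinner (f v) y = cinner v p"
  proof (rule Riesz_chilbert)
    fix v
    have "cmod (cinner (f v) y) \<le> norm (f v) * norm y" by (rule Cauchy_Schwarz_cinner)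
    also have "\<dots> \<le> (onorm f * norm v) * norm y"
      by (intro mult_right_mono onorm bounded_clinear_bounded_linear f) simp
    finally show "cmod (cinner (f v) y) \<le> (onorm f * norm y) * norm v" by (simp add: ac_simps)
  qed (use f in \<open>auto simp: bounded_clinear_add bounded_clinear_scaleC cinner_add_left cinner_scaleC_left\<close>)
  then obtain p where p: "\<forall>v. cinner (f v) y = cinner v p" by blast
  have "\<forall>v. cinner (f v) y = cinner v (cadjoint f y)"
    unfolding cadjoint_def
  proof (rule theI[of _ p])
    show "x = p" if "\<forall>v. cinner (f v) y = cinner v x" for x
      by (rule cinner_eqI) (metis p that)
  qed (fact p)
  then show ?thesis by blast
qed

lemma orth_proj:
  fixes M :: "'a::chilbert set"
  assumes M: "csubspace M" "closed M"
  shows "orth_proj M x \<in> M" "x - orth_proj M x \<in> orth_compl M"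
proof -
  interpret U: hilbert_on "UNIV::'a set" scaleC cinner
    by (rule hilbert_on_closed_csubspace) auto
  obtain p where p: "p \<in> M" "\<And>v. v \<in> M \<Longrightarrow> cinner v x = cinner v p"
    using U.projection[OF hilbert_on_closed_csubspace[OF M], of x] by auto
  have "\<exists>!p. p \<in> M \<and> x - p \<in> orth_compl M"
  proof (intro ex1I conjI)
    show "x - p \<in> orth_compl M"
      using p(2) cinner_commute[of "x - p"] by (auto simp: orth_compl_def cinner_diff_right)
    fix q assume "q \<in> M \<and> x - q \<in> orth_compl M"
    then have q: "q \<in> M" "\<And>v. v \<in> M \<Longrightarrow> cinner (x - q) v = 0" by (auto simp: orth_compl_def)
    have pq: "p - q \<in> M" using csubspace_diff M p q by blast
    have "cinner (p - q) (x - q) = 0" "cinner (p - q) (x - p) = 0"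
      using cinner_commute[of "p - q" "x - q"] q(2)[OF pq] p(2)[OF pq] by (auto simp: cinner_diff_right)
    then have "cinner (p - q) (p - q) = 0" by (simp add: cinner_diff_right)
    then show "q = p" by simp
  qed (fact p)
  from theI'[OF this] show "orth_proj M x \<in> M" "x - orth_proj M x \<in> orth_compl M"
    by (auto simp: orth_proj_def)
qed

lemma orth_proj_unique:
  fixes M :: "'a::chilbert set"
  assumes M: "csubspace M" "closed M" and p: "p \<in> M" "x - p \<in> orth_compl M"
  shows "orth_proj M x = p"
proof -
  have d: "orth_proj M x - p \<in> M" using csubspace_diff M orth_proj[OF M] p by blast
  have "(x - p) - (x - orth_proj M x) \<in> orth_compl M"
    by (intro csubspace_diff csubspace_orth_compl p orth_proj[OF M])
  then have "cinner (orth_proj M x - p) (orth_proj M x - p) = 0"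
    using d by (auto simp: orth_compl_def)
  then show ?thesis by simp
qed

lemma closure_csubspace_eq_UNIV:
  fixes M :: "'a::chilbert set"
  assumes M: "csubspace M" and "\<And>d. (\<And>m. m \<in> M \<Longrightarrow> cinner m d = 0) \<Longrightarrow> d = 0"
  shows "closure M = UNIV"
proof (rule sym, rule UNIV_eq_I)
  fix x
  note cM = csubspace_closure[OF M] closed_closure[of M]
  have "x - orth_proj (closure M) x = 0"
  proof (rule assms(2))
    fix m assume "m \<in> M"
    then have "m \<in> closure M" using closure_subset by blast
    then show "cinner m (x - orth_proj (closure M) x) = 0"
      using orth_proj(2)[OF cM, of x] cinner_commute[of m] by (auto simp: orth_compl_def)
  qed
  then show "x \<in> closure M" using orth_proj(1)[OF cM, of x] by simp
qed

lemma closure_rangeE: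
  fixes a :: "'x \<Rightarrow> 'k::metric_space"
  assumes "w \<in> closure (range a)"
  obtains f where "(\<lambda>n::nat. a (f n)) \<longlonglongrightarrow> w"
proof -
  from assms obtain g where g: "\<forall>n. g n \<in> range a" "g \<longlonglongrightarrow> w"
    unfolding closure_sequential by (elim exE conjE)
  from g(1) have "g n = a (inv a (g n))" for n
    by (simp add: f_inv_into_f)
  then have "g = (\<lambda>n. a (inv a (g n)))" by (rule ext)
  with g(2) show ?thesis by (intro that[of "\<lambda>n. inv a (g n)"]) simp
qed

lemma Cauchy_isometric:
  assumes "Cauchy f" and "\<And>m n. dist (g m) (g n) = dist (f m) (f n)"
  shows "Cauchy g"
  using assms by (simp add: Cauchy_def)

text \<open>The extension is read off from the closure of the graph.\<close>

lemma isometry_extension: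
  fixes a :: "'x::chilbert \<Rightarrow> 'k::chilbert" and b :: "'x \<Rightarrow> 'l::chilbert"
  assumes a: "bounded_clinear a" and b: "bounded_clinear b" and eq: "\<And>x. norm (a x) = norm (b x)"
  shows "\<exists>V. unitary_onto (closure (range a)) (closure (range b)) V \<and> (\<forall>x. V (a x) = b x)"
proof -
  define \<Gamma> where "\<Gamma> = closure (range (\<lambda>x. (a x, b x)))"
  have cs: "csubspace \<Gamma>"
    unfolding \<Gamma>_def by (intro csubspace_closure csubspace_range bounded_clinear_Pair a b)
  have nrm: "norm w = norm l" if wl: "(w, l) \<in> \<Gamma>" for w l
  proof -
    obtain f where f: "(\<lambda>n::nat. (a (f n), b (f n))) \<longlonglongrightarrow> (w, l)"
      using wl unfolding \<Gamma>_def by (rule closure_rangeE)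
    have "(\<lambda>n. norm (a (f n))) \<longlonglongrightarrow> norm w" "(\<lambda>n. norm (b (f n))) \<longlonglongrightarrow> norm l"
      using tendsto_norm[OF tendsto_fst[OF f]] tendsto_norm[OF tendsto_snd[OF f]] by simp_all
    then show ?thesis using LIMSEQ_unique by (simp add: eq)
  qed
  have uniq: "l = l'" if "(w, l) \<in> \<Gamma>" "(w, l') \<in> \<Gamma>" for w l l'
    using nrm[of "w - w" "l - l'"] csubspace_diff[OF cs that] by simp
  have dist_eq: "dist (b x) (b y) = dist (a x) (a y)" for x y
    using eq[of "x - y"] by (simp add: dist_norm bounded_clinear_diff a b)
  have ex: "\<exists>l. (w, l) \<in> \<Gamma>" if w: "w \<in> closure (range a)" for w
  proof -
    obtain f where f: "(\<lambda>n::nat. a (f n)) \<longlonglongrightarrow> w" using w by (rule closure_rangeE)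
    have "Cauchy (\<lambda>n. b (f n))"
      by (rule Cauchy_isometric[OF LIMSEQ_imp_Cauchy[OF f]]) (rule dist_eq)
    then obtain l where lim: "(\<lambda>n. b (f n)) \<longlonglongrightarrow> l" using Cauchy_convergent convergentD by blast
    have "(w, l) \<in> \<Gamma>" unfolding \<Gamma>_def closure_sequential
      by (intro exI[of _ "\<lambda>n. (a (f n), b (f n))"] conjI allI tendsto_Pair f lim) auto
    then show ?thesis by blast
  qed
  have ex': "\<exists>w. (w, l) \<in> \<Gamma>" if l: "l \<in> closure (range b)" for l
  proof -
    obtain f where f: "(\<lambda>n::nat. b (f n)) \<longlonglongrightarrow> l" using l by (rule closure_rangeE)
    have "Cauchy (\<lambda>n. a (f n))"
      by (rule Cauchy_isometric[OF LIMSEQ_imp_Cauchy[OF f]]) (rule dist_eq[symmetric])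
    then obtain w where lim: "(\<lambda>n. a (f n)) \<longlonglongrightarrow> w" using Cauchy_convergent convergentD by blast
    have "(w, l) \<in> \<Gamma>" unfolding \<Gamma>_def closure_sequential
      by (intro exI[of _ "\<lambda>n. (a (f n), b (f n))"] conjI allI tendsto_Pair f lim) auto
    then show ?thesis by blast
  qed
  have in_cl: "w \<in> closure (range a) \<and> l \<in> closure (range b)" if wl: "(w, l) \<in> \<Gamma>" for w l
  proof -
    obtain f where f: "(\<lambda>n::nat. (a (f n), b (f n))) \<longlonglongrightarrow> (w, l)"
      using wl unfolding \<Gamma>_def by (rule closure_rangeE)
    show ?thesis
      unfolding closure_sequential
      using tendsto_fst[OF f] tendsto_snd[OF f]
      by (intro conjI exI[of _ "\<lambda>n. a (f n)"] exI[of _ "\<lambda>n. b (f n)"]) auto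
  qed
  define V where "V w = (THE l. (w, l) \<in> \<Gamma>)" for w
  have V: "V w = l" if "(w, l) \<in> \<Gamma>" for w l
    unfolding V_def using that uniq by blast
  have VG: "(w, V w) \<in> \<Gamma>" if w: "w \<in> closure (range a)" for w
    using ex[OF w] V by auto
  show ?thesis
  proof (intro exI conjI allI)
    show "V (a x) = b x" for x
      by (rule V) (auto simp: \<Gamma>_def intro: subsetD[OF closure_subset])
    show "unitary_onto (closure (range a)) (closure (range b)) V"
      unfolding unitary_onto_def
    proof (intro conjI ballI allI)
      fix x y assume xy: "x \<in> closure (range a)" "y \<in> closure (range a)"
      show "V (x + y) = V x + V y"
        using csubspace_add[OF cs VG[OF xy(1)] VG[OF xy(2)]] by (intro V) simp
    next
      fix c x assume x: "x \<in> closure (range a)"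
      show "V (c *\<^sub>C x) = c *\<^sub>C V x"
        using csubspace_scaleC[OF cs VG[OF x], of c] by (intro V) simp
    next
      fix x assume x: "x \<in> closure (range a)"
      show "norm (V x) = norm x" using nrm[OF VG[OF x]] by simp
    next
      show "V ` closure (range a) = closure (range b)"
      proof (intro equalityI subsetI)
        fix l assume "l \<in> V ` closure (range a)"
        then show "l \<in> closure (range b)" using in_cl VG by blast
      next
        fix l assume "l \<in> closure (range b)"
        then obtain w where w: "(w, l) \<in> \<Gamma>" using ex' by blast
        then show "l \<in> V ` closure (range a)"
          using V[OF w] in_cl[OF w] by (intro image_eqI[of _ _ w]) auto
      qed
    qed
  qed
qed

section \<open>Square roots of positive operators\<close>

text \<open>Polarisation over the complex numbers: the sesquilinear form s vanishes on the diagonal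
  because the quadratic form is real, and expanding it at x + y and at x + \<i> y kills it
  everywhere.\<close>

lemma positive_semidef_selfadjoint:
  assumes P: "positive_semidef P"
  shows "cinner (P x) y = cinner x (P y)"
proof -
  note lin = bounded_clinear_add bounded_clinear_scaleC cinner_add_left cinner_add_right
    cinner_scaleC_left cinner_scaleC_right
  have bl: "bounded_clinear P" using P by (simp add: positive_semidef_def)
  define s where "s u v = cinner (P u) v - cinner u (P v)" for u v
  have s0: "s u u = 0" for u
  proof -
    have "Im (cinner (P u) u) = 0" using P by (simp add: positive_semidef_def)
    then have "cnj (cinner (P u) u) = cinner (P u) u" by (simp add: complex_eq_iff)
    then show ?thesis using cinner_commute[of u "P u"] by (simp add: s_def)
  qed
  have "s (x + y) (x + y) = s x x + s y y + s x y + s y x"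
    using bl by (simp add: s_def lin)
  then have 1: "s x y + s y x = 0" by (simp add: s0)
  have "s (x + \<i> *\<^sub>C y) (x + \<i> *\<^sub>C y) = s x x + s y y + \<i> * (s y x - s x y)"
    using bl by (simp add: s_def lin algebra_simps)
  then have "s y x = s x y" by (simp add: s0)
  with 1 have "s x y = 0" by simp
  then show ?thesis by (simp add: s_def)
qed

lemma positive_semidef_Re:
  assumes "positive_semidef P" shows "Re (cinner (P x) x) \<ge> 0" "cinner (P x) x = complex_of_real (Re (cinner (P x) x))"
  using assms by (auto simp: positive_semidef_def complex_eq_iff)

lemma positive_semidefI:
  assumes "bounded_clinear P" "\<And>x y. cinner (P x) y = cinner x (P y)" "\<And>x. 0 \<le> Re (cinner (P x) x)"
  shows "positive_semidef P"
  unfolding positive_semidef_def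
proof (intro conjI allI assms)
  fix x
  have "cinner (P x) x = cnj (cinner (P x) x)" using assms(2)[of x x] cinner_commute[of x "P x"] by simp
  then show "Im (cinner (P x) x) = 0" by (simp add: complex_eq_iff)
qed

text \<open>Taylor coefficients of the square root of 1 - t. In the Pochhammer form the first factor
  -1/2 is negative and all later ones are positive, which shows the sign.\<close>

definition sqrt_coeff :: "nat \<Rightarrow> real" where
  "sqrt_coeff k = pochhammer (- 1 / 2) k / fact k"

lemma sqrt_coeff_eq: "sqrt_coeff k = (1 / 2 gchoose k) * (- 1) ^ k"
  by (simp add: sqrt_coeff_def gbinomial_pochhammer flip: mult.assoc power_mult_distrib)

lemma sqrt_coeff_0 [simp]: "sqrt_coeff 0 = 1"
  by (simp add: sqrt_coeff_def)

lemma sqrt_coeff_Suc_le: "sqrt_coeff (Suc k) \<le> 0"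
  by (simp add: sqrt_coeff_def pochhammer_rec divide_nonpos_pos pochhammer_nonneg)

text \<open>Partial sums are the coefficients of the series divided by 1 - t, that is of (1 - t) to
  the power -1/2, and those are positive.\<close>

lemma sum_sqrt_coeff: "0 \<le> (\<Sum>k\<le>n. sqrt_coeff k)"
proof -
  have "(\<Sum>k\<le>n. sqrt_coeff k) = (- 1) ^ n * (1 / 2 - 1 gchoose n)"
    unfolding sqrt_coeff_eq by (rule gbinomial_sum_lower_neg)
  also have "\<dots> = pochhammer (1 / 2) n / fact n"
    by (simp add: gbinomial_pochhammer flip: mult.assoc power_mult_distrib)
  finally show ?thesis by (simp add: pochhammer_nonneg)
qed

text \<open>Only the coefficient with index 0 is positive, and it equals 1, so a partial sum of
  absolute values is 2 minus the partial sum of the coefficients.\<close>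

lemma summable_abs_sqrt_coeff: "summable (\<lambda>k. \<bar>sqrt_coeff k\<bar>)"
proof (rule summableI_nonneg_bounded)
  fix n
  have "(\<Sum>k<Suc n. \<bar>sqrt_coeff k\<bar>) = 2 - (\<Sum>k\<le>n. sqrt_coeff k)"
  proof (induction n)
    case (Suc n)
    then show ?case using sqrt_coeff_Suc_le[of n] by simp
  qed simp
  then have "(\<Sum>k<Suc n. \<bar>sqrt_coeff k\<bar>) \<le> 2" using sum_sqrt_coeff[of n] by simp
  moreover have "(\<Sum>k<n. \<bar>sqrt_coeff k\<bar>) \<le> (\<Sum>k<Suc n. \<bar>sqrt_coeff k\<bar>)" by simp
  ultimately show "(\<Sum>k<n. \<bar>sqrt_coeff k\<bar>) \<le> 2" by linarith
qed auto

lemma suminf_sqrt_coeff: "0 \<le> (\<Sum>k. sqrt_coeff k)"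
proof (rule LIMSEQ_le_const)
  show "(\<lambda>n. \<Sum>k\<le>n. sqrt_coeff k) \<longlonglongrightarrow> (\<Sum>k. sqrt_coeff k)"
    by (rule summable_LIMSEQ'[OF summable_rabs_cancel[OF summable_abs_sqrt_coeff]])
qed (use sum_sqrt_coeff in blast)

text \<open>The coefficients of the squared series 1 - t, by Vandermonde with 1/2 + 1/2 = 1.\<close>

lemma sqrt_coeff_convolution:
  "(\<Sum>m\<le>k. sqrt_coeff m * sqrt_coeff (k - m)) = (if k = 0 then 1 else if k = 1 then - 1 else 0)"
proof -
  have "(\<Sum>m\<le>k. sqrt_coeff m * sqrt_coeff (k - m))
      = (\<Sum>m\<in>{0..k}. (1 / 2 gchoose m) * (1 / 2 gchoose (k - m))) * (- 1) ^ k"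
    unfolding sum_distrib_right atMost_atLeast0
    by (intro sum.cong refl) (simp add: sqrt_coeff_eq flip: power_add)
  also have "(\<Sum>m\<in>{0..k}. (1 / 2 gchoose m) * (1 / 2 gchoose (k - m))) = (of_nat 1 gchoose k :: real)"
    by (subst gbinomial_Vandermonde) simp
  also have "\<dots> = real (1 choose k)" by (simp only: binomial_gbinomial)
  finally show ?thesis by (cases k rule: nat.exhaust[case_names 0 Suc]) (auto simp: binomial_eq_0 gr0_conv_Suc)
qed

lemma bounded_clinear_funpow: "bounded_clinear (B :: 'a::chilbert \<Rightarrow> 'a) \<Longrightarrow> bounded_clinear (B ^^ n)"
proof (induction n)
  case 0
  show ?case by (rule bounded_clinearI[of _ 1]) auto
next
  case (Suc n)
  then show ?case using bounded_clinear_compose[of B "B ^^ n"] by (simp add: o_def)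
qed

text \<open>The binomial series for \<open>(1 - B)\<^sup>1\<^sup>/\<^sup>2\<close> converges absolutely even when \<open>\<parallel>B\<parallel> = 1\<close>.\<close>

lemma sqrt_one_minus_contraction:
  fixes B :: "'a::chilbert \<Rightarrow> 'a"
  assumes B: "bounded_clinear B" and contr: "\<And>x. norm (B x) \<le> norm x"
    and sa: "\<And>x y. cinner (B x) y = cinner x (B y)"
  shows "\<exists>Q. positive_semidef Q \<and> (\<forall>x. Q (Q x) = x - B x)"
proof -
  let ?c = sqrt_coeff
  have npow: "norm ((B ^^ n) x) \<le> norm x" for n x
    by (induction n) (auto intro: order_trans[OF contr])
  have sapow: "cinner ((B ^^ n) x) y = cinner x ((B ^^ n) y)" for n x y
    by (induction n arbitrary: x y) (simp_all add: sa flip: funpow_swap1)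
  note Bn = bounded_clinear_funpow[OF B]
  have nle: "norm (?c n *\<^sub>R (B ^^ n) x) \<le> \<bar>?c n\<bar> * norm x" for n x
    by (simp add: mult_left_mono npow)
  have summ: "summable (\<lambda>n. norm (?c n *\<^sub>R (B ^^ n) x))" for x
    by (rule summable_comparison_test'[OF summable_mult2[OF summable_abs_sqrt_coeff, of "norm x"]])
      (use nle in auto)
  note sm = summable_norm_cancel[OF summ]
  define Q where "Q x = (\<Sum>n. ?c n *\<^sub>R (B ^^ n) x)" for x
  have Qs: "(\<lambda>n. ?c n *\<^sub>R (B ^^ n) x) sums Q x" for x
    unfolding Q_def by (rule summable_sums[OF sm])
  have Q: "bounded_clinear Q"
  proof (rule bounded_clinearI)
    show "Q (x + y) = Q x + Q y" for x y
      unfolding Q_def suminf_add[OF sm sm]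
      by (simp add: bounded_clinear_add[OF Bn] scaleR_add_right)
    show "Q (c *\<^sub>C x) = c *\<^sub>C Q x" for c x
    proof -
      have "(\<lambda>n. c *\<^sub>C (?c n *\<^sub>R (B ^^ n) x)) sums (c *\<^sub>C Q x)"
        by (rule bounded_linear.sums[OF bounded_bilinear.bounded_linear_right[OF bounded_bilinear_scaleC] Qs])
      then have "(\<lambda>n. ?c n *\<^sub>R (B ^^ n) (c *\<^sub>C x)) sums (c *\<^sub>C Q x)"
        by (simp add: bounded_clinear_scaleC[OF Bn] scaleR_scaleC scaleC_scaleC mult.commute)
      then show ?thesis using Qs sums_unique2 by blast
    qed
    show "norm (Q x) \<le> (\<Sum>n. \<bar>?c n\<bar>) * norm x" for x
    proof -
      have "norm (Q x) \<le> (\<Sum>n. norm (?c n *\<^sub>R (B ^^ n) x))"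
        unfolding Q_def by (rule summable_norm[OF summ])
      also have "\<dots> \<le> (\<Sum>n. \<bar>?c n\<bar> * norm x)"
        by (rule suminf_le[OF nle summ summable_mult2[OF summable_abs_sqrt_coeff]])
      finally show ?thesis
        by (simp add: suminf_mult2[OF summable_abs_sqrt_coeff])
    qed
  qed
  have Qip1: "(\<lambda>n. ?c n *\<^sub>R cinner ((B ^^ n) x) y) sums cinner (Q x) y" for x y
    using bounded_linear.sums[OF bounded_bilinear.bounded_linear_left[OF bounded_bilinear_cinner] Qs, of x y]
    by (simp add: bounded_bilinear.scaleR_left[OF bounded_bilinear_cinner])
  have Qip2: "(\<lambda>n. ?c n *\<^sub>R cinner x ((B ^^ n) y)) sums cinner x (Q y)" for x y
    using bounded_linear.sums[OF bounded_bilinear.bounded_linear_right[OF bounded_bilinear_cinner] Qs, of x y]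
    by (simp add: bounded_bilinear.scaleR_right[OF bounded_bilinear_cinner])
  have psd: "positive_semidef Q"
  proof (rule positive_semidefI[OF Q])
    show "cinner (Q x) y = cinner x (Q y)" for x y
      using Qip1[of x y] Qip2[of x y] sums_unique2 by (auto simp: sapow)
    show "0 \<le> Re (cinner (Q x) x)" for x
    proof -
      have R: "(\<lambda>n. ?c n * Re (cinner ((B ^^ n) x) x)) sums Re (cinner (Q x) x)"
        using sums_Re[OF Qip1[of x x]] by simp
      have L: "(\<lambda>n. ?c n * (norm x)\<^sup>2) sums ((\<Sum>n. ?c n) * (norm x)\<^sup>2)"
        by (rule sums_mult2[OF summable_sums[OF summable_rabs_cancel[OF summable_abs_sqrt_coeff]]])
      \<comment> \<open>For n > 0 the coefficient is nonpositive and the form of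
        \<open>B ^^ n\<close> is at most \<open>(norm x)\<^sup>2\<close>. Termwise, Q therefore
        dominates the scalar series at t = 1, whose sum is nonnegative.\<close>
      have I: "?c n * (norm x)\<^sup>2 \<le> ?c n * Re (cinner ((B ^^ n) x) x)" for n
      proof (cases n)
        case 0
        then show ?thesis by (simp add: cinner_self)
      next
        case (Suc k)
        have "Re (cinner ((B ^^ n) x) x) \<le> norm ((B ^^ n) x) * norm x"
          using complex_Re_le_cmod Cauchy_Schwarz_cinner order_trans by blast
        also have "\<dots> \<le> (norm x)\<^sup>2"
          by (simp add: power2_eq_square mult_right_mono npow)
        finally have "Re (cinner ((B ^^ n) x) x) \<le> (norm x)\<^sup>2" .
        moreover have "?c n \<le> 0" unfolding Suc by (rule sqrt_coeff_Suc_le)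
        ultimately show ?thesis by (rule mult_left_mono_neg)
      qed
      have "0 \<le> (\<Sum>n. ?c n) * (norm x)\<^sup>2"
        by (intro mult_nonneg_nonneg suminf_sqrt_coeff) simp
      also have "\<dots> \<le> Re (cinner (Q x) x)" by (rule sums_le[OF I L R])
      finally show ?thesis .
    qed
  qed
  have sq: "Q (Q x) = x - B x" for x
  proof -
    \<comment> \<open>Double series of Q applied twice. By rows it sums to \<open>Q (Q x)\<close>,
      by antidiagonals the convolution identity leaves the two terms x and \<open>- B x\<close>;
      absolute summability permits the regrouping.\<close>
    define F where "F = (\<lambda>(m, n). (?c m * ?c n) *\<^sub>R (B ^^ (m + n)) x)"
    have cs: "(\<lambda>n. norm (?c n)) summable_on UNIV"
      by (rule norm_summable_imp_summable_on) (simp add: summable_abs_sqrt_coeff)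
    have "(\<lambda>p. norm (case p of (m, n) \<Rightarrow> ?c m * ?c n)) summable_on (UNIV \<times> UNIV)"
      by (subst Infinite_Sum.abs_summable_on_Sigma_iff)
        (use cs in \<open>auto simp: abs_mult infsum_cmult_right' infsum_nonneg intro!: summable_on_cmult_right summable_on_cmult_left\<close>)
    then have "(\<lambda>p. norm (case p of (m, n) \<Rightarrow> ?c m * ?c n) * norm x) summable_on (UNIV \<times> UNIV)"
      by (rule summable_on_cmult_left)
    then have "(\<lambda>p. norm (F p)) summable_on (UNIV \<times> UNIV)"
      by (rule Infinite_Sum.abs_summable_on_comparison_test')
        (auto simp: F_def split: prod.splits intro!: mult_left_mono npow)
    then have SF: "F summable_on (UNIV \<times> UNIV)" by (rule abs_summable_summable)
    have infs: "infsum f UNIV = suminf f" if "summable (\<lambda>n. norm (f n))" for f :: "nat \<Rightarrow> 'a"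
      using norm_summable_imp_has_sum[OF that summable_sums[OF summable_norm_cancel[OF that]]]
      by (rule infsumI)
    have row: "(\<Sum>\<^sub>\<infinity>n. F (m, n)) = ?c m *\<^sub>R (B ^^ m) (Q x)" for m
    proof -
      have "(\<lambda>n. ?c m *\<^sub>R (B ^^ m) (?c n *\<^sub>R (B ^^ n) x)) sums (?c m *\<^sub>R (B ^^ m) (Q x))"
        by (intro sums_scaleR_right bounded_linear.sums[OF bounded_clinear_bounded_linear[OF Bn] Qs])
      moreover have "?c m *\<^sub>R (B ^^ m) (?c n *\<^sub>R (B ^^ n) x) = F (m, n)" for n
        by (simp add: F_def linear_scale[OF bounded_linear.linear[OF bounded_clinear_bounded_linear[OF Bn]]] funpow_add)
      ultimately have s: "(\<lambda>n. F (m, n)) sums (?c m *\<^sub>R (B ^^ m) (Q x))" by simp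
      have "summable (\<lambda>n. norm (F (m, n)))"
      proof (rule summable_comparison_test'[OF summable_mult2[OF summable_mult[OF summable_abs_sqrt_coeff, of "\<bar>?c m\<bar>"], of "norm x"]])
        show "norm (norm (F (m, n))) \<le> \<bar>?c m\<bar> * \<bar>?c n\<bar> * norm x" for n
          using mult_left_mono[OF npow[of "m + n" x], of "\<bar>?c m * ?c n\<bar>"] by (simp add: F_def abs_mult)
      qed
      from infs[OF this] sums_unique[OF s] show ?thesis by simp
    qed
    have "Q (Q x) = (\<Sum>\<^sub>\<infinity>m. ?c m *\<^sub>R (B ^^ m) (Q x))"
      by (simp add: infs[OF summ] Q_def)
    also have "\<dots> = infsum F (UNIV \<times> UNIV)"
      using infsum_Sigma_banach[OF SF] by (simp add: row)
    also have "\<dots> = infsum (\<lambda>(k, m). F (m, k - m)) (SIGMA k:UNIV. {..k})"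
    proof -
      have bij: "bij_betw (\<lambda>(k, m). (m, k - m)) (SIGMA k:UNIV. {..k::nat}) (UNIV \<times> UNIV)"
        by (rule bij_betw_byWitness[where f' = "\<lambda>(m, n). (m + n, m)"]) auto
      then show ?thesis
        using infsum_reindex_bij_betw[OF bij, of F] by (simp add: case_prod_beta')
    qed
    also have "\<dots> = (\<Sum>\<^sub>\<infinity>k. \<Sum>\<^sub>\<infinity>m\<in>{..k}. F (m, k - m))"
    proof -
      have bij: "bij_betw (\<lambda>(k, m). (m, k - m)) (SIGMA k:UNIV. {..k::nat}) (UNIV \<times> UNIV)"
        by (rule bij_betw_byWitness[where f' = "\<lambda>(m, n). (m + n, m)"]) auto
      have "(\<lambda>(k, m). F (m, k - m)) summable_on (SIGMA k:UNIV. {..k})"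
        using summable_on_reindex_bij_betw[OF bij, of F] SF by (simp add: case_prod_beta')
      from infsum_Sigma_banach[OF this] show ?thesis by simp
    qed
    also have "\<dots> = (\<Sum>\<^sub>\<infinity>k. (\<Sum>m\<le>k. ?c m * ?c (k - m)) *\<^sub>R (B ^^ k) x)"
      by (simp add: F_def scaleR_sum_left)
    also have "\<dots> = (\<Sum>\<^sub>\<infinity>k\<in>{0, 1}. (\<Sum>m\<le>k. ?c m * ?c (k - m)) *\<^sub>R (B ^^ k) x)"
      by (rule infsum_cong_neutral) (auto simp: sqrt_coeff_convolution)
    also have "\<dots> = x - B x" by (simp add: sqrt_coeff_convolution)
    finally show ?thesis .
  qed
  show ?thesis using psd sq by blast
qed

lemma positive_semidef_sqrt_exists:
  fixes P :: "'a::chilbert \<Rightarrow> 'a"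
  assumes P: "positive_semidef P"
  shows "\<exists>Q. positive_semidef Q \<and> (\<forall>x. Q (Q x) = P x)"
proof -
  have bl: "bounded_clinear P" using P by (simp add: positive_semidef_def)
  \<comment> \<open>The \<open>+ 1\<close> makes a positive even for P = 0, so that P can be scaled
    to 1 - B with B a contraction.\<close>
  define a where "a = onorm P + 1"
  have a: "a > 0" unfolding a_def using onorm_pos_le[OF bounded_clinear_bounded_linear[OF bl]] by simp
  have Pa: "norm (P x) \<le> a * norm x" for x
    using onorm[OF bounded_clinear_bounded_linear[OF bl], of x] norm_ge_zero[of x] by (simp add: a_def distrib_right del: norm_ge_zero)
  define B where "B x = x - complex_of_real (1 / a) *\<^sub>C P x" for x
  \<comment> \<open>Positivity of P tested at \<open>x - (1 / a) P x\<close>. This inequality makes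
    the square of P / a at most P / a, hence B contractive.\<close>
  have key: "(norm (P x))\<^sup>2 \<le> a * Re (cinner (P x) x)" for x
  proof -
    define t where "t = complex_of_real (1 / a)"
    have "Re (cinner (P (P x)) (P x)) \<le> norm (P (P x)) * norm (P x)"
      using complex_Re_le_cmod Cauchy_Schwarz_cinner order_trans by blast
    also have "\<dots> \<le> a * (norm (P x))\<^sup>2"
      using mult_right_mono[OF Pa[of "P x"], of "norm (P x)"] by (simp add: power2_eq_square)
    finally have le: "Re (cinner (P (P x)) (P x)) \<le> a * (norm (P x))\<^sup>2" .
    have "0 \<le> Re (cinner (P (x - t *\<^sub>C P x)) (x - t *\<^sub>C P x))"
      by (rule positive_semidef_Re[OF P])
    also have "cinner (P (x - t *\<^sub>C P x)) (x - t *\<^sub>C P x)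
       = cinner (P x) x - t * cinner (P x) (P x) - t * cinner (P (P x)) x + t * t * cinner (P (P x)) (P x)"
      by (simp add: bounded_clinear_diff[OF bl] bounded_clinear_scaleC[OF bl] cinner_diff_left cinner_diff_right
          cinner_scaleC_left cinner_scaleC_right t_def algebra_simps)
    also have "cinner (P (P x)) x = cinner (P x) (P x)" by (rule positive_semidef_selfadjoint[OF P])
    finally have "0 \<le> Re (cinner (P x) x) - 2 / a * (norm (P x))\<^sup>2 + (1 / a)\<^sup>2 * Re (cinner (P (P x)) (P x))"
      by (simp add: t_def cinner_self power2_eq_square)
    also have "\<dots> \<le> Re (cinner (P x) x) - 2 / a * (norm (P x))\<^sup>2 + (1 / a)\<^sup>2 * (a * (norm (P x))\<^sup>2)"
      by (intro add_left_mono mult_left_mono le) auto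
    finally show ?thesis using a by (simp add: field_simps power2_eq_square)
  qed
  have "\<exists>Q. positive_semidef Q \<and> (\<forall>x. Q (Q x) = x - B x)"
  proof (rule sqrt_one_minus_contraction)
    show contr: "norm (B x) \<le> norm x" for x
    proof -
      have "(norm (B x))\<^sup>2 = (norm x)\<^sup>2 - 2 / a * Re (cinner (P x) x) + (1 / a)\<^sup>2 * (norm (P x))\<^sup>2"
        using positive_semidef_selfadjoint[OF P, of x x]
        by (simp add: B_def norm_diff_sq cinner_scaleC_right norm_divide power_divide power_mult_distrib)
      also have "\<dots> \<le> (norm x)\<^sup>2 - 2 / a * Re (cinner (P x) x) + (1 / a)\<^sup>2 * (a * Re (cinner (P x) x))"
        by (intro add_left_mono mult_left_mono key) auto
      also have "\<dots> = (norm x)\<^sup>2 - 1 / a * Re (cinner (P x) x)"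
        using a by (simp add: field_simps power2_eq_square)
      also have "\<dots> \<le> (norm x)\<^sup>2" using a positive_semidef_Re[OF P, of x] by simp
      finally show ?thesis by (rule power2_le_imp_le) simp
    qed
    show "bounded_clinear B"
      by (rule bounded_clinearI[of _ 1])
        (use contr in \<open>auto simp: B_def bounded_clinear_add[OF bl] bounded_clinear_scaleC[OF bl] scaleC_add_right
          scaleC_diff_right scaleC_scaleC mult.commute\<close>)
    show "cinner (B x) y = cinner x (B y)" for x y
      by (simp add: B_def cinner_diff_left cinner_diff_right cinner_scaleC_left cinner_scaleC_right
          positive_semidef_selfadjoint[OF P])
  qed
  then obtain Q where Q: "positive_semidef Q" "\<And>x. Q (Q x) = complex_of_real (1 / a) *\<^sub>C P x"
    by (auto simp: B_def)
  have Qb: "bounded_clinear Q" using Q by (simp add: positive_semidef_def)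
  define R where "R x = complex_of_real (sqrt a) *\<^sub>C Q x" for x
  have "positive_semidef R"
  proof (rule positive_semidefI)
    show "bounded_clinear R"
    proof (rule bounded_clinearI[of _ "sqrt a * onorm Q"])
      show "norm (R x) \<le> sqrt a * onorm Q * norm x" for x
        using a onorm[OF bounded_clinear_bounded_linear[OF Qb], of x] by (simp add: R_def)
    qed (simp_all add: R_def bounded_clinear_add[OF Qb] bounded_clinear_scaleC[OF Qb] scaleC_add_right
        scaleC_scaleC mult.commute)
    show "cinner (R x) y = cinner x (R y)" for x y
      by (simp add: R_def cinner_scaleC_left cinner_scaleC_right positive_semidef_selfadjoint[OF Q(1)])
    show "0 \<le> Re (cinner (R x) x)" for x
      using a positive_semidef_Re[OF Q(1), of x] by (simp add: R_def cinner_scaleC_left)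
  qed
  moreover have "R (R x) = P x" for x
    using a by (simp add: R_def bounded_clinear_scaleC[OF Qb] scaleC_scaleC Q(2) flip: of_real_mult)
  ultimately show ?thesis by blast
qed

lemma psd_sqrt:
  assumes "positive_semidef P"
  shows positive_semidef_psd_sqrt: "positive_semidef (psd_sqrt P)"
    and psd_sqrt_sq: "psd_sqrt P (psd_sqrt P x) = P x"
proof -
  have "positive_semidef (psd_sqrt P) \<and> (\<forall>x. psd_sqrt P (psd_sqrt P x) = P x)"
    unfolding psd_sqrt_def by (rule someI_ex[OF positive_semidef_sqrt_exists[OF assms]])
  then show "positive_semidef (psd_sqrt P)" "psd_sqrt P (psd_sqrt P x) = P x" by auto
qed

section \<open>Vector-valued holomorphic functions\<close>

definition has_cderiv :: "(complex \<Rightarrow> 'a::chilbert) \<Rightarrow> 'a \<Rightarrow> complex \<Rightarrow> bool" where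
  "has_cderiv f l z \<longleftrightarrow> ((\<lambda>w. inverse (w - z) *\<^sub>C (f w - f z)) \<longlongrightarrow> l) (at z)"

lemma holomorphic_vec_iff: "holomorphic_vec f \<longleftrightarrow> (\<forall>z\<in>disk. \<exists>l. has_cderiv f l z)"
  by (simp add: holomorphic_vec_def has_cderiv_def)

lemma has_cderiv_add: "has_cderiv f l z \<Longrightarrow> has_cderiv g m z \<Longrightarrow> has_cderiv (\<lambda>w. f w + g w) (l + m) z"
  unfolding has_cderiv_def
  by (drule (1) tendsto_add) (simp add: algebra_simps scaleC_add_right scaleC_diff_right)

lemma has_cderiv_clinear:
  assumes "bounded_clinear L" "has_cderiv f l z"
  shows "has_cderiv (\<lambda>w. L (f w)) (L l) z"
  using bounded_clinear_tendsto[OF assms(1) assms(2)[unfolded has_cderiv_def]]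
  by (simp add: has_cderiv_def bounded_clinear_scaleC[OF assms(1)] bounded_clinear_diff[OF assms(1)])

lemma has_cderiv_tendsto:
  assumes "has_cderiv f l z"
  shows "(f \<longlongrightarrow> f z) (at z)"
proof -
  have "((\<lambda>w. f z + (w - z) *\<^sub>C (inverse (w - z) *\<^sub>C (f w - f z))) \<longlongrightarrow> f z + (z - z) *\<^sub>C l) (at z)"
    using assms unfolding has_cderiv_def by (intro tendsto_intros)
  then have "((\<lambda>w. f z + (w - z) *\<^sub>C (inverse (w - z) *\<^sub>C (f w - f z))) \<longlongrightarrow> f z) (at z)"
    by simp
  then show ?thesis
    by (rule Lim_transform_eventually) (auto simp: eventually_at_filter scaleC_scaleC)
qed

lemma has_cderiv_cinner:
  assumes "has_cderiv f l z"
  shows "((\<lambda>w. cinner (f w) y) has_field_derivative cinner l y) (at z)"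
  unfolding has_field_derivative_iff
proof (rule Lim_transform_eventually)
  show "((\<lambda>w. cinner (inverse (w - z) *\<^sub>C (f w - f z)) y) \<longlongrightarrow> cinner l y) (at z)"
    using assms unfolding has_cderiv_def by (intro tendsto_intros)
  show "\<forall>\<^sub>F w in at z. cinner (inverse (w - z) *\<^sub>C (f w - f z)) y = (cinner (f w) y - cinner (f z) y) / (w - z)"
    by (simp add: cinner_scaleC_left cinner_diff_left field_simps)
qed

lemma holomorphic_vec_cong:
  assumes f: "holomorphic_vec f" and eq: "\<And>z. z \<in> disk \<Longrightarrow> f z = g z"
  shows "holomorphic_vec g"
  unfolding holomorphic_vec_def
proof
  fix z :: complex assume z: "z \<in> disk"
  then obtain l where lim: "((\<lambda>w. inverse (w - z) *\<^sub>C (f w - f z)) \<longlongrightarrow> l) (at z)"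
    using f unfolding holomorphic_vec_def by blast
  have ev: "\<forall>\<^sub>F w in at z. inverse (w - z) *\<^sub>C (f w - f z) = inverse (w - z) *\<^sub>C (g w - g z)"
    using eventually_at_in_open'[OF open_ball z] by eventually_elim (simp only: eq z)
  show "\<exists>l. ((\<lambda>w. inverse (w - z) *\<^sub>C (g w - g z)) \<longlongrightarrow> l) (at z)"
    using Lim_transform_eventually[OF lim ev] by (rule exI)
qed

lemma holomorphic_vec_diff:
  assumes "holomorphic_vec f" "holomorphic_vec g"
  shows "holomorphic_vec (\<lambda>z. f z - g z)"
  unfolding holomorphic_vec_iff
proof
  fix z :: complex assume z: "z \<in> disk"
  obtain l m where l: "has_cderiv f l z" and m: "has_cderiv g m z"
    using assms z unfolding holomorphic_vec_iff by metis
  have "bounded_clinear (\<lambda>v::'a. - v)" by (rule bounded_clinearI[of _ 1]) auto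
  from has_cderiv_add[OF l has_cderiv_clinear[OF this m]]
  show "\<exists>l. has_cderiv (\<lambda>z. f z - g z) l z" by auto
qed

lemma holomorphic_vec_cinner:
  assumes "holomorphic_vec f"
  shows "(\<lambda>w. cinner (f w) y) holomorphic_on disk"
proof (rule holomorphic_onI)
  fix z assume "z \<in> disk"
  then obtain l where "has_cderiv f l z" using assms unfolding holomorphic_vec_iff by blast
  then show "(\<lambda>w. cinner (f w) y) field_differentiable at z within disk"
    using has_cderiv_cinner field_differentiable_at_within field_differentiable_def by blast
qed

lemma holomorphic_vec_continuous_on:
  assumes "holomorphic_vec f"
  shows "continuous_on disk f"
proof (rule continuous_at_imp_continuous_on, rule ballI)
  fix z :: complex assume "z \<in> disk"
  then obtain l where "has_cderiv f l z" using assms unfolding holomorphic_vec_iff by blast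
  then show "isCont f z" using has_cderiv_tendsto by (simp add: isCont_def)
qed

text \<open>All constants depend on the bound M alone, which later makes the estimates uniform over
  functionals. Circles of radius R/3 around points of \<open>ball z (R / 3)\<close> stay inside
  \<open>ball z R\<close>, so Cauchy's inequality bounds the first derivative by 3 M / R and the
  second by 2 M / (R/3)^2 = 18 M / R^2.\<close>

lemma holomorphic_second_order:
  assumes hol: "\<phi> holomorphic_on ball z R" and R: "R > 0"
    and bd: "\<And>w. w \<in> ball z R \<Longrightarrow> cmod (\<phi> w) \<le> M" and w: "w \<in> ball z (R / 3)"
  shows "cmod (\<phi> w - \<phi> z - deriv \<phi> z * (w - z)) \<le> 18 * M / R\<^sup>2 * (cmod (w - z))\<^sup>2"
    and "cmod (deriv \<phi> z) \<le> 3 * M / R"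
proof -
  have Cauchy: "cmod ((deriv ^^ n) \<phi> x) \<le> fact n * M / (R / 3) ^ n" if x: "x \<in> ball z (R / 3)" for x n
  proof (rule Cauchy_inequality)
    have sub: "cball x (R / 3) \<subseteq> ball z R"
    proof
      fix v assume "v \<in> cball x (R / 3)"
      then show "v \<in> ball z R" using x R dist_triangle[of z v x] by (simp add: dist_commute)
    qed
    show "\<phi> holomorphic_on ball x (R / 3)"
      using hol sub ball_subset_cball holomorphic_on_subset by (meson subset_trans)
    show "continuous_on (cball x (R / 3)) \<phi>"
      using holomorphic_on_imp_continuous_on[OF hol] sub continuous_on_subset by blast
    show "0 < R / 3" using R by simp
    show "cmod (\<phi> v) \<le> M" if "cmod (x - v) = R / 3" for v
      using sub that by (intro bd) (auto simp: dist_norm)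
  qed
  have zin: "z \<in> ball z (R / 3)" using R by simp
  show "cmod (deriv \<phi> z) \<le> 3 * M / R"
    using Cauchy[OF zin, of 1] R by (simp add: field_simps)
  have "cmod ((deriv ^^ 0) \<phi> w - (\<Sum>i\<le>1. (deriv ^^ i) \<phi> z * (w - z) ^ i / fact i))
      \<le> 18 * M / R\<^sup>2 * cmod (w - z) ^ Suc 1 / fact 1"
  proof (rule complex_Taylor[where S = "ball z (R / 3)"])
    fix i x assume x: "x \<in> ball z (R / 3)"
    have "ball z (R / 3) \<subseteq> ball z R" using R by (simp add: subset_ball)
    then have x': "x \<in> ball z R" using x by blast
    have "(deriv ^^ i) \<phi> holomorphic_on ball z R"
      by (rule holomorphic_higher_deriv[OF hol open_ball])
    then show "((deriv ^^ i) \<phi> has_field_derivative (deriv ^^ Suc i) \<phi> x) (at x within ball z (R / 3))"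
      using holomorphic_derivI[OF _ open_ball x'] by (simp add: has_field_derivative_at_within)
  next
    fix x assume x: "x \<in> ball z (R / 3)"
    show "cmod ((deriv ^^ Suc 1) \<phi> x) \<le> 18 * M / R\<^sup>2"
      using Cauchy[OF x, of 2] by (simp add: numeral_2_eq_2 power2_eq_square field_simps)
  qed (use w zin in auto)
  then show "cmod (\<phi> w - \<phi> z - deriv \<phi> z * (w - z)) \<le> 18 * M / R\<^sup>2 * (cmod (w - z))\<^sup>2"
    by (simp add: power2_eq_square algebra_simps)
qed

text \<open>The derivative of a weakly holomorphic function exists as a vector by the Riesz theorem, and
  the Cauchy estimates make the convergence of the difference quotients uniform in the functional.\<close>

lemma weakly_holomorphic_cderiv:
  fixes f :: "complex \<Rightarrow> 'a::chilbert"
  assumes hol: "\<And>y. (\<lambda>w. cinner (f w) y) holomorphic_on ball z R" and R: "R > 0"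
    and bd: "\<And>w. w \<in> ball z R \<Longrightarrow> norm (f w) \<le> M"
  obtains l where "norm l \<le> 3 * M / R" "has_cderiv f l z"
    "\<And>w. w \<in> ball z (R / 3) \<Longrightarrow> w \<noteq> z \<Longrightarrow>
      norm (inverse (w - z) *\<^sub>C (f w - f z) - l) \<le> 18 * M / R\<^sup>2 * cmod (w - z)"
proof -
  define \<phi> where "\<phi> y = (\<lambda>w. cinner (f w) y)" for y
  have zin: "z \<in> ball z R" using R by simp
  have "0 \<le> M" using bd[OF zin] norm_ge_zero order_trans by blast
  have bd\<phi>: "cmod (\<phi> y w) \<le> M * norm y" if "w \<in> ball z R" for w y
    unfolding \<phi>_def using Cauchy_Schwarz_cinner[of "f w" y] mult_right_mono[OF bd[OF that], of "norm y"] by simp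
  note so = holomorphic_second_order[OF hol[folded \<phi>_def] R bd\<phi>]
  have fd: "\<phi> y field_differentiable at z" for y
    using hol[folded \<phi>_def] zin holomorphic_on_imp_differentiable_at open_ball by blast
  \<comment> \<open>\<open>\<phi> y\<close> is conjugate-linear in y, so it is the conjugate of the
    derivative that is a linear functional.\<close>
  have "\<exists>l\<in>UNIV. \<forall>y\<in>UNIV. cnj (deriv (\<phi> y) z) = cinner y l"
  proof (rule Riesz_chilbert)
    fix y y' :: 'a
    have "\<phi> (y + y') = (\<lambda>w. \<phi> y w + \<phi> y' w)" by (simp add: \<phi>_def cinner_add_right)
    then show "cnj (deriv (\<phi> (y + y')) z) = cnj (deriv (\<phi> y) z) + cnj (deriv (\<phi> y') z)"
      using fd by simp
    fix c
    have "\<phi> (c *\<^sub>C y) = (\<lambda>w. cnj c * \<phi> y w)" by (simp add: \<phi>_def cinner_scaleC_right)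
    then show "cnj (deriv (\<phi> (c *\<^sub>C y)) z) = c * cnj (deriv (\<phi> y) z)"
      using fd by simp
    show "cmod (cnj (deriv (\<phi> y) z)) \<le> 3 * M / R * norm y"
      using so(2)[of z y] R by simp
  qed auto
  then obtain l where l: "\<And>y. cnj (deriv (\<phi> y) z) = cinner y l" by blast
  have dl: "deriv (\<phi> y) z = cinner l y" for y
    using arg_cong[OF l[of y], of cnj] cinner_commute[of l y] by simp
  have nl: "norm l \<le> 3 * M / R"
  proof (cases "l = 0")
    case True then show ?thesis using \<open>0 \<le> M\<close> R by simp
  next
    case False
    have "(norm l)\<^sup>2 = cmod (deriv (\<phi> l) z)" by (simp add: dl cinner_self norm_power)
    also have "\<dots> \<le> 3 * (M * norm l) / R" using so(2)[of z l] R by simp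
    finally show ?thesis using False R by (simp add: power2_eq_square field_simps)
  qed
  have main: "norm (inverse (w - z) *\<^sub>C (f w - f z) - l) \<le> 18 * M / R\<^sup>2 * cmod (w - z)"
    if w: "w \<in> ball z (R / 3)" and wz: "w \<noteq> z" for w
  proof -
    \<comment> \<open>The Taylor remainder as a vector. Testing the scalar estimate against v itself
      turns its left side into \<open>(norm v)\<^sup>2\<close>, and one factor \<open>norm v\<close>
      cancels.\<close>
    define v where "v = f w - f z - (w - z) *\<^sub>C l"
    have "\<phi> v w - \<phi> v z - deriv (\<phi> v) z * (w - z) = cinner v v"
      unfolding dl by (simp add: v_def \<phi>_def cinner_diff_left cinner_scaleC_left mult.commute)
    then have "(norm v)\<^sup>2 \<le> 18 * (M * norm v) / R\<^sup>2 * (cmod (w - z))\<^sup>2"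
      using so(1)[OF _ w, of v] by (simp add: cinner_self norm_power)
    then have "norm v * norm v \<le> norm v * (18 * M / R\<^sup>2 * (cmod (w - z))\<^sup>2)"
      by (simp add: power2_eq_square ac_simps)
    then have nv: "norm v \<le> 18 * M / R\<^sup>2 * (cmod (w - z))\<^sup>2"
    proof (cases "v = 0")
      case False
      then have "0 < norm v" by simp
      with \<open>norm v * norm v \<le> _\<close> show ?thesis by (rule mult_left_le_imp_le)
    qed (use \<open>0 \<le> M\<close> in simp)
    have "inverse (w - z) *\<^sub>C (f w - f z) - l = inverse (w - z) *\<^sub>C v"
      using wz by (simp add: v_def scaleC_diff_right scaleC_scaleC)
    then have "norm (inverse (w - z) *\<^sub>C (f w - f z) - l) = norm v / cmod (w - z)"
      by (simp add: norm_inverse divide_inverse mult.commute)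
    also have "\<dots> \<le> (18 * M / R\<^sup>2 * (cmod (w - z))\<^sup>2) / cmod (w - z)"
      by (rule divide_right_mono[OF nv]) simp
    also have "\<dots> = 18 * M / R\<^sup>2 * cmod (w - z)"
      using wz by (simp add: power2_eq_square)
    finally show ?thesis .
  qed
  have "has_cderiv f l z"
    unfolding has_cderiv_def
  proof (rule LIM_zero_cancel, rule Lim_null_comparison)
    show "\<forall>\<^sub>F w in at z. norm (inverse (w - z) *\<^sub>C (f w - f z) - l) \<le> 18 * M / R\<^sup>2 * cmod (w - z)"
      unfolding eventually_at using main R by (intro exI[of _ "R / 3"]) (auto simp: dist_commute)
    have "((\<lambda>w. 18 * M / R\<^sup>2 * cmod (w - z)) \<longlongrightarrow> 18 * M / R\<^sup>2 * cmod (z - z)) (at z)"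
      by (intro tendsto_intros)
    then show "((\<lambda>w. 18 * M / R\<^sup>2 * cmod (w - z)) \<longlongrightarrow> 0) (at z)" by simp
  qed
  then show thesis using that nl main by blast
qed

lemma ball_subset_disk: "z \<in> disk \<Longrightarrow> r \<le> 1 - cmod z \<Longrightarrow> ball z r \<subseteq> disk"
proof
  fix w assume "z \<in> disk" "r \<le> 1 - cmod z" "w \<in> ball z r"
  then show "w \<in> disk" using norm_triangle_ineq2[of w z] by (simp add: dist_norm norm_minus_commute)
qed

lemma holomorphic_vec_if_weakly:
  fixes f :: "complex \<Rightarrow> 'a::chilbert"
  assumes hol: "\<And>y. (\<lambda>w. cinner (f w) y) holomorphic_on disk"
    and bd: "\<And>r. r < 1 \<Longrightarrow> \<exists>M. \<forall>w. cmod w \<le> r \<longrightarrow> norm (f w) \<le> M"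
  shows "holomorphic_vec f"
  unfolding holomorphic_vec_iff
proof
  fix z :: complex assume z: "z \<in> disk"
  define R where "R = (1 - cmod z) / 2"
  have R: "R > 0" "cmod z + R < 1" using z by (auto simp: R_def field_simps)
  obtain M where M: "\<And>w. cmod w \<le> cmod z + R \<Longrightarrow> norm (f w) \<le> M"
    using bd[OF R(2)] by blast
  have sub: "ball z R \<subseteq> disk" by (rule ball_subset_disk[OF z]) (use R in simp)
  have M': "norm (f w) \<le> M" if "w \<in> ball z R" for w
    using that norm_triangle_ineq2[of w z] by (intro M) (simp add: dist_norm norm_minus_commute)
  obtain l where "has_cderiv f l z"
    by (rule weakly_holomorphic_cderiv[OF holomorphic_on_subset[OF hol sub] R(1) M'])
  then show "\<exists>l. has_cderiv f l z" by blast
qed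

text \<open>For a contraction-valued function the vector estimate holds with bound
  \<open>norm x\<close>, so the error of the difference quotient is linear in \<open>norm x\<close>:
  this is convergence in operator norm. The derivative L is chosen pointwise and is linear by
  uniqueness of limits.\<close>

lemma holomorphic_op_if_weakly:
  fixes S :: "complex \<Rightarrow> 'a::chilbert \<Rightarrow> 'b::chilbert"
  assumes lin: "\<And>z. z \<in> disk \<Longrightarrow> bounded_clinear (S z)"
    and contr: "\<And>z x. z \<in> disk \<Longrightarrow> norm (S z x) \<le> norm x"
    and hol: "\<And>x y. (\<lambda>z. cinner (S z x) y) holomorphic_on disk"
  shows "holomorphic_op S"
  unfolding holomorphic_op_def
proof
  fix z :: complex assume z: "z \<in> disk"
  define R where "R = 1 - cmod z"
  have R: "R > 0" using z by (auto simp: R_def)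
  have sub: "ball z R \<subseteq> disk" by (rule ball_subset_disk[OF z]) (simp add: R_def)
  have "\<exists>l. norm l \<le> 3 * norm x / R \<and> has_cderiv (\<lambda>w. S w x) l z \<and>
     (\<forall>w\<in>ball z (R / 3). w \<noteq> z \<longrightarrow>
       norm (inverse (w - z) *\<^sub>C (S w x - S z x) - l) \<le> 18 * norm x / R\<^sup>2 * cmod (w - z))" for x
  proof (rule weakly_holomorphic_cderiv[OF holomorphic_on_subset[OF hol sub] R contr[OF subsetD[OF sub]], of x], goal_cases)
    case (1 w)
    then show ?case .
  next
    case (2 l)
    then show ?case by blast
  qed
  then obtain L where L: "\<And>x. norm (L x) \<le> 3 * norm x / R" "\<And>x. has_cderiv (\<lambda>w. S w x) (L x) z"
    "\<And>x w. w \<in> ball z (R / 3) \<Longrightarrow> w \<noteq> z \<Longrightarrow>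
       norm (inverse (w - z) *\<^sub>C (S w x - S z x) - L x) \<le> 18 * norm x / R\<^sup>2 * cmod (w - z)"
    by metis
  have ev: "\<forall>\<^sub>F w in at z. w \<in> disk"
    using z by (intro eventually_at_in_open') auto
  have lin_tendsto: "l = m" if "has_cderiv f l z" "has_cderiv g m z" "\<And>w. w \<in> disk \<Longrightarrow> f w = g w"
    for f g :: "complex \<Rightarrow> 'b" and l m
  proof (rule tendsto_unique[OF trivial_limit_at])
    show "((\<lambda>w. inverse (w - z) *\<^sub>C (f w - f z)) \<longlongrightarrow> l) (at z)" using that by (simp add: has_cderiv_def)
    show "((\<lambda>w. inverse (w - z) *\<^sub>C (f w - f z)) \<longlongrightarrow> m) (at z)"
      using that(2) unfolding has_cderiv_def
      by (rule Lim_transform_eventually) (use ev in eventually_elim, use that(3) z in simp)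
  qed
  have blL: "bounded_clinear L"
  proof (rule bounded_clinearI)
    show "L (x + y) = L x + L y" for x y
      by (rule lin_tendsto[OF L(2) has_cderiv_add[OF L(2) L(2)]]) (simp add: lin bounded_clinear_add)
    have sc: "bounded_clinear (\<lambda>v::'b. c *\<^sub>C v)" for c
      by (rule bounded_clinearI[of _ "cmod c"]) (auto simp: scaleC_add_right scaleC_scaleC mult.commute)
    show "L (c *\<^sub>C x) = c *\<^sub>C L x" for c x
      by (rule lin_tendsto[OF L(2) has_cderiv_clinear[OF sc L(2)]]) (simp add: lin bounded_clinear_scaleC)
    show "norm (L x) \<le> (3 / R) * norm x" for x using L(1)[of x] by simp
  qed
  show "\<exists>L. bounded_clinear L \<and>
        ((\<lambda>w. onorm (\<lambda>x. inverse (w - z) *\<^sub>C (S w x - S z x) - L x)) \<longlongrightarrow> 0) (at z)"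
  proof (intro exI[of _ L] conjI blL)
    have ub: "norm (onorm (\<lambda>x. inverse (w - z) *\<^sub>C (S w x - S z x) - L x)) \<le> 18 / R\<^sup>2 * cmod (w - z)"
      if w: "w \<in> ball z (R / 3)" "w \<noteq> z" for w
    proof -
      have wd: "w \<in> disk" using w(1) sub subset_ball[of "R / 3" R z] R by (simp add: subset_iff)
      have "bounded_linear (\<lambda>x. inverse (w - z) *\<^sub>C (S w x - S z x) - L x)"
        by (intro bounded_linear_sub bounded_linear_compose[OF bounded_bilinear.bounded_linear_right[OF bounded_bilinear_scaleC]]
          bounded_clinear_bounded_linear lin wd z blL)
      then have "0 \<le> onorm (\<lambda>x. inverse (w - z) *\<^sub>C (S w x - S z x) - L x)" by (rule onorm_pos_le)
      moreover have "onorm (\<lambda>x. inverse (w - z) *\<^sub>C (S w x - S z x) - L x) \<le> 18 / R\<^sup>2 * cmod (w - z)"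
        by (rule onorm_bound) (use L(3)[OF w] in \<open>auto simp: ac_simps\<close>)
      ultimately show ?thesis by simp
    qed
    show "((\<lambda>w. onorm (\<lambda>x. inverse (w - z) *\<^sub>C (S w x - S z x) - L x)) \<longlongrightarrow> 0) (at z)"
    proof (rule Lim_null_comparison)
      show "\<forall>\<^sub>F w in at z. norm (onorm (\<lambda>x. inverse (w - z) *\<^sub>C (S w x - S z x) - L x)) \<le> 18 / R\<^sup>2 * cmod (w - z)"
        unfolding eventually_at using ub R by (intro exI[of _ "R / 3"]) (auto simp: dist_commute)
      have "((\<lambda>w. 18 / R\<^sup>2 * cmod (w - z)) \<longlongrightarrow> 18 / R\<^sup>2 * cmod (z - z)) (at z)"
        by (intro tendsto_intros)
      then show "((\<lambda>w. 18 / R\<^sup>2 * cmod (w - z)) \<longlongrightarrow> 0) (at z)" by simp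
    qed
  qed
qed

section \<open>Functions of the Schur class and holomorphic eigenvectors\<close>

lemma schur_class_bounded_clinear: "S \<in> schur_class \<Longrightarrow> z \<in> disk \<Longrightarrow> bounded_clinear (S z)"
  by (simp add: schur_class_def)

lemma schur_class_contraction: "S \<in> schur_class \<Longrightarrow> z \<in> disk \<Longrightarrow> norm (S z x) \<le> norm x"
  by (auto simp: schur_class_def intro: bounded_clinear_contraction)

lemma schur_class_holomorphic_vec:
  assumes S: "S \<in> schur_class"
  shows "holomorphic_vec (\<lambda>z. S z x)"
  unfolding holomorphic_vec_iff
proof
  fix z :: complex assume z: "z \<in> disk"
  then obtain L where L: "bounded_clinear L"
    "((\<lambda>w. onorm (\<lambda>x. inverse (w - z) *\<^sub>C (S w x - S z x) - L x)) \<longlongrightarrow> 0) (at z)"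
    using S unfolding schur_class_def holomorphic_op_def by blast
  have "has_cderiv (\<lambda>z. S z x) (L x) z"
    unfolding has_cderiv_def
  proof (rule LIM_zero_cancel, rule Lim_null_comparison)
    have "\<forall>\<^sub>F w in at z. w \<in> disk"
      using z by (intro eventually_at_in_open') auto
    then show "\<forall>\<^sub>F w in at z. norm (inverse (w - z) *\<^sub>C (S w x - S z x) - L x)
        \<le> onorm (\<lambda>x. inverse (w - z) *\<^sub>C (S w x - S z x) - L x) * norm x"
    proof eventually_elim
      case (elim w)
      have "bounded_linear (\<lambda>x. inverse (w - z) *\<^sub>C (S w x - S z x) - L x)"
        by (intro bounded_linear_sub bounded_linear_compose[OF bounded_bilinear.bounded_linear_right[OF bounded_bilinear_scaleC]]
          bounded_clinear_bounded_linear schur_class_bounded_clinear[OF S] elim z L)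
      from onorm[OF this, of x] show ?case .
    qed
    show "((\<lambda>w. onorm (\<lambda>x. inverse (w - z) *\<^sub>C (S w x - S z x) - L x) * norm x) \<longlongrightarrow> 0) (at z)"
      using tendsto_mult_right[OF L(2), of "norm x"] by simp
  qed
  then show "\<exists>l. has_cderiv (\<lambda>z. S z x) l z" by blast
qed

text \<open>The relation says \<open>T\<^sup>* q(z) = z q(z)\<close>; comparing Taylor coefficients at \<open>0\<close>, the first
  nonzero one would lie in the kernel of \<open>T\<^sup>*\<close>.\<close>

lemma holomorphic_eigenvector_zero:
  fixes q :: "complex \<Rightarrow> 'x::chilbert" and T :: "'x \<Rightarrow> 'x"
  assumes q: "holomorphic_vec q" and T: "bounded_clinear T" and inj: "inj (cadjoint T)"
    and eig: "\<And>z x. z \<in> disk \<Longrightarrow> cinner (q z) (T x) = z * cinner (q z) x"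
    and z: "z \<in> disk"
  shows "q z = 0"
proof -
  define \<phi> where "\<phi> x = (\<lambda>w. cinner (q w) x)" for x
  have hol: "\<phi> x holomorphic_on disk" for x
    unfolding \<phi>_def by (rule holomorphic_vec_cinner[OF q])
  have half: "cball 0 (1/2) \<subseteq> disk" by auto
  have "bounded (q ` cball 0 (1/2))"
    by (rule compact_imp_bounded[OF compact_continuous_image[OF
          continuous_on_subset[OF holomorphic_vec_continuous_on[OF q] half] compact_cball]])
  then obtain M where M: "\<And>w. w \<in> cball 0 (1/2) \<Longrightarrow> norm (q w) \<le> M"
    unfolding bounded_iff by blast
  have coeff: "(deriv ^^ n) (\<phi> x) 0 = 0" for n x
  proof (induction n arbitrary: x rule: less_induct)
    case (less n)
    \<comment> \<open>On vectors \<open>T v\<close> the function has an additional factor w. By the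
      Leibniz rule its n-th derivative at 0 contains only derivatives of \<open>\<phi> v\<close> of
      order below n, which vanish by induction.\<close>
    have ranT: "(deriv ^^ n) (\<phi> (T v)) 0 = 0" for v
    proof -
      have "(deriv ^^ n) (\<phi> (T v)) 0 = (deriv ^^ n) (\<lambda>w. w * \<phi> v w) 0"
        by (rule higher_deriv_transform_within_open[of _ disk])
          (use hol eig in \<open>auto intro!: holomorphic_intros simp: \<phi>_def\<close>)
      also have "\<dots> = (\<Sum>i = 0..n. of_nat (n choose i) * (deriv ^^ i) (\<lambda>w. w) 0 * (deriv ^^ (n - i)) (\<phi> v) 0)"
        by (rule higher_deriv_mult[of _ disk]) (use hol in \<open>auto intro!: holomorphic_intros\<close>)
      also have "\<dots> = 0"
      proof (rule sum.neutral, rule ballI)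
        fix i assume "i \<in> {0..n}"
        then show "of_nat (n choose i) * (deriv ^^ i) (\<lambda>w. w) 0 * (deriv ^^ (n - i)) (\<phi> v) 0 = 0"
          using less[of "n - i" v] by (cases "i = 0") auto
      qed
      finally show ?thesis .
    qed
    \<comment> \<open>The n-th Taylor coefficient as a functional of v, bounded by Cauchy's
      inequality on the circle of radius 1/2. Its representing vector p is orthogonal to the range
      of T, hence is killed by the injective adjoint of T.\<close>
    have "\<exists>p\<in>UNIV. \<forall>v\<in>UNIV. cnj ((deriv ^^ n) (\<phi> v) 0) = cinner v p"
    proof (rule Riesz_chilbert)
      fix v v' :: 'x and c
      have "\<phi> (v + v') = (\<lambda>w. \<phi> v w + \<phi> v' w)" by (simp add: \<phi>_def cinner_add_right)
      then show "cnj ((deriv ^^ n) (\<phi> (v + v')) 0) = cnj ((deriv ^^ n) (\<phi> v) 0) + cnj ((deriv ^^ n) (\<phi> v') 0)"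
        using higher_deriv_add[OF hol[of v] hol[of v'] open_ball, of 0 n] by simp
      have "\<phi> (c *\<^sub>C v) = (\<lambda>w. cnj c * \<phi> v w)" by (simp add: \<phi>_def cinner_scaleC_right)
      then show "cnj ((deriv ^^ n) (\<phi> (c *\<^sub>C v)) 0) = c * cnj ((deriv ^^ n) (\<phi> v) 0)"
        using higher_deriv_cmult[OF hol[of v] _ open_ball, of 0 n "cnj c"] by simp
      have "cmod ((deriv ^^ n) (\<phi> v) 0) \<le> fact n * (M * norm v) / (1 / 2) ^ n"
      proof (rule Cauchy_inequality)
        show "\<phi> v holomorphic_on ball 0 (1/2)"
          using hol by (rule holomorphic_on_subset) auto
        show "continuous_on (cball 0 (1/2)) (\<phi> v)"
          using holomorphic_on_imp_continuous_on[OF hol] half by (rule continuous_on_subset)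
        fix w :: complex assume "cmod (0 - w) = 1 / 2"
        then have "norm (q w) \<le> M" by (intro M) (simp add: dist_norm)
        then show "cmod (\<phi> v w) \<le> M * norm v"
          unfolding \<phi>_def using Cauchy_Schwarz_cinner[of "q w" v] mult_right_mono[of "norm (q w)" M "norm v"] by simp
      qed simp
      then show "cmod (cnj ((deriv ^^ n) (\<phi> v) 0)) \<le> fact n * M * 2 ^ n * norm v"
        by (simp add: power_divide ac_simps)
    qed auto
    then obtain p where p: "\<And>v. cnj ((deriv ^^ n) (\<phi> v) 0) = cinner v p" by blast
    have "cadjoint T p = cadjoint T 0"
    proof (rule cinner_eqI)
      fix v
      have "cinner v (cadjoint T p) = 0"
        using p[of "T v"] ranT[of v] by (simp flip: cadjoint[OF T])
      then show "cinner v (cadjoint T p) = cinner v (cadjoint T 0)"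
        by (simp flip: cadjoint[OF T, of v 0])
    qed
    then have "p = 0" by (rule injD[OF inj])
    then show ?case using p[of x] by simp
  qed
  have "\<phi> (q z) z = 0"
    by (rule holomorphic_fun_eq_0_on_connected[OF hol _ _ coeff _ z]) auto
  then show ?thesis by (simp add: \<phi>_def)
qed

section \<open>Unitary colligations in closed loop\<close>

text \<open>A unitary operator with zero block D22. U is a total function on the type of states but
  is meaningful only over \<open>X0\<close>; hence the membership hypotheses, and unitarity in the
  form of norm preservation together with surjectivity.\<close>

locale colligation =
  fixes X0 :: "'x::chilbert set"
    and U :: "'x \<times> 'u::chilbert \<times> 'e::chilbert \<Rightarrow> 'x \<times> 'y::chilbert \<times> 'd::chilbert"
  assumes csubspace_X0: "csubspace X0" and closed_X0: "closed X0"
    and U_plus: "h \<in> X0 \<Longrightarrow> h' \<in> X0 \<Longrightarrow> U ((h, a) + (h', a')) = U (h, a) + U (h', a')"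
    and U_scaleC: "h \<in> X0 \<Longrightarrow> U (c *\<^sub>C (h, a)) = c *\<^sub>C U (h, a)"
    and U_norm: "h \<in> X0 \<Longrightarrow> norm (U (h, a)) = norm (h, a)"
    and U_in: "h \<in> X0 \<Longrightarrow> fst (U (h, a)) \<in> X0"
    and U_surj: "k \<in> X0 \<Longrightarrow> \<exists>h\<in>X0. \<exists>a. U (h, a) = (k, b)"
    and U_D22: "snd (snd (U (0, 0, e))) = 0"
begin

lemma U_add: "U (h, a) = (k, b) \<Longrightarrow> U (h', a') = (k', b') \<Longrightarrow> h \<in> X0 \<Longrightarrow> h' \<in> X0 \<Longrightarrow>
    U (h + h', a + a') = (k + k', b + b')"
  using U_plus[of h h' a a'] by simp

lemma U_scale: "U (h, a) = (k, b) \<Longrightarrow> h \<in> X0 \<Longrightarrow> U (c *\<^sub>C h, c *\<^sub>C a) = (c *\<^sub>C k, c *\<^sub>C b)"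
  using U_scaleC[of h c a] by simp

lemma U_diff: 
  assumes "U (h, a) = (k, b)" "U (h', a') = (k', b')" "h \<in> X0" "h' \<in> X0"
  shows "U (h - h', a - a') = (k - k', b - b')"
  using U_add[OF assms(1) U_scale[OF assms(2,4), of "-1"] assms(3) csubspace_scaleC[OF csubspace_X0 assms(4)]]
  by simp

lemma U_zero: "U (0, 0) = (0, 0)"
  using U_norm[of 0 0] csubspace_zero[OF csubspace_X0] by (simp add: zero_prod_def norm_Pair)

lemma U_energy:
  assumes "U (h, u, e) = (k, y, d)" "h \<in> X0"
  shows "(norm k)\<^sup>2 + (norm y)\<^sup>2 + (norm d)\<^sup>2 = (norm h)\<^sup>2 + (norm u)\<^sup>2 + (norm e)\<^sup>2"
  using arg_cong[OF U_norm[OF assms(2), of "(u, e)"], of "\<lambda>t. t\<^sup>2"]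
  unfolding assms(1) by (simp only: norm_Pair_sq)

text \<open>Polarisation: additivity and norm preservation give the real parts, and replacing h by
  \<i> h gives the imaginary parts.\<close>

lemma U_cinner:
  assumes h: "h \<in> X0" "h' \<in> X0"
  shows "cinner (U (h, a)) (U (h', a')) = cinner (h, a) (h', a')"
proof -
  have Re: "Re (cinner (U (g, b)) (U (h', a'))) = Re (cinner (g, b) (h', a'))" if g: "g \<in> X0" for g b
  proof -
    have "norm (U ((g, b) + (h', a'))) = norm ((g, b) + (h', a'))"
      using U_norm[OF csubspace_add[OF csubspace_X0 g h(2)], of "b + a'"] by simp
    then have "(norm (U (g, b) + U (h', a')))\<^sup>2 = (norm ((g, b) + (h', a')))\<^sup>2"
      using U_plus[OF g h(2), of b a'] by (simp only:)
    then show ?thesis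
      unfolding norm_add_sq by (simp add: U_norm g h)
  qed
  have "Re (cinner (\<i> *\<^sub>C U (h, a)) (U (h', a'))) = Re (cinner (\<i> *\<^sub>C (h, a)) (h', a'))"
    using Re[OF csubspace_scaleC[OF csubspace_X0 h(1)], of \<i> "\<i> *\<^sub>C a"] U_scaleC[OF h(1), of \<i> a] by simp
  then have "Im (cinner (U (h, a)) (U (h', a'))) = Im (cinner (h, a) (h', a'))"
    by (simp only: cinner_scaleC_left) simp
  then show ?thesis using Re[OF h(1), of a] by (simp add: complex_eq_iff)
qed

lemma U_inner:
  assumes "U (h, u, e) = (k, y, d)" "U (h', u', e') = (k', y', d')" "h \<in> X0" "h' \<in> X0"
  shows "cinner k k' + cinner y y' + cinner d d' = cinner h h' + cinner u u' + cinner e e'"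
  using U_cinner[OF assms(3,4), of "(u, e)" "(u', e')"] assms(1,2) by (simp add: add.assoc)

lemma U_mem: "U (h, a) = (k, b) \<Longrightarrow> h \<in> X0 \<Longrightarrow> k \<in> X0"
  using U_in[of h a] by simp

lemma U_bound:
  assumes "U (h, u, e) = (k, y, d)" "h \<in> X0"
  shows "norm k \<le> norm h + norm u + norm e" "norm y \<le> norm h + norm u + norm e"
    "norm d \<le> norm h + norm u + norm e"
proof -
  have "norm (k, y, d) = norm (h, u, e)" using U_norm[OF assms(2), of "(u, e)"] assms(1) by simp
  also have "\<dots> \<le> norm h + norm u + norm e"
    using norm_Pair_le[of h "(u, e)"] norm_Pair_le[of u e] by simp
  finally have *: "norm (k, y, d) \<le> norm h + norm u + norm e" .
  have "norm k \<le> norm (k, y, d)" "norm (y, d) \<le> norm (k, y, d)" "norm y \<le> norm (y, d)" "norm d \<le> norm (y, d)"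
    using norm_fst_le[of "k"] norm_snd_le[of "(y, d)" k] norm_fst_le[of y d] norm_snd_le[of d y] by auto
  with * show "norm k \<le> norm h + norm u + norm e" "norm y \<le> norm h + norm u + norm e"
    "norm d \<le> norm h + norm u + norm e" by linarith+
qed

section \<open>The state equation and the transfer function\<close>

lemma mem_X0: "x \<in> X0 \<Longrightarrow> h \<in> X0 \<Longrightarrow> x + z *\<^sub>C h \<in> X0"
  by (intro csubspace_add[OF csubspace_X0] csubspace_scaleC[OF csubspace_X0])

text \<open>Banach's fixed point theorem on \<open>X0\<close>: a change of h reaches the next state
  multiplied by z and through a contraction. This plays the role of the Neumann series for I - z
  A.\<close>

lemma state_ex:
  assumes z: "z \<in> disk" and x: "x \<in> X0"
  shows "\<exists>h\<in>X0. \<exists>b. U (x + z *\<^sub>C h, a) = (h, b)"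
proof -
  define f where "f h = fst (U (x + z *\<^sub>C h, a))" for h
  have "\<exists>!h. h \<in> X0 \<and> f h = h"
  proof (rule Banach_fix)
    show "complete X0" using closed_X0 by (simp add: complete_eq_closed)
    show "X0 \<noteq> {}" using x by blast
    show "0 \<le> cmod z" "cmod z < 1" using z by auto
    show "f ` X0 \<subseteq> X0" unfolding f_def by (rule image_subsetI) (rule U_in[OF mem_X0[OF x]])
    fix h h' assume h: "h \<in> X0" "h' \<in> X0"
    obtain k b k' b' where kb: "U (x + z *\<^sub>C h, a) = (k, b)" "U (x + z *\<^sub>C h', a) = (k', b')"
      by (metis surj_pair)
    have "U (z *\<^sub>C (h - h'), 0, 0) = (k - k', fst (b - b'), snd (b - b'))"
      using U_diff[OF kb mem_X0[OF x h(1)] mem_X0[OF x h(2)]] by (simp add: scaleC_diff_right zero_prod_def prod_eq_iff)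
    from U_bound(1)[OF this csubspace_scaleC[OF csubspace_X0 csubspace_diff[OF csubspace_X0 h]]]
    show "dist (f h) (f h') \<le> cmod z * dist h h'"
      by (simp add: f_def kb dist_norm)
  qed
  then obtain h where "h \<in> X0" "f h = h" by blast
  then show ?thesis by (metis f_def prod.collapse)
qed

lemma state_zero:
  assumes z: "z \<in> disk" and h: "h \<in> X0" "U (z *\<^sub>C h, 0) = (h, b)"
  shows "h = 0"
proof -
  have "norm h \<le> cmod z * norm h"
    using U_bound(1)[of "z *\<^sub>C h" 0 0 h "fst b" "snd b"] h csubspace_scaleC[OF csubspace_X0 h(1)]
    by (simp add: zero_prod_def)
  moreover have "cmod z * norm h < 1 * norm h" if "h \<noteq> 0"
    using z that by (intro mult_strict_right_mono) auto
  ultimately show ?thesis by (metis mult_1 not_le)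
qed

text \<open>Replaces the formula with \<open>inv_into\<close> by the relation
  \<open>U (z h, a) = (h, b)\<close>, in which linearity and energy balance are immediate.
  Injectivity of I - z A on \<open>X0\<close> identifies the inverse with the given state h.\<close>

lemma transfer_function_eq:
  assumes z: "z \<in> disk" and h: "h \<in> X0" "U (z *\<^sub>C h, a) = (h, b)"
  shows "transfer_function X0 U z a = b"
proof -
  have z0: "0 \<in> X0" by (rule csubspace_zero[OF csubspace_X0])
  define A where "A = (\<lambda>h. fst (U (h, 0)))"
  obtain k1 b1 k2 b2 where kb: "U (h, 0) = (k1, b1)" "U (0, a) = (k2, b2)" by (metis surj_pair)
  have eq: "h = z *\<^sub>C k1 + k2" "b = z *\<^sub>C b1 + b2"
    using U_add[OF U_scale[OF kb(1) h(1), of z] kb(2) csubspace_scaleC[OF csubspace_X0 h(1)] z0] h(2) by simp_all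
  have inj: "inj_on (\<lambda>h. h - z *\<^sub>C A h) X0"
  proof (rule inj_onI)
    fix g g' assume g: "g \<in> X0" "g' \<in> X0" "g - z *\<^sub>C A g = g' - z *\<^sub>C A g'"
    obtain p q p' q' where pq: "U (g, 0) = (p, q)" "U (g', 0) = (p', q')" by (metis surj_pair)
    have "U (z *\<^sub>C (g - g'), 0) = (z *\<^sub>C (p - p'), z *\<^sub>C (q - q'))"
      using U_scale[OF U_diff[OF pq g(1,2)] csubspace_diff[OF csubspace_X0 g(1,2)], of z] by simp
    moreover have "z *\<^sub>C (p - p') = g - g'"
      using g(3) by (simp add: A_def pq scaleC_diff_right algebra_simps)
    ultimately have "g - g' = 0"
      using state_zero[OF z csubspace_diff[OF csubspace_X0 g(1,2)]] by simp
    then show "g = g'" by simp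
  qed
  have "inv_into X0 (\<lambda>h. h - z *\<^sub>C A h) k2 = h"
    by (rule inv_into_f_eq[OF inj h(1)]) (use eq kb in \<open>simp add: A_def\<close>)
  then show ?thesis
    unfolding transfer_function_def Let_def A_def by (simp add: kb eq(2) add.commute)
qed

lemma transfer_function_ex:
  assumes z: "z \<in> disk"
  shows "\<exists>h\<in>X0. U (z *\<^sub>C h, a) = (h, transfer_function X0 U z a)"
  using state_ex[OF z csubspace_zero[OF csubspace_X0], of a] transfer_function_eq[OF z] by fastforce

lemma transfer_function_add:
  assumes z: "z \<in> disk"
  shows "transfer_function X0 U z (a + a') = transfer_function X0 U z a + transfer_function X0 U z a'"
proof -
  obtain h h' where h: "h \<in> X0" "U (z *\<^sub>C h, a) = (h, transfer_function X0 U z a)"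
    and h': "h' \<in> X0" "U (z *\<^sub>C h', a') = (h', transfer_function X0 U z a')"
    using transfer_function_ex[OF z] by meson
  show ?thesis
    by (rule transfer_function_eq[OF z csubspace_add[OF csubspace_X0 h(1) h'(1)]])
      (use U_add[OF h(2) h'(2)] h h' in \<open>simp add: scaleC_add_right csubspace_scaleC[OF csubspace_X0]\<close>)
qed

lemma transfer_function_scaleC:
  assumes z: "z \<in> disk"
  shows "transfer_function X0 U z (c *\<^sub>C a) = c *\<^sub>C transfer_function X0 U z a"
proof -
  obtain h where h: "h \<in> X0" "U (z *\<^sub>C h, a) = (h, transfer_function X0 U z a)"
    using transfer_function_ex[OF z] by meson
  show ?thesis
    by (rule transfer_function_eq[OF z csubspace_scaleC[OF csubspace_X0 h(1), of c]])
      (use U_scale[OF h(2), of c] h in \<open>simp add: csubspace_scaleC[OF csubspace_X0] scaleC_scaleC mult.commute\<close>)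
qed

text \<open>Energy conservation and \<open>D\<^sub>2\<^sub>2 = 0\<close> replace the maximum principle here.\<close>

lemma Schwarz_D22:
  assumes z: "z \<in> disk" and h: "h \<in> X0" "U (z *\<^sub>C h, 0, e) = (h, y, d)"
  shows "norm d \<le> cmod z * norm e"
proof -
  define r where "r = (cmod z)\<^sup>2"
  have r: "0 \<le> r" "r \<le> 1" using z by (auto simp: r_def power_le_one)
  have zh: "z *\<^sub>C h \<in> X0" by (rule csubspace_scaleC[OF csubspace_X0 h(1)])
  \<comment> \<open>Because D22 vanishes, e has no direct effect on d, which gives |d| \<le> |z|
    |h|. The energy balance bounds (1 - |z|^2) |h|^2 by |e|^2 - |d|^2; eliminating |h| leaves the
    claim.\<close>
  obtain k1 y1 d1 k2 y2 where kyd: "U (z *\<^sub>C h, 0, 0) = (k1, y1, d1)" "U (0, 0, e) = (k2, y2, 0)"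
    using U_D22[of e] by (metis surj_pair snd_conv)
  have "d = d1"
    using U_add[OF kyd zh csubspace_zero[OF csubspace_X0]] h(2) by simp
  then have "(norm d)\<^sup>2 \<le> r * (norm h)\<^sup>2"
    using U_energy[OF kyd(1) zh] by (simp add: r_def power_mult_distrib) (smt (verit) zero_le_power2)
  then have 1: "(1 - r) * (norm d)\<^sup>2 \<le> (1 - r) * (r * (norm h)\<^sup>2)"
    using r by (intro mult_left_mono) auto
  have "(norm d)\<^sup>2 + (1 - r) * (norm h)\<^sup>2 \<le> (norm e)\<^sup>2"
  proof -
    have "(norm h)\<^sup>2 + (norm y)\<^sup>2 + (norm d)\<^sup>2 = r * (norm h)\<^sup>2 + (norm e)\<^sup>2"
      using U_energy[OF h(2) zh] by (simp add: r_def power_mult_distrib)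
    moreover have "0 \<le> (norm y)\<^sup>2" by simp
    ultimately show ?thesis unfolding left_diff_distrib by linarith
  qed
  then have "r * ((norm d)\<^sup>2 + (1 - r) * (norm h)\<^sup>2) \<le> r * (norm e)\<^sup>2"
    using r by (intro mult_left_mono) auto
  with 1 have "(norm d)\<^sup>2 \<le> r * (norm e)\<^sup>2" by (simp add: algebra_simps)
  then have "(norm d)\<^sup>2 \<le> (cmod z * norm e)\<^sup>2" by (simp add: r_def power_mult_distrib)
  then show ?thesis by (rule power2_le_imp_le) simp
qed

text \<open>The colligation with the feedback \<open>e = e\<^sub>0 + K d\<close>; \<open>x\<close> is the initial state and \<open>h\<close> the generating
  function of the later states, evaluated at \<open>z\<close>.\<close>

definition loop :: "('d \<Rightarrow> 'e) \<Rightarrow> complex \<Rightarrow> 'x \<Rightarrow> 'u \<Rightarrow> 'e \<Rightarrow> 'x \<Rightarrow> 'e \<Rightarrow> 'y \<Rightarrow> 'd \<Rightarrow> bool" where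
  "loop K z x u e0 h e y d \<longleftrightarrow>
     x \<in> X0 \<and> h \<in> X0 \<and> U (x + z *\<^sub>C h, u, e) = (h, y, d) \<and> e = e0 + K d"

lemma loop_add:
  assumes K: "bounded_clinear K" and l: "loop K z x u e0 h e y d" "loop K z x' u' e0' h' e' y' d'"
  shows "loop K z (x + x') (u + u') (e0 + e0') (h + h') (e + e') (y + y') (d + d')"
  using l U_add[of "x + z *\<^sub>C h" "(u, e)" h "(y, d)" "x' + z *\<^sub>C h'" "(u', e')" h' "(y', d')"]
  by (clarsimp simp add: loop_def mem_X0 bounded_clinear_add[OF K] csubspace_add[OF csubspace_X0] scaleC_add_right algebra_simps)

lemma loop_scale:
  assumes K: "bounded_clinear K" and l: "loop K z x u e0 h e y d"
  shows "loop K z (c *\<^sub>C x) (c *\<^sub>C u) (c *\<^sub>C e0) (c *\<^sub>C h) (c *\<^sub>C e) (c *\<^sub>C y) (c *\<^sub>C d)"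
  using l U_scale[of "x + z *\<^sub>C h" "(u, e)" h "(y, d)" c]
  by (clarsimp simp add: loop_def mem_X0 bounded_clinear_scaleC[OF K] csubspace_scaleC[OF csubspace_X0] scaleC_add_right
      scaleC_scaleC mult.commute)

lemma loop_diff:
  assumes K: "bounded_clinear K" and l: "loop K z x u e0 h e y d" "loop K z x' u' e0' h' e' y' d'"
  shows "loop K z (x - x') (u - u') (e0 - e0') (h - h') (e - e') (y - y') (d - d')"
  using loop_add[OF K l(1) loop_scale[OF K l(2), of "-1"]] by simp

text \<open>With \<kappa> = 1 / (1 - r), three equations of the form t \<le> q + |z| t are solved in
  succession, each at the cost of a factor \<kappa>: the state h0 for e = 0, the signal e (by the
  Schwarz estimate for \<open>\<Sigma>22\<close>), and the rest h - h0 of the state. The sum of the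
  three input norms of U is then at most (1 + 2 + 1) \<kappa>^3 times the data. The bound is uniform
  in |z| \<le> r, as the limits in z below require.\<close>

lemma loop_bound:
  assumes K: "\<And>d. norm (K d) \<le> norm d" and z: "cmod z \<le> r" "r < 1" and l: "loop K z x u e0 h e y d"
  shows "norm h \<le> 4 / (1 - r) ^ 3 * (norm x + norm u + norm e0)"
    "norm e \<le> 4 / (1 - r) ^ 3 * (norm x + norm u + norm e0)"
    "norm y \<le> 4 / (1 - r) ^ 3 * (norm x + norm u + norm e0)"
    "norm d \<le> 4 / (1 - r) ^ 3 * (norm x + norm u + norm e0)"
proof -
  define \<kappa> where "\<kappa> = 1 / (1 - r)"
  define s where "s = norm x + norm u + norm e0"
  have r0: "0 \<le> r" using z norm_ge_zero order_trans by blast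
  have zd: "z \<in> disk" using z by simp
  have solve: "t \<le> \<kappa> * q" if "t \<le> q + cmod z * t" "0 \<le> t" for t q
  proof -
    have "cmod z * t \<le> r * t" using z(1) that(2) by (rule mult_right_mono)
    with that(1) have "t * (1 - r) \<le> q" by (simp add: algebra_simps)
    then show ?thesis using z(2) by (simp add: \<kappa>_def field_simps)
  qed
  have k1: "1 \<le> \<kappa>" using r0 z(2) by (simp add: \<kappa>_def field_simps)
  have xh: "x \<in> X0" "h \<in> X0" "U (x + z *\<^sub>C h, u, e) = (h, y, d)" "e = e0 + K d"
    using l by (auto simp: loop_def)
  obtain h0 y0 d0 where h0: "h0 \<in> X0" "U (x + z *\<^sub>C h0, u, 0) = (h0, y0, d0)"
    using state_ex[OF zd xh(1), of "(u, 0)"] by (metis surj_pair)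
  have n0: "norm (x + z *\<^sub>C h0) \<le> norm x + cmod z * norm h0"
    using norm_triangle_ineq[of x "z *\<^sub>C h0"] by simp
  have h0b: "norm h0 \<le> \<kappa> * (norm x + norm u)"
    using U_bound(1)[OF h0(2) mem_X0[OF xh(1) h0(1)]] n0 by (intro solve) auto
  have "cmod z * norm h0 \<le> 1 * norm h0" using z by (intro mult_right_mono) auto
  have d0b: "norm d0 \<le> \<kappa> * (norm x + norm u)"
  proof -
    have "norm d0 \<le> (norm x + norm u) + r * norm h0"
      using U_bound(3)[OF h0(2) mem_X0[OF xh(1) h0(1)]] n0 mult_right_mono[OF z(1), of "norm h0"] by simp
    also have "\<dots> \<le> (norm x + norm u) + r * (\<kappa> * (norm x + norm u))"
      using h0b r0 by (intro add_left_mono mult_left_mono) auto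
    also have "\<dots> = \<kappa> * (norm x + norm u)"
      using z(2) by (simp add: \<kappa>_def field_simps)
    finally show ?thesis .
  qed
  have D: "U (z *\<^sub>C (h - h0), 0, e) = (h - h0, y - y0, d - d0)"
    using U_diff[OF xh(3) h0(2) mem_X0[OF xh(1,2)] mem_X0[OF xh(1) h0(1)]] by (simp add: scaleC_diff_right)
  have hh: "h - h0 \<in> X0" by (rule csubspace_diff[OF csubspace_X0 xh(2) h0(1)])
  have dd: "norm (d - d0) \<le> cmod z * norm e" by (rule Schwarz_D22[OF zd hh D])
  have "norm e \<le> norm e0 + norm d" using xh(4) norm_triangle_ineq[of e0 "K d"] K[of d] by simp
  moreover have "norm d \<le> norm d0 + norm (d - d0)" using norm_triangle_ineq[of d0 "d - d0"] by simp
  ultimately have eb: "norm e \<le> \<kappa> * (norm e0 + norm d0)"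
    using dd by (intro solve) auto
  have ks: "0 \<le> \<kappa> * s" using k1 by (simp add: s_def)
  have "norm e0 + norm d0 \<le> \<kappa> * s"
    using d0b mult_right_mono[OF k1, of "norm e0"] by (simp add: s_def algebra_simps)
  then have "\<kappa> * (norm e0 + norm d0) \<le> \<kappa> * (\<kappa> * s)"
    using k1 by (intro mult_left_mono) auto
  with eb have e2: "norm e \<le> \<kappa>\<^sup>2 * s"
    by (simp only: power2_eq_square mult.assoc)
  have hb': "norm (h - h0) \<le> \<kappa> * norm e"
    using U_bound(1)[OF D csubspace_scaleC[OF csubspace_X0 hh]] by (intro solve) auto
  have p12: "s \<le> \<kappa> * s" "\<kappa> * s \<le> \<kappa>\<^sup>2 * s" "\<kappa>\<^sup>2 * s \<le> \<kappa> ^ 3 * s"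
    using k1 mult_right_mono[OF k1, of s] mult_right_mono[OF k1, of "\<kappa> * s"] mult_right_mono[OF k1, of "\<kappa>\<^sup>2 * s"] ks
    by (simp_all add: s_def power2_eq_square power3_eq_cube mult.assoc)
  have "\<kappa> * norm e \<le> \<kappa> * (\<kappa>\<^sup>2 * s)" using e2 k1 by (intro mult_left_mono) auto
  then have "norm (h - h0) \<le> \<kappa> ^ 3 * s" using hb' by (simp add: power2_eq_square power3_eq_cube mult.assoc)
  moreover have "norm h0 \<le> \<kappa> * s"
  proof -
    have "\<kappa> * (norm x + norm u) \<le> \<kappa> * s" using k1 by (intro mult_left_mono) (auto simp: s_def)
    with h0b show ?thesis by (rule order_trans)
  qed
  ultimately have h2: "norm h \<le> 2 * (\<kappa> ^ 3 * s)"
    using norm_triangle_ineq[of h0 "h - h0"] p12 by simp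
  have "norm (x + z *\<^sub>C h) \<le> norm x + norm h"
    using norm_triangle_ineq[of x "z *\<^sub>C h"] mult_right_mono[of "cmod z" 1 "norm h"] z by simp
  moreover have "norm x + norm u \<le> s" by (simp add: s_def)
  ultimately have tot: "norm (x + z *\<^sub>C h) + norm u + norm e \<le> 4 * (\<kappa> ^ 3 * s)"
    using h2 e2 p12 by linarith
  have eqk: "4 / (1 - r) ^ 3 * (norm x + norm u + norm e0) = 4 * (\<kappa> ^ 3 * s)"
    by (simp add: \<kappa>_def s_def power_divide)
  note ub = U_bound[OF xh(3) mem_X0[OF xh(1,2)]]
  show "norm h \<le> 4 / (1 - r) ^ 3 * (norm x + norm u + norm e0)"
    "norm e \<le> 4 / (1 - r) ^ 3 * (norm x + norm u + norm e0)"
    "norm y \<le> 4 / (1 - r) ^ 3 * (norm x + norm u + norm e0)"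
    "norm d \<le> 4 / (1 - r) ^ 3 * (norm x + norm u + norm e0)"
    unfolding eqk using ub tot e2 p12 ks by linarith+
qed

lemma loop_unique:
  assumes K: "bounded_clinear K" "\<And>d. norm (K d) \<le> norm d" and z: "z \<in> disk"
    and l: "loop K z x u e0 h e y d" "loop K z x u e0 h' e' y' d'"
  shows "h = h'" "e = e'" "y = y'" "d = d'"
  using loop_bound[OF K(2) order_refl _ loop_diff[OF K(1) l]] z by simp_all

lemma block22_bound:
  assumes z: "z \<in> disk"
  shows "norm (block22 (transfer_function X0 U) z v) \<le> cmod z * norm v"
proof -
  obtain h where h: "h \<in> X0" "U (z *\<^sub>C h, 0, v) = (h, transfer_function X0 U z (0, v))"
    using transfer_function_ex[OF z] by meson
  then show ?thesis
    using Schwarz_D22[OF z h(1), of v "fst (transfer_function X0 U z (0, v))" "block22 (transfer_function X0 U) z v"]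
    by (simp add: block22_def)
qed

lemma block22_diff:
  assumes z: "z \<in> disk"
  shows "block22 (transfer_function X0 U) z (v - w)
    = block22 (transfer_function X0 U) z v - block22 (transfer_function X0 U) z w"
  using transfer_function_add[OF z, of "(0, v - w)" "(0, w)"] by (simp add: block22_def prod_eq_iff)

text \<open>By superposition. The response for e = 0 leaves the equation
  \<open>e = e0 + K (d0 + \<Sigma>22(z) e)\<close>, a contraction with constant |z|; the response to
  e alone is added to the first one.\<close>

lemma loop_ex:
  assumes K: "bounded_clinear K" "\<And>d. norm (K d) \<le> norm d" and z: "z \<in> disk" and x: "x \<in> X0"
  shows "\<exists>h e y d. loop K z x u e0 h e y d"
proof -
  obtain h0 y0 d0 where h0: "h0 \<in> X0" "U (x + z *\<^sub>C h0, u, 0) = (h0, y0, d0)"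
    using state_ex[OF z x, of "(u, 0)"] by (metis surj_pair)
  define B where "B = block22 (transfer_function X0 U) z"
  have "\<exists>!e. e0 + K (d0 + B e) = e"
  proof (rule banach_fix_type)
    show "0 \<le> cmod z" "cmod z < 1" using z by auto
    show "\<forall>v w. dist (e0 + K (d0 + B v)) (e0 + K (d0 + B w)) \<le> cmod z * dist v w"
    proof (intro allI)
      fix v w
      have "dist (e0 + K (d0 + B v)) (e0 + K (d0 + B w)) = norm (K (B (v - w)))"
        by (simp add: dist_norm B_def block22_diff[OF z] flip: bounded_clinear_diff[OF K(1)])
      also have "\<dots> \<le> cmod z * dist v w"
        using K(2)[of "B (v - w)"] block22_bound[OF z, of "v - w"] by (simp add: B_def dist_norm)
      finally show "dist (e0 + K (d0 + B v)) (e0 + K (d0 + B w)) \<le> cmod z * dist v w" .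
    qed
  qed
  then obtain e where e: "e = e0 + K (d0 + B e)" by metis
  obtain h1 where h1: "h1 \<in> X0" "U (z *\<^sub>C h1, 0, e) = (h1, transfer_function X0 U z (0, e))"
    using transfer_function_ex[OF z] by meson
  have "U ((x + z *\<^sub>C h0) + z *\<^sub>C h1, (u, 0) + (0, e)) = (h0 + h1, (y0, d0) + transfer_function X0 U z (0, e))"
    by (rule U_add[OF h0(2) h1(2) mem_X0[OF x h0(1)] csubspace_scaleC[OF csubspace_X0 h1(1)]])
  then have "loop K z x u e0 (h0 + h1) e (y0 + block12 (transfer_function X0 U) z e) (d0 + B e)"
    using e x csubspace_add[OF csubspace_X0 h0(1) h1(1)]
    by (simp add: loop_def scaleC_add_right add.assoc block12_def B_def block22_def prod_eq_iff)
  then show ?thesis by blast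
qed

text \<open>The output H(z) x + S(z) u + G(z) e0 of the overview; the choice is determined because
  the loop has one solution.\<close>

definition loop_out :: "('d \<Rightarrow> 'e) \<Rightarrow> complex \<Rightarrow> 'x \<Rightarrow> 'u \<Rightarrow> 'e \<Rightarrow> 'y" where
  "loop_out K z x u e0 = (SOME y. \<exists>h e d. loop K z x u e0 h e y d)"

lemma loop_out_eq:
  assumes K: "bounded_clinear K" "\<And>d. norm (K d) \<le> norm d" and z: "z \<in> disk"
    and l: "loop K z x u e0 h e y d"
  shows "loop_out K z x u e0 = y"
proof -
  have "\<exists>h e d. loop K z x u e0 h e (loop_out K z x u e0) d"
    unfolding loop_out_def by (rule someI[of _ y]) (use l in blast)
  then show ?thesis using loop_unique(3)[OF K z _ l] by blast
qed

lemma loop_out: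
  assumes K: "bounded_clinear K" "\<And>d. norm (K d) \<le> norm d" and z: "z \<in> disk" and x: "x \<in> X0"
  obtains h e d where "loop K z x u e0 h e (loop_out K z x u e0) d"
  using loop_ex[OF K z x, of u e0] loop_out_eq[OF K z, of x u e0] by metis

lemma loop_out_add:
  assumes K: "bounded_clinear K" "\<And>d. norm (K d) \<le> norm d" and z: "z \<in> disk" and x: "x \<in> X0" "x' \<in> X0"
  shows "loop_out K z (x + x') (u + u') (e + e') = loop_out K z x u e + loop_out K z x' u' e'"
proof -
  obtain h1 e1 d1 h2 e2 d2 where l: "loop K z x u e h1 e1 (loop_out K z x u e) d1"
    "loop K z x' u' e' h2 e2 (loop_out K z x' u' e') d2"
    using loop_out[OF K z] x by metis
  show ?thesis by (rule loop_out_eq[OF K z loop_add[OF K(1) l]])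
qed

lemma loop_out_scale:
  assumes K: "bounded_clinear K" "\<And>d. norm (K d) \<le> norm d" and z: "z \<in> disk" and x: "x \<in> X0"
  shows "loop_out K z (c *\<^sub>C x) (c *\<^sub>C u) (c *\<^sub>C e) = c *\<^sub>C loop_out K z x u e"
proof -
  obtain h1 e1 d1 where l: "loop K z x u e h1 e1 (loop_out K z x u e) d1"
    using loop_out[OF K z] x by metis
  show ?thesis by (rule loop_out_eq[OF K z loop_scale[OF K(1) l]])
qed

lemma loop_out_bound:
  assumes K: "bounded_clinear K" "\<And>d. norm (K d) \<le> norm d" and z: "z \<in> disk" and x: "x \<in> X0"
  shows "norm (loop_out K z x u e) \<le> 4 / (1 - cmod z) ^ 3 * (norm x + norm u + norm e)"
proof -
  obtain h1 e1 d1 where l: "loop K z x u e h1 e1 (loop_out K z x u e) d1"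
    using loop_out[OF K z] x by metis
  show ?thesis by (rule loop_bound(3)[OF K(2) order_refl _ l]) (use z in simp)
qed

text \<open>The state equation for the inverse of U. The preimages are chosen by f, but since U
  preserves norms, differences of preimages are controlled by differences of images, and f is again
  a contraction with constant |z|.\<close>

lemma adjoint_state_ex:
  assumes z: "z \<in> disk"
  shows "\<exists>k\<in>X0. \<exists>a. U (k, a) = (cnj z *\<^sub>C k, b)"
proof -
  have sc: "cnj z *\<^sub>C k \<in> X0" if "k \<in> X0" for k by (rule csubspace_scaleC[OF csubspace_X0 that])
  have "\<forall>k\<in>X0. \<exists>h. h \<in> X0 \<and> (\<exists>a. U (h, a) = (cnj z *\<^sub>C k, b))"
    using U_surj[OF sc] by blast
  then obtain f where f: "\<And>k. k \<in> X0 \<Longrightarrow> f k \<in> X0" "\<And>k. k \<in> X0 \<Longrightarrow> \<exists>a. U (f k, a) = (cnj z *\<^sub>C k, b)"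
    by metis
  have "\<exists>!k. k \<in> X0 \<and> f k = k"
  proof (rule Banach_fix)
    show "complete X0" using closed_X0 by (simp add: complete_eq_closed)
    show "X0 \<noteq> {}" using csubspace_zero[OF csubspace_X0] by blast
    show "0 \<le> cmod z" "cmod z < 1" using z by auto
    show "f ` X0 \<subseteq> X0" using f(1) by blast
    fix k k' assume k: "k \<in> X0" "k' \<in> X0"
    obtain a a' where a: "U (f k, a) = (cnj z *\<^sub>C k, b)" "U (f k', a') = (cnj z *\<^sub>C k', b)"
      using f(2)[OF k(1)] f(2)[OF k(2)] by blast
    have "U (f k - f k', a - a') = (cnj z *\<^sub>C (k - k'), 0)"
      using U_diff[OF a f(1)[OF k(1)] f(1)[OF k(2)]] by (simp add: scaleC_diff_right)
    then have "norm (f k - f k', a - a') = norm (cnj z *\<^sub>C (k - k'), 0 :: 'y \<times> 'd)"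
      using U_norm[OF csubspace_diff[OF csubspace_X0 f(1)[OF k(1)] f(1)[OF k(2)]], of "a - a'"] by simp
    then show "dist (f k) (f k') \<le> cmod z * dist k k'"
      using norm_fst_le[of "f k - f k'" "a - a'"] by (simp add: dist_norm norm_Pair)
  qed
  then show ?thesis using f(2) by metis
qed

text \<open>The graph of U over the closed set \<open>X0\<close> is closed. This allows passing from
  finite sums of trajectories to power series.\<close>

lemma U_tendsto:
  assumes h: "\<And>n::nat. h n \<in> X0" "h \<longlonglongrightarrow> g" and a: "a \<longlonglongrightarrow> c"
    and U: "\<And>n. U (h n, a n) = (k n, b n)" and k: "k \<longlonglongrightarrow> l" and b: "b \<longlonglongrightarrow> q"
  shows "U (g, c) = (l, q)"
proof -
  have g: "g \<in> X0" using closed_sequentially[OF closed_X0] h by blast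
  have "(\<lambda>n. U (h n, a n)) \<longlonglongrightarrow> U (g, c)"
  proof (rule LIM_zero_cancel, rule Lim_null_comparison)
    have "norm (U (h n, a n) - U (g, c)) = norm (h n - g, a n - c)" for n
    proof -
      obtain k' b' where kb: "U (g, c) = (k', b')" by (metis surj_pair)
      show ?thesis
        using U_norm[OF csubspace_diff[OF csubspace_X0 h(1)[of n] g], of "a n - c"] U_diff[OF U[of n] kb h(1) g]
        by (simp add: U kb)
    qed
    then show "\<forall>\<^sub>F n in sequentially. norm (U (h n, a n) - U (g, c)) \<le> norm (h n - g, a n - c)" by simp
    have "(\<lambda>n. norm (h n - g, a n - c)) \<longlonglongrightarrow> norm (g - g, c - c)" by (intro tendsto_intros h a)
    then show "(\<lambda>n. norm (h n - g, a n - c)) \<longlonglongrightarrow> 0" by (simp add: norm_Pair)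
  qed
  moreover have "(\<lambda>n. U (h n, a n)) \<longlonglongrightarrow> (l, q)" unfolding U by (intro tendsto_intros k b)
  ultimately show ?thesis by (rule LIMSEQ_unique)
qed

section \<open>The Redheffer transform as a closed loop\<close>

abbreviation "Sg \<equiv> transfer_function X0 U"

text \<open>The loop supplies the preimage e of v, so \<open>inv\<close> is determined by
  injectivity; a nonzero kernel vector would satisfy |v| \<le> |z| |v|.\<close>

lemma feedback_inv:
  assumes K: "bounded_clinear K" "\<And>d. norm (K d) \<le> norm d" and z: "z \<in> disk"
    and e: "e - K (block22 Sg z e) = v"
  shows "inv (\<lambda>v. v - K (block22 Sg z v)) v = e"
proof (rule inv_f_eq[where f = "\<lambda>v. v - K (block22 Sg z v)", OF _ e], rule injI)
  fix v w assume eq: "v - K (block22 Sg z v) = w - K (block22 Sg z w)"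
  then have "v - w = K (block22 Sg z (v - w))"
    by (simp add: block22_diff[OF z] bounded_clinear_diff[OF K(1)] algebra_simps)
  then have "norm (v - w) \<le> cmod z * norm (v - w)"
    by (metis K(2) block22_bound[OF z] order_trans)
  moreover have "cmod z * norm (v - w) < 1 * norm (v - w)" if "v \<noteq> w"
    using z that by (intro mult_strict_right_mono) auto
  ultimately show "v = w" by (metis mult_1 not_le)
qed

lemma loop_transfer:
  assumes z: "z \<in> disk" and l: "loop K z 0 u e0 h e y d"
  shows "y = block11 Sg z u + block12 Sg z e" "d = block21 Sg z u + block22 Sg z e" "e = e0 + K d"
proof -
  have "h \<in> X0" "U (z *\<^sub>C h, u, e) = (h, y, d)" and e: "e = e0 + K d"
    using l unfolding loop_def by auto
  from transfer_function_eq[OF z this(1,2)] transfer_function_add[OF z, of "(u, 0)" "(0, e)"]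
  show "y = block11 Sg z u + block12 Sg z e" "d = block21 Sg z u + block22 Sg z e"
    by (auto simp: block11_def block12_def block21_def block22_def prod_eq_iff)
  show "e = e0 + K d" by (rule e)
qed

lemma redheffer_eq:
  assumes E: "\<E> \<in> schur_class" and z: "z \<in> disk" and l: "loop (\<E> z) z 0 u 0 h e y d"
  shows "redheffer Sg \<E> z u = y"
proof -
  note K = schur_class_bounded_clinear[OF E z] schur_class_contraction[OF E z]
  note t = loop_transfer[OF z l]
  have "inv (\<lambda>v. v - \<E> z (block22 Sg z v)) (\<E> z (block21 Sg z u)) = e"
  proof (rule feedback_inv[OF K z])
    have "e = \<E> z (block21 Sg z u + block22 Sg z e)" using t(2,3) by simp
    then show "e - \<E> z (block22 Sg z e) = \<E> z (block21 Sg z u)"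
      unfolding bounded_clinear_add[OF K(1)] by (metis add_diff_cancel)
  qed
  then show ?thesis using z t(1) by (simp add: redheffer_def)
qed

lemma redheffer_G_eq:
  assumes E: "\<E> \<in> schur_class" and z: "z \<in> disk" and l: "loop (\<E> z) z 0 0 e0 h e y d"
  shows "redheffer_G Sg \<E> z e0 = y"
proof -
  note K = schur_class_bounded_clinear[OF E z] schur_class_contraction[OF E z]
  note t = loop_transfer[OF z l]
  have 0: "block11 Sg z 0 = 0" "block21 Sg z 0 = 0"
    using transfer_function_scaleC[OF z, of 0 0] by (auto simp: block11_def block21_def zero_prod_def)
  have "inv (\<lambda>v. v - \<E> z (block22 Sg z v)) e0 = e"
    by (rule feedback_inv[OF K z]) (use t(2,3) 0 in \<open>simp\<close>)
  then show ?thesis using t(1) 0 by (simp add: redheffer_G_def)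
qed

lemma redheffer_loop_out:
  assumes E: "\<E> \<in> schur_class" and z: "z \<in> disk"
  shows "redheffer Sg \<E> z u = loop_out (\<E> z) z 0 u 0"
proof -
  obtain h e d where "loop (\<E> z) z 0 u 0 h e (loop_out (\<E> z) z 0 u 0) d"
    using loop_out[OF schur_class_bounded_clinear[OF E z] schur_class_contraction[OF E z] z csubspace_zero[OF csubspace_X0]]
    by metis
  then show ?thesis by (rule redheffer_eq[OF E z])
qed

lemma redheffer_G_loop_out:
  assumes E: "\<E> \<in> schur_class" and z: "z \<in> disk"
  shows "redheffer_G Sg \<E> z e0 = loop_out (\<E> z) z 0 0 e0"
proof -
  obtain h e d where "loop (\<E> z) z 0 0 e0 h e (loop_out (\<E> z) z 0 0 e0) d"
    using loop_out[OF schur_class_bounded_clinear[OF E z] schur_class_contraction[OF E z] z csubspace_zero[OF csubspace_X0]]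
    by metis
  then show ?thesis by (rule redheffer_G_eq[OF E z])
qed

text \<open>Difference quotients of solutions of the closed loop solve the closed loop again, with inputs
  that converge.\<close>

lemma loop_holomorphic:
  assumes E: "\<E> \<in> schur_class" and f: "holomorphic_vec f"
    and l: "\<And>z. z \<in> disk \<Longrightarrow> loop (\<E> z) z 0 u (f z) (h z) (e z) (y z) (d z)"
  shows "holomorphic_vec h" "holomorphic_vec y"
proof -
  have "\<exists>h' y'. has_cderiv h h' z \<and> has_cderiv y y' z" if z: "z \<in> disk" for z
  proof -
    note K = schur_class_bounded_clinear[OF E] schur_class_contraction[OF E]
    obtain f' where f': "has_cderiv f f' z" using f z unfolding holomorphic_vec_iff by blast
    obtain m where m: "has_cderiv (\<lambda>w. \<E> w (d z)) m z"
      using schur_class_holomorphic_vec[OF E] z unfolding holomorphic_vec_iff by blast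
    have hz: "h z \<in> X0" using l[OF z] by (simp add: loop_def)
    \<comment> \<open>Candidates for the derivatives, from formal differentiation of the loop: the
      derivative of z h(z) contributes the initial state h(z), the constant input u contributes 0,
      and the derivative of f and of \<E> at the fixed vector d(z) contribute f' + m.\<close>
    obtain h' e' y' d' where l': "loop (\<E> z) z (h z) 0 (f' + m) h' e' y' d'"
      using loop_ex[OF K(1)[OF z] K(2)[OF z] z hz] by metis
    have e': "e' = f' + m + \<E> z d'" using l' by (simp add: loop_def)
    \<comment> \<open>The defect in the feedback equation. Difference quotient minus candidate
      solves the loop at w with initial state (w - z) h' and with r(w) as e0; both tend to
      0.\<close>
    define r where "r w = inverse (w - z) *\<^sub>C (f w - f z) + inverse (w - z) *\<^sub>C (\<E> w (d z) - \<E> z (d z))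
      - (e' - \<E> w d')" for w
    have quot: "loop (\<E> w) w ((w - z) *\<^sub>C h') 0 (r w) (inverse (w - z) *\<^sub>C (h w - h z) - h')
        (inverse (w - z) *\<^sub>C (e w - e z) - e') (inverse (w - z) *\<^sub>C (y w - y z) - y')
        (inverse (w - z) *\<^sub>C (d w - d z) - d')"
      if w: "w \<in> disk" "w \<noteq> z" for w
    proof -
      have lw: "U (w *\<^sub>C h w, u, e w) = (h w, y w, d w)" "h w \<in> X0" "e w = f w + \<E> w (d w)"
        using l[OF w(1)] by (auto simp: loop_def)
      have lz: "U (z *\<^sub>C h z, u, e z) = (h z, y z, d z)" "e z = f z + \<E> z (d z)"
        using l[OF z] by (auto simp: loop_def)
      have l'': "U (h z + z *\<^sub>C h', 0, e') = (h', y', d')" "h' \<in> X0" using l' by (auto simp: loop_def)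
      note sc = csubspace_scaleC[OF csubspace_X0] and df = csubspace_diff[OF csubspace_X0]
      have 1: "U (w *\<^sub>C h w - z *\<^sub>C h z, (u, e w) - (u, e z)) = (h w - h z, (y w, d w) - (y z, d z))"
        by (rule U_diff[OF lw(1) lz(1) sc[OF lw(2)] sc[OF hz]])
      have 2: "U (inverse (w - z) *\<^sub>C (w *\<^sub>C h w - z *\<^sub>C h z), inverse (w - z) *\<^sub>C ((u, e w) - (u, e z)))
        = (inverse (w - z) *\<^sub>C (h w - h z), inverse (w - z) *\<^sub>C ((y w, d w) - (y z, d z)))"
        by (rule U_scale[OF 1 df[OF sc[OF lw(2)] sc[OF hz]]])
      have 3: "U (inverse (w - z) *\<^sub>C (w *\<^sub>C h w - z *\<^sub>C h z) - (h z + z *\<^sub>C h'),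
          inverse (w - z) *\<^sub>C ((u, e w) - (u, e z)) - (0, e'))
        = (inverse (w - z) *\<^sub>C (h w - h z) - h', inverse (w - z) *\<^sub>C ((y w, d w) - (y z, d z)) - (y', d'))"
        by (rule U_diff[OF 2 l''(1) sc[OF df[OF sc[OF lw(2)] sc[OF hz]]] mem_X0[OF hz l''(2)]])
      have "w *\<^sub>C h w - z *\<^sub>C h z = w *\<^sub>C (h w - h z) + (w - z) *\<^sub>C h z"
        by (simp add: scaleC_diff_right scaleC_diff_left)
      then have "inverse (w - z) *\<^sub>C (w *\<^sub>C h w - z *\<^sub>C h z)
          = w *\<^sub>C (inverse (w - z) *\<^sub>C (h w - h z)) + h z"
        using w(2) by (simp add: scaleC_add_right scaleC_scaleC mult.commute)
      then have in1: "inverse (w - z) *\<^sub>C (w *\<^sub>C h w - z *\<^sub>C h z) - (h z + z *\<^sub>C h')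
          = (w - z) *\<^sub>C h' + w *\<^sub>C (inverse (w - z) *\<^sub>C (h w - h z) - h')"
        by (simp add: scaleC_diff_right scaleC_diff_left)
      have "inverse (w - z) *\<^sub>C (e w - e z) - e'
          = r w + \<E> w (inverse (w - z) *\<^sub>C (d w - d z) - d')"
      proof -
        have "e w - e z = (f w - f z) + \<E> w (d w - d z) + (\<E> w (d z) - \<E> z (d z))"
          by (simp add: lw(3) lz(2) bounded_clinear_diff[OF K(1)[OF w(1)]])
        then show ?thesis
          by (simp only: r_def bounded_clinear_diff[OF K(1)[OF w(1)]] bounded_clinear_scaleC[OF K(1)[OF w(1)]]
              scaleC_add_right) simp
      qed
      then show ?thesis
        using 3 unfolding in1 loop_def
        by (simp add: sc df lw(2) hz l''(2))
    qed
    have r0: "(r \<longlongrightarrow> 0) (at z)"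
    proof -
      have "((\<lambda>w. inverse (w - z) *\<^sub>C (f w - f z) + inverse (w - z) *\<^sub>C (\<E> w (d z) - \<E> z (d z))
          - (e' - \<E> w d')) \<longlongrightarrow> f' + m - (e' - \<E> z d')) (at z)"
      proof (intro tendsto_intros)
        show "((\<lambda>w. inverse (w - z) *\<^sub>C (f w - f z)) \<longlongrightarrow> f') (at z)"
          "((\<lambda>w. inverse (w - z) *\<^sub>C (\<E> w (d z) - \<E> z (d z))) \<longlongrightarrow> m) (at z)"
          using f' m by (simp_all add: has_cderiv_def)
        obtain m' where "has_cderiv (\<lambda>w. \<E> w d') m' z"
          using schur_class_holomorphic_vec[OF E] z unfolding holomorphic_vec_iff by blast
        then show "((\<lambda>w. \<E> w d') \<longlongrightarrow> \<E> z d') (at z)" by (rule has_cderiv_tendsto)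
      qed
      then show ?thesis by (simp add: e' r_def[abs_def])
    qed
    \<comment> \<open>The loop bound is applied at the moving point w; a fixed radius between |z|
      and 1 makes its constant independent of w.\<close>
    define \<rho> where "\<rho> = (1 + cmod z) / 2"
    have \<rho>: "cmod z < \<rho>" "\<rho> < 1" using z by (auto simp: \<rho>_def)
    define B where "B w = 4 / (1 - \<rho>) ^ 3 * (norm ((w - z) *\<^sub>C h') + norm (0::'u) + norm (r w))" for w
    have B0: "(B \<longlongrightarrow> 0) (at z)"
    proof -
      have "((\<lambda>w. 4 / (1 - \<rho>) ^ 3 * (norm ((w - z) *\<^sub>C h') + norm (0::'u) + norm (r w)))
        \<longlongrightarrow> 4 / (1 - \<rho>) ^ 3 * (norm ((z - z) *\<^sub>C h') + norm (0::'u) + norm (0::'e))) (at z)"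
        by (intro tendsto_intros r0)
      then show ?thesis by (simp add: B_def[abs_def])
    qed
    have "z \<in> ball 0 \<rho>" using \<rho> by simp
    then have "\<forall>\<^sub>F w in at z. w \<in> ball 0 \<rho> - {z}"
      using eventually_at_in_open[OF open_ball] by blast
    then have ev: "\<forall>\<^sub>F w in at z. norm (inverse (w - z) *\<^sub>C (h w - h z) - h') \<le> B w
        \<and> norm (inverse (w - z) *\<^sub>C (y w - y z) - y') \<le> B w"
    proof eventually_elim
      case (elim w)
      then have w: "w \<in> disk" "w \<noteq> z" "cmod w \<le> \<rho>" using \<rho> by auto
      show ?case
        using loop_bound(1,3)[OF K(2)[OF w(1)] w(3) \<rho>(2) quot[OF w(1,2)]] by (simp only: B_def)
    qed
    have "has_cderiv h h' z" unfolding has_cderiv_def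
      by (rule LIM_zero_cancel, rule Lim_null_comparison[OF _ B0]) (use ev in eventually_elim, blast)
    moreover have "has_cderiv y y' z" unfolding has_cderiv_def
      by (rule LIM_zero_cancel, rule Lim_null_comparison[OF _ B0]) (use ev in eventually_elim, blast)
    ultimately show ?thesis by blast
  qed
  then show "holomorphic_vec h" "holomorphic_vec y" unfolding holomorphic_vec_iff by blast+
qed

lemma loop_contraction:
  assumes K: "\<And>d. norm (K d) \<le> norm d" and z: "z \<in> disk" and l: "loop K z 0 u 0 h e y d"
  shows "norm y \<le> norm u"
proof -
  have h: "h \<in> X0" "U (z *\<^sub>C h, u, e) = (h, y, d)" "e = K d" using l by (auto simp: loop_def)
  have "(norm e)\<^sup>2 \<le> (norm d)\<^sup>2" unfolding h(3) by (intro power_mono K) simp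
  moreover have "(norm (z *\<^sub>C h))\<^sup>2 \<le> (norm h)\<^sup>2"
    using z mult_right_mono[of "cmod z" 1 "norm h"] by (intro power_mono) auto
  ultimately have "(norm y)\<^sup>2 \<le> (norm u)\<^sup>2"
    using U_energy[OF h(2) csubspace_scaleC[OF csubspace_X0 h(1)]] by linarith
  then show ?thesis by (rule power2_le_imp_le) simp
qed

theorem redheffer_schur_class:
  assumes E: "\<E> \<in> schur_class"
  shows "redheffer Sg \<E> \<in> schur_class"
proof -
  let ?S = "redheffer Sg \<E>"
  note K = schur_class_bounded_clinear[OF E] schur_class_contraction[OF E]
  have 0: "0 \<in> X0" by (rule csubspace_zero[OF csubspace_X0])
  have contr: "norm (?S z u) \<le> norm u" if z: "z \<in> disk" for z u
  proof -
    obtain h e y d where l: "loop (\<E> z) z 0 u 0 h e y d" using loop_ex[OF K(1)[OF z] K(2)[OF z] z 0] by metis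
    show ?thesis using loop_contraction[OF K(2)[OF z] z l] redheffer_eq[OF E z l] by simp
  qed
  have lin: "bounded_clinear (?S z)" if z: "z \<in> disk" for z
  proof (rule bounded_clinearI[of _ 1])
    show "?S z (u + v) = ?S z u + ?S z v" for u v
      using loop_out_add[OF K(1)[OF z] K(2)[OF z] z 0 0, of u v 0 0] by (simp add: redheffer_loop_out[OF E z])
    show "?S z (c *\<^sub>C u) = c *\<^sub>C ?S z u" for c u
      using loop_out_scale[OF K(1)[OF z] K(2)[OF z] z 0, of c u 0] by (simp add: redheffer_loop_out[OF E z])
  qed (use contr[OF z] in simp)
  have hol: "holomorphic_vec (\<lambda>z. ?S z u)" for u
  proof -
    have "\<forall>z\<in>disk. \<exists>h e y d. loop (\<E> z) z 0 u 0 h e y d"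
      using loop_ex[OF K(1) K(2) _ 0] by blast
    then obtain h e y d where l: "\<And>z. z \<in> disk \<Longrightarrow> loop (\<E> z) z 0 u 0 (h z) (e z) (y z) (d z)"
      by metis
    have "holomorphic_vec (\<lambda>z::complex. 0::'e)"
      by (auto simp: holomorphic_vec_def intro!: exI[of _ 0])
    from loop_holomorphic(2)[OF E this l] have "holomorphic_vec y" .
    then show ?thesis
      by (rule holomorphic_vec_cong) (rule redheffer_eq[OF E _ l, symmetric])
  qed
  have "onorm (?S z) \<le> 1" if "z \<in> disk" for z
    by (rule onorm_bound) (use contr[OF that] in auto)
  moreover have "holomorphic_op ?S"
    by (rule holomorphic_op_if_weakly[OF lin contr holomorphic_vec_cinner[OF hol]])
  moreover have "?S \<in> extensional disk" by (simp add: redheffer_def)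
  ultimately show ?thesis using lin by (simp add: schur_class_def)
qed

text \<open>Surjectivity of \<open>U\<close> turns the adjoint relations into a solution of the adjoint closed loop.\<close>

lemma adjoint_loop:
  assumes E: "\<E> \<in> schur_class" and z: "z \<in> disk"
  shows "\<exists>k\<in>X0. \<exists>e'.
     (\<forall>x\<in>X0. \<forall>e0. cinner (loop_out (\<E> z) z x 0 e0) y = cinner x k + cinner e0 e') \<and>
     U (k, cadjoint (redheffer Sg \<E> z) y, e') = (cnj z *\<^sub>C k, y, cadjoint (\<E> z) e')"
proof -
  let ?S = "redheffer Sg \<E>"
  let ?out = "loop_out (\<E> z) z"
  let ?C = "4 / (1 - cmod z) ^ 3"
  note K = schur_class_bounded_clinear[OF E z] schur_class_contraction[OF E z]
  have 0: "0 \<in> X0" by (rule csubspace_zero[OF csubspace_X0])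
  note add = loop_out_add[OF K z] and scale = loop_out_scale[OF K z] and bound = loop_out_bound[OF K z]
  have bl: "bounded_clinear (?S z)"
    by (rule schur_class_bounded_clinear[OF redheffer_schur_class[OF E] z])
  have bdd: "cmod (cinner (?out x 0 e0) y) \<le> ?C * norm y * (norm x + norm e0)" if "x \<in> X0" for x e0
  proof -
    have "cmod (cinner (?out x 0 e0) y) \<le> norm (?out x 0 e0) * norm y" by (rule Cauchy_Schwarz_cinner)
    also have "\<dots> \<le> (?C * (norm x + norm (0::'u) + norm e0)) * norm y"
      by (intro mult_right_mono bound that) simp
    finally show ?thesis by (simp add: mult_ac)
  qed
  have "\<exists>k\<in>X0. \<forall>x\<in>X0. cinner (?out x 0 0) y = cinner x k"
  proof (rule Riesz_chilbert[OF csubspace_X0 closed_X0])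
    fix v w c assume v: "v \<in> X0"
    show "cinner (?out (c *\<^sub>C v) 0 0) y = c * cinner (?out v 0 0) y"
      using scale[OF v, of c 0 0] by (simp add: cinner_scaleC_left)
    show "cmod (cinner (?out v 0 0) y) \<le> ?C * norm y * norm v" using bdd[OF v, of 0] by simp
    assume w: "w \<in> X0"
    show "cinner (?out (v + w) 0 0) y = cinner (?out v 0 0) y + cinner (?out w 0 0) y"
      using add[OF v w, of 0 0 0 0] by (simp add: cinner_add_left)
  qed
  then obtain k where k: "k \<in> X0" "\<And>x. x \<in> X0 \<Longrightarrow> cinner (?out x 0 0) y = cinner x k" by blast
  have "\<exists>e'\<in>UNIV. \<forall>e0\<in>UNIV. cinner (?out 0 0 e0) y = cinner e0 e'"
  proof (rule Riesz_chilbert)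
    fix v w c
    show "cinner (?out 0 0 (c *\<^sub>C v)) y = c * cinner (?out 0 0 v) y"
      using scale[OF 0, of c 0 v] by (simp add: cinner_scaleC_left)
    show "cmod (cinner (?out 0 0 v) y) \<le> ?C * norm y * norm v" using bdd[OF 0, of v] by simp
    show "cinner (?out 0 0 (v + w)) y = cinner (?out 0 0 v) y + cinner (?out 0 0 w) y"
      using add[OF 0 0, of 0 0 v w] by (simp add: cinner_add_left)
  qed auto
  then obtain e' where e': "\<And>e0. cinner (?out 0 0 e0) y = cinner e0 e'" by blast
  have full: "cinner (?out x u e0) y = cinner x k + cinner u (cadjoint (?S z) y) + cinner e0 e'"
    if x: "x \<in> X0" for x u e0
  proof -
    have "?out x u e0 = ?out x 0 0 + ?out 0 u 0 + ?out 0 0 e0"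
      using add[OF x 0, of 0 u 0 0] add[OF x 0, of u 0 0 e0] by simp
    moreover have "cinner (?out 0 u 0) y = cinner u (cadjoint (?S z) y)"
      using cadjoint[OF bl, of u y] by (simp add: redheffer_loop_out[OF E z])
    ultimately show ?thesis by (simp add: cinner_add_left k(2)[OF x] e')
  qed
  obtain h0 a0 where a0: "h0 \<in> X0" "U (h0, a0) = (cnj z *\<^sub>C k, y, cadjoint (\<E> z) e')"
    using U_surj[OF csubspace_scaleC[OF csubspace_X0 k(1)]] by blast
  obtain u0 e0 where a0_eq: "a0 = (u0, e0)" by fastforce
  \<comment> \<open>Every vector (h, u, e) is the input of U in some closed loop: take initial state
    h - z k1 and e0 = e - \<E>(z) d1. Comparing the inner product preserved by U with the adjoint
    relation shows that the preimage (h0, u0, e0) is (k, adjoint of S(z) applied to y, e').\<close>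
  have pair: "cinner h h0 + cinner u u0 + cinner e e0 = cinner h k + cinner u (cadjoint (?S z) y) + cinner e e'"
    if h: "h \<in> X0" for h u e
  proof -
    obtain k1 y1 d1 where U1: "U (h, u, e) = (k1, y1, d1)" by (metis surj_pair)
    have k1: "k1 \<in> X0" by (rule U_mem[OF U1 h])
    have x: "h - z *\<^sub>C k1 \<in> X0" by (intro csubspace_diff[OF csubspace_X0 h] csubspace_scaleC[OF csubspace_X0 k1])
    have "loop (\<E> z) z (h - z *\<^sub>C k1) u (e - \<E> z d1) k1 e y1 d1"
      using x k1 U1 by (simp add: loop_def)
    from loop_out_eq[OF K z this] full[OF x, of u "e - \<E> z d1"]
    have "cinner y1 y = cinner (h - z *\<^sub>C k1) k + cinner u (cadjoint (?S z) y) + cinner (e - \<E> z d1) e'"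
      by simp
    moreover have "cinner k1 (cnj z *\<^sub>C k) + cinner y1 y + cinner d1 (cadjoint (\<E> z) e')
        = cinner h h0 + cinner u u0 + cinner e e0"
      by (rule U_inner[OF U1 a0(2)[unfolded a0_eq] h a0(1)])
    ultimately show ?thesis
      by (simp add: cinner_diff_left cinner_scaleC_left cinner_scaleC_right cadjoint[OF K(1)] algebra_simps)
  qed
  have "h0 - k \<in> X0" by (rule csubspace_diff[OF csubspace_X0 a0(1) k(1)])
  then have "cinner (h0 - k) (h0 - k) = 0"
    using pair[of "h0 - k" 0 0] by (simp add: cinner_diff_right)
  then have h0k: "h0 = k" by simp
  have "u0 = cadjoint (?S z) y" by (rule cinner_eqI) (use pair[OF 0, of _ 0] in simp)
  moreover have "e0 = e'" by (rule cinner_eqI) (use pair[OF 0, of 0] in simp)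
  ultimately have "U (k, cadjoint (?S z) y, e') = (cnj z *\<^sub>C k, y, cadjoint (\<E> z) e')"
    using a0(2) h0k a0_eq by simp
  moreover have "\<forall>x\<in>X0. \<forall>e0. cinner (?out x 0 e0) y = cinner x k + cinner e0 e'"
    using full[of _ 0] by simp
  ultimately show ?thesis using k(1) by blast
qed

text \<open>Multiplied by c = 1 / (1 - \<omega> conj(\<zeta>)), the adjoint relation at \<zeta> is a
  closed loop at \<omega>: the states match because c k = k + \<omega> c conj(\<zeta>) k, and the
  feedback equation leaves \<open>K_\<E>(\<omega>, \<zeta>) e'\<close> as e0. Removing the response
  to the input from the output c y leaves \<open>K_S(\<omega>, \<zeta>) y\<close>.\<close>

lemma kernel_identity:
  assumes E: "\<E> \<in> schur_class" and \<omega>: "\<omega> \<in> disk" and \<zeta>: "\<zeta> \<in> disk" and k: "k \<in> X0"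
    and adj: "U (k, cadjoint (redheffer Sg \<E> \<zeta>) y, e') = (cnj \<zeta> *\<^sub>C k, y, cadjoint (\<E> \<zeta>) e')"
  shows "loop_out (\<E> \<omega>) \<omega> k 0 (schur_kernel \<E> \<omega> \<zeta> e') = schur_kernel (redheffer Sg \<E>) \<omega> \<zeta> y"
proof -
  note K = schur_class_bounded_clinear[OF E \<omega>] schur_class_contraction[OF E \<omega>]
  have 0: "0 \<in> X0" by (rule csubspace_zero[OF csubspace_X0])
  let ?Sy = "cadjoint (redheffer Sg \<E> \<zeta>) y"
  define c where "c = inverse (1 - \<omega> * cnj \<zeta>)"
  have "cmod \<omega> * cmod \<zeta> < 1"
    using \<omega> \<zeta> mult_strict_mono'[of "cmod \<omega>" 1 "cmod \<zeta>" 1] by simp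
  have "1 - \<omega> * cnj \<zeta> \<noteq> 0"
  proof
    assume "1 - \<omega> * cnj \<zeta> = 0"
    then have "cmod (\<omega> * cnj \<zeta>) = 1" by simp
    with \<open>cmod \<omega> * cmod \<zeta> < 1\<close> show False by (simp add: norm_mult)
  qed
  then have c: "c - \<omega> * (c * cnj \<zeta>) = 1" by (simp add: c_def field_simps)
  have "U (c *\<^sub>C k, c *\<^sub>C ?Sy, c *\<^sub>C e') = (c *\<^sub>C cnj \<zeta> *\<^sub>C k, c *\<^sub>C y, c *\<^sub>C cadjoint (\<E> \<zeta>) e')"
    using U_scale[OF adj k, of c] by simp
  moreover have "k + \<omega> *\<^sub>C (c *\<^sub>C cnj \<zeta> *\<^sub>C k) = c *\<^sub>C k"
    using arg_cong[OF c, of "\<lambda>t. t *\<^sub>C k"] by (simp add: scaleC_scaleC scaleC_diff_left algebra_simps)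
  ultimately have "loop (\<E> \<omega>) \<omega> k (c *\<^sub>C ?Sy) (schur_kernel \<E> \<omega> \<zeta> e')
      (c *\<^sub>C cnj \<zeta> *\<^sub>C k) (c *\<^sub>C e') (c *\<^sub>C y) (c *\<^sub>C cadjoint (\<E> \<zeta>) e')"
    using k by (simp add: loop_def csubspace_scaleC[OF csubspace_X0] schur_kernel_def c_def scaleC_diff_right
        bounded_clinear_scaleC[OF K(1)])
  from loop_out_eq[OF K \<omega> this]
  have "loop_out (\<E> \<omega>) \<omega> k (c *\<^sub>C ?Sy) (schur_kernel \<E> \<omega> \<zeta> e') = c *\<^sub>C y" .
  moreover have "loop_out (\<E> \<omega>) \<omega> k (c *\<^sub>C ?Sy) (schur_kernel \<E> \<omega> \<zeta> e')
      = loop_out (\<E> \<omega>) \<omega> k 0 (schur_kernel \<E> \<omega> \<zeta> e') + loop_out (\<E> \<omega>) \<omega> 0 (c *\<^sub>C ?Sy) 0"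
    using loop_out_add[OF K \<omega> k 0, of 0 "c *\<^sub>C ?Sy" "schur_kernel \<E> \<omega> \<zeta> e'" 0] by simp
  moreover have "loop_out (\<E> \<omega>) \<omega> 0 (c *\<^sub>C ?Sy) 0 = c *\<^sub>C redheffer Sg \<E> \<omega> ?Sy"
    using loop_out_scale[OF K \<omega> 0, of c ?Sy 0] by (simp add: redheffer_loop_out[OF E \<omega>])
  ultimately show ?thesis by (simp add: schur_kernel_def c_def scaleC_diff_right eq_diff_eq)
qed

end

section \<open>Reproducing kernel Hilbert spaces\<close>

lemma hilbert_on_prod:
  fixes V1 :: "'v::ab_group_add set" and V2 :: "'w::ab_group_add set"
  assumes "hilbert_on V1 sc1 ip1" "hilbert_on V2 sc2 ip2"
  shows "hilbert_on (V1 \<times> V2) (\<lambda>c p. (sc1 c (fst p), sc2 c (snd p)))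
    (\<lambda>p q. ip1 (fst p) (fst q) + ip2 (snd p) (snd q))"
proof -
  interpret A: hilbert_on V1 sc1 ip1 by fact
  interpret B: hilbert_on V2 sc2 ip2 by fact
  let ?ip = "\<lambda>p q. ip1 (fst p) (fst q) + ip2 (snd p) (snd q)"
  have nrm: "ip_norm ?ip p = sqrt ((ip_norm ip1 (fst p))\<^sup>2 + (ip_norm ip2 (snd p))\<^sup>2)" if "p \<in> V1 \<times> V2" for p
    using that by (auto simp: ip_norm_def A.ip_nonneg B.ip_nonneg)
  show ?thesis
  proof
    fix p q w :: "'v \<times> 'w" and c
    show "0 \<in> V1 \<times> V2" by (simp add: zero_prod_def A.zero_in B.zero_in)
    assume p: "p \<in> V1 \<times> V2"
    then show "(sc1 c (fst p), sc2 c (snd p)) \<in> V1 \<times> V2" by (auto simp: A.sc_in B.sc_in)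
    show "0 \<le> Re (?ip p p)" using p by (auto simp: A.ip_nonneg B.ip_nonneg)
    show "p = 0" if "?ip p p = 0"
    proof -
      have "Re (ip1 (fst p) (fst p)) + Re (ip2 (snd p) (snd p)) = 0" using arg_cong[OF that, of Re] by simp
      moreover have "0 \<le> Re (ip1 (fst p) (fst p))" "0 \<le> Re (ip2 (snd p) (snd p))"
        using p by (auto simp: A.ip_nonneg B.ip_nonneg)
      ultimately have "ip_norm ip1 (fst p) = 0" "ip_norm ip2 (snd p) = 0" by (auto simp: ip_norm_def)
      then show ?thesis using A.ip_norm_eq_0[of "fst p"] B.ip_norm_eq_0[of "snd p"] p by (auto simp: prod_eq_iff)
    qed
    assume q: "q \<in> V1 \<times> V2"
    show "p + q \<in> V1 \<times> V2" using p q by (auto simp: A.add_in B.add_in)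
    show "?ip p q = cnj (?ip q p)"
      using p q A.ip_commute[of "fst p" "fst q"] B.ip_commute[of "snd p" "snd q"] by (auto simp: mem_Times_iff)
    show "?ip (sc1 c (fst p), sc2 c (snd p)) q = c * ?ip p q"
      using p q by (auto simp: A.ip_sc_left B.ip_sc_left algebra_simps)
    assume w: "w \<in> V1 \<times> V2"
    show "?ip (p + q) w = ?ip p w + ?ip q w"
      using p q w by (auto simp: A.ip_add_left B.ip_add_left)
  next
    fix F :: "nat \<Rightarrow> 'v \<times> 'w" assume F: "\<And>n. F n \<in> V1 \<times> V2"
      and C: "\<And>e. e > 0 \<Longrightarrow> \<exists>n0. \<forall>m\<ge>n0. \<forall>n\<ge>n0. ip_norm ?ip (F m - F n) < e"
    have F1: "\<And>n. fst (F n) \<in> V1" and F2: "\<And>n. snd (F n) \<in> V2" using F by (auto simp: mem_Times_iff)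
    have d: "F m - F n \<in> V1 \<times> V2" for m n
      using F1 F2 A.diff_in B.diff_in by (simp add: mem_Times_iff)
    have "ip_norm ip1 (fst (F m) - fst (F n)) \<le> ip_norm ?ip (F m - F n)"
      "ip_norm ip2 (snd (F m) - snd (F n)) \<le> ip_norm ?ip (F m - F n)" for m n
      unfolding nrm[OF d] by (auto intro!: real_le_rsqrt)
    note le = this
    have "\<exists>a\<in>V1. (\<lambda>n. ip_norm ip1 (fst (F n) - a)) \<longlonglongrightarrow> 0"
      using C le(1) by (intro A.complete F1) (meson order_le_less_trans)
    then obtain a where a: "a \<in> V1" "(\<lambda>n. ip_norm ip1 (fst (F n) - a)) \<longlonglongrightarrow> 0" by blast
    have "\<exists>b\<in>V2. (\<lambda>n. ip_norm ip2 (snd (F n) - b)) \<longlonglongrightarrow> 0"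
      using C le(2) by (intro B.complete F2) (meson order_le_less_trans)
    then obtain b where b: "b \<in> V2" "(\<lambda>n. ip_norm ip2 (snd (F n) - b)) \<longlonglongrightarrow> 0" by blast
    have "F n - (a, b) \<in> V1 \<times> V2" for n
      using F1 F2 A.diff_in B.diff_in a b by (simp add: mem_Times_iff)
    then have "ip_norm ?ip (F n - (a, b)) = sqrt ((ip_norm ip1 (fst (F n) - a))\<^sup>2 + (ip_norm ip2 (snd (F n) - b))\<^sup>2)" for n
      using nrm by simp
    moreover have "(\<lambda>n. sqrt ((ip_norm ip1 (fst (F n) - a))\<^sup>2 + (ip_norm ip2 (snd (F n) - b))\<^sup>2)) \<longlonglongrightarrow> sqrt (0\<^sup>2 + 0\<^sup>2)"
      by (intro tendsto_intros a b)
    ultimately show "\<exists>f\<in>V1 \<times> V2. (\<lambda>n. ip_norm ?ip (F n - f)) \<longlonglongrightarrow> 0"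
      using a(1) b(1) by (intro bexI[of _ "(a, b)"]) auto
  qed
qed

text \<open>Functions in \<open>extensional disk\<close> are not closed under pointwise addition, since
  \<open>undefined + undefined\<close> need not be \<open>undefined\<close>; extending by \<open>0\<close> repairs this.\<close>

definition ext0 :: "(complex \<Rightarrow> 'b::zero) \<Rightarrow> complex \<Rightarrow> 'b" where
  "ext0 f z = (if z \<in> disk then f z else 0)"

definition fsc :: "complex \<Rightarrow> (complex \<Rightarrow> 'b::chilbert) \<Rightarrow> complex \<Rightarrow> 'b" where
  "fsc c f z = c *\<^sub>C f z"

text \<open>\<open>ip\<close> is constrained only on extensional functions, so zero-extended
  arguments are restricted again before it is applied.\<close>

abbreviation rip :: "((complex \<Rightarrow> 'b) \<Rightarrow> (complex \<Rightarrow> 'b) \<Rightarrow> complex) \<Rightarrow> (complex \<Rightarrow> 'b) \<Rightarrow> (complex \<Rightarrow> 'b) \<Rightarrow> complex" where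
  "rip ip \<equiv> \<lambda>f g. ip (restrict f disk) (restrict g disk)"

lemma restrict_ext0: "restrict (ext0 f) disk = restrict f disk"
  by (auto simp: ext0_def)

lemma hilbert_on_ext0:
  fixes H :: "(complex \<Rightarrow> 'b::chilbert) set"
  assumes "function_hilbert_space H ip"
  shows "hilbert_on (ext0 ` H) fsc (rip ip)"
proof -
  note fh = assms[unfolded function_hilbert_space_def]
  have exten: "f \<in> extensional disk" if "f \<in> H" for f using fh that by blast
  have mem: "g \<in> ext0 ` H \<longleftrightarrow> restrict g disk \<in> H \<and> (\<forall>z. z \<notin> disk \<longrightarrow> g z = 0)" for g
  proof
    assume "g \<in> ext0 ` H"
    then obtain f where f: "f \<in> H" "g = ext0 f" by blast
    then show "restrict g disk \<in> H \<and> (\<forall>z. z \<notin> disk \<longrightarrow> g z = 0)"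
      using exten[OF f(1)] by (simp add: restrict_ext0 extensional_restrict) (simp add: ext0_def)
  next
    assume g: "restrict g disk \<in> H \<and> (\<forall>z. z \<notin> disk \<longrightarrow> g z = 0)"
    have "g = ext0 (restrict g disk)" using g by (intro ext) (simp add: ext0_def)
    then show "g \<in> ext0 ` H" using g by blast
  qed
  have radd: "restrict (f + g) disk = (\<lambda>z\<in>disk. restrict f disk z + restrict g disk z)" for f g :: "complex \<Rightarrow> 'b"
    by (rule restrict_ext) simp
  have rdiff: "restrict (f - g) disk = (\<lambda>z\<in>disk. restrict f disk z - restrict g disk z)" for f g :: "complex \<Rightarrow> 'b"
    by (rule restrict_ext) simp
  have rsc: "restrict (fsc c f) disk = (\<lambda>z\<in>disk. c *\<^sub>C restrict f disk z)" for f :: "complex \<Rightarrow> 'b" and c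
    by (rule restrict_ext) (simp add: fsc_def)
  have rzero: "restrict (0 :: complex \<Rightarrow> 'b) disk = (\<lambda>z\<in>disk. 0)"
    by (rule restrict_ext) simp
  show ?thesis
  proof
    fix f g h :: "complex \<Rightarrow> 'b" and c
    show "0 \<in> ext0 ` H" unfolding mem rzero using fh by simp
    assume f: "f \<in> ext0 ` H"
    then have f': "restrict f disk \<in> H" unfolding mem by blast
    show "fsc c f \<in> ext0 ` H" unfolding mem rsc
    proof (rule conjI)
      show "(\<lambda>z\<in>disk. c *\<^sub>C restrict f disk z) \<in> H" using fh f' by blast
      show "\<forall>z. z \<notin> disk \<longrightarrow> fsc c f z = 0" using f[unfolded mem] by (simp add: fsc_def)
    qed
    show "0 \<le> Re (rip ip f f)" using fh f' by blast
    show "f = 0" if "rip ip f f = 0"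
    proof -
      have "restrict f disk = (\<lambda>z\<in>disk. 0)" using fh f' that by blast
      then have "f z = 0" if "z \<in> disk" for z using that by (metis restrict_apply')
      then show ?thesis using f[unfolded mem] by (intro ext) (metis zero_fun_apply)
    qed
    assume g: "g \<in> ext0 ` H"
    then have g': "restrict g disk \<in> H" unfolding mem by blast
    show "f + g \<in> ext0 ` H" unfolding mem radd
    proof (rule conjI)
      show "(\<lambda>z\<in>disk. restrict f disk z + restrict g disk z) \<in> H" using fh f' g' by blast
      show "\<forall>z. z \<notin> disk \<longrightarrow> (f + g) z = 0" using f[unfolded mem] g[unfolded mem] by simp
    qed
    show "rip ip f g = cnj (rip ip g f)" using fh f' g' by blast
    show "rip ip (fsc c f) g = c * rip ip f g" unfolding rsc using fh f' g' by blast
    assume h: "h \<in> ext0 ` H"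
    then have h': "restrict h disk \<in> H" unfolding mem by blast
    show "rip ip (f + g) h = rip ip f h + rip ip g h" unfolding radd using fh f' g' h' by blast
  next
    fix F :: "nat \<Rightarrow> complex \<Rightarrow> 'b" assume F: "\<And>n. F n \<in> ext0 ` H"
      and C: "\<And>e. e > 0 \<Longrightarrow> \<exists>n0. \<forall>m\<ge>n0. \<forall>n\<ge>n0. ip_norm (rip ip) (F m - F n) < e"
    have nrm: "ip_norm (rip ip) (f - g) = ip_norm ip (\<lambda>z\<in>disk. restrict f disk z - restrict g disk z)" for f g
      unfolding ip_norm_def rdiff by simp
    have "\<forall>n. restrict (F n) disk \<in> H" using F unfolding mem by blast
    moreover have "\<forall>e>0. \<exists>n0. \<forall>m\<ge>n0. \<forall>n\<ge>n0. ip_norm ip (\<lambda>z\<in>disk. restrict (F m) disk z - restrict (F n) disk z) < e"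
      using C unfolding nrm by blast
    ultimately have "\<exists>f\<in>H. (\<lambda>n. ip_norm ip (\<lambda>z\<in>disk. restrict (F n) disk z - f z)) \<longlonglongrightarrow> 0"
      using fh by (elim conjE allE[of _ "\<lambda>n. restrict (F n) disk"]) blast
    then obtain f where f: "f \<in> H" "(\<lambda>n. ip_norm ip (\<lambda>z\<in>disk. restrict (F n) disk z - f z)) \<longlonglongrightarrow> 0" by blast
    have "restrict (ext0 f) disk = f" using exten[OF f(1)] by (simp add: restrict_ext0 extensional_restrict)
    then have "(\<lambda>n. ip_norm (rip ip) (F n - ext0 f)) \<longlonglongrightarrow> 0"
      unfolding nrm using f(2) by simp
    then show "\<exists>f\<in>ext0 ` H. (\<lambda>n. ip_norm (rip ip) (F n - f)) \<longlonglongrightarrow> 0" using f(1) by blast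
  qed
qed

section \<open>Reproducing kernels on spaces of functions that vanish off the disk\<close>

locale rkhs0 = hilbert_on V fsc ip for V :: "(complex \<Rightarrow> 'b::chilbert) set" and ip +
  fixes K :: "complex \<Rightarrow> complex \<Rightarrow> 'b \<Rightarrow> 'b"
  assumes supp: "f \<in> V \<Longrightarrow> z \<notin> disk \<Longrightarrow> f z = 0"
    and kernel_in: "\<zeta> \<in> disk \<Longrightarrow> ext0 (\<lambda>z. K z \<zeta> y) \<in> V"
    and reproducing: "f \<in> V \<Longrightarrow> \<zeta> \<in> disk \<Longrightarrow> ip f (ext0 (\<lambda>z. K z \<zeta> y)) = cinner (f \<zeta>) y"
begin

lemma reproducing': "f \<in> V \<Longrightarrow> \<zeta> \<in> disk \<Longrightarrow> ip (ext0 (\<lambda>z. K z \<zeta> y)) f = cinner y (f \<zeta>)"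
  using ip_commute[OF kernel_in, of \<zeta> f y] reproducing[of f \<zeta> y] cinner_commute[of y "f \<zeta>"] by simp

lemma fun_eqI: "f \<in> V \<Longrightarrow> g \<in> V \<Longrightarrow> (\<And>z. z \<in> disk \<Longrightarrow> f z = g z) \<Longrightarrow> f = g"
  using supp by (intro ext) metis

text \<open>Cauchy-Schwarz against the kernel function for the vector f(\<zeta>) itself; the squared
  norm of that function is the diagonal kernel value bounded in the hypothesis.\<close>

lemma norm_eval_le:
  assumes f: "f \<in> V" and \<zeta>: "\<zeta> \<in> disk" and K: "Re (cinner (K \<zeta> \<zeta> (f \<zeta>)) (f \<zeta>)) \<le> C\<^sup>2 * (norm (f \<zeta>))\<^sup>2" and C: "0 \<le> C"
  shows "norm (f \<zeta>) \<le> C * ip_norm ip f"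
proof -
  let ?k = "ext0 (\<lambda>z. K z \<zeta> (f \<zeta>))"
  have k: "?k \<in> V" by (rule kernel_in[OF \<zeta>])
  have "(ip_norm ip ?k)\<^sup>2 \<le> (C * norm (f \<zeta>))\<^sup>2"
    using K reproducing[OF k \<zeta>, of "f \<zeta>"] \<zeta> by (simp add: ip_norm_sq[OF k] ext0_def power_mult_distrib)
  then have nk: "ip_norm ip ?k \<le> C * norm (f \<zeta>)" by (rule power2_le_imp_le) (simp add: C)
  have "(norm (f \<zeta>))\<^sup>2 = cmod (ip f ?k)" by (simp add: reproducing[OF f \<zeta>] cinner_self norm_power)
  also have "\<dots> \<le> ip_norm ip f * ip_norm ip ?k" by (rule Cauchy_Schwarz[OF f k])
  also have "\<dots> \<le> ip_norm ip f * (C * norm (f \<zeta>))" by (rule mult_left_mono[OF nk ip_norm_nonneg[OF f]])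
  finally have le: "norm (f \<zeta>) * norm (f \<zeta>) \<le> norm (f \<zeta>) * (C * ip_norm ip f)" by (simp add: power2_eq_square ac_simps)
  show ?thesis
  proof (cases "f \<zeta> = 0")
    case True
    then show ?thesis by (simp add: C ip_norm_nonneg[OF f])
  next
    case False
    then have "0 < norm (f \<zeta>)" by simp
    with le show ?thesis by (rule mult_left_le_imp_le)
  qed
qed

end

lemma rkhs0_if_is_rkhs:
  assumes "is_rkhs K H ip"
  shows "rkhs0 (ext0 ` H) (rip ip) K"
proof -
  note r = assms[unfolded is_rkhs_def]
  interpret hilbert_on "ext0 ` H" fsc "rip ip" by (rule hilbert_on_ext0) (use r in blast)
  have exten: "f \<in> extensional disk" if "f \<in> H" for f
    using r that unfolding function_hilbert_space_def by blast
  show ?thesis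
  proof
    show "f z = 0" if "f \<in> ext0 ` H" "z \<notin> disk" for f z using that by (auto simp: ext0_def)
    fix \<zeta> y assume \<zeta>: "\<zeta> \<in> disk"
    have k: "(\<lambda>z\<in>disk. K z \<zeta> y) \<in> H" using r \<zeta> by blast
    have "ext0 (\<lambda>z. K z \<zeta> y) = ext0 (\<lambda>z\<in>disk. K z \<zeta> y)" by (rule ext) (simp add: ext0_def)
    then show "ext0 (\<lambda>z. K z \<zeta> y) \<in> ext0 ` H" using k by blast
    fix g assume "g \<in> ext0 ` H"
    then obtain f where f: "f \<in> H" "g = ext0 f" by blast
    have "ip f (\<lambda>z\<in>disk. K z \<zeta> y) = cinner (f \<zeta>) y" using r \<zeta> f(1) by blast
    then show "rip ip g (ext0 (\<lambda>z. K z \<zeta> y)) = cinner (g \<zeta>) y"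
      using \<zeta> exten[OF f(1)] by (simp add: f(2) restrict_ext0 extensional_restrict del: mem_ball) (simp add: ext0_def)
  qed
qed

lemma schur_kernel_diag:
  assumes S: "S \<in> schur_class" and \<zeta>: "\<zeta> \<in> disk"
  shows "Re (cinner (schur_kernel S \<zeta> \<zeta> y) y) \<le> (1 / sqrt (1 - (cmod \<zeta>)\<^sup>2))\<^sup>2 * (norm y)\<^sup>2"
proof -
  have q: "(cmod \<zeta>)\<^sup>2 < 1" using \<zeta> by (simp add: power_less_one_iff)
  have "cinner (S \<zeta> (cadjoint (S \<zeta>) y)) y = complex_of_real ((norm (cadjoint (S \<zeta>) y))\<^sup>2)"
    by (simp add: cadjoint[OF schur_class_bounded_clinear[OF S \<zeta>]] cinner_self)
  then have "cinner (schur_kernel S \<zeta> \<zeta> y) y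
      = complex_of_real (((norm y)\<^sup>2 - (norm (cadjoint (S \<zeta>) y))\<^sup>2) / (1 - (cmod \<zeta>)\<^sup>2))"
    by (simp add: schur_kernel_def cinner_scaleC_left cinner_diff_left cinner_self divide_inverse mult.commute
        flip: complex_norm_square)
  then have "Re (cinner (schur_kernel S \<zeta> \<zeta> y) y) = ((norm y)\<^sup>2 - (norm (cadjoint (S \<zeta>) y))\<^sup>2) / (1 - (cmod \<zeta>)\<^sup>2)"
    by (simp only: Re_complex_of_real)
  also have "\<dots> \<le> (norm y)\<^sup>2 / (1 - (cmod \<zeta>)\<^sup>2)"
    using q by (intro divide_right_mono) auto
  finally show ?thesis using q by (simp add: power_divide)
qed

section \<open>De Branges-Rovnyak spaces consist of holomorphic functions\<close>

locale schur_rkhs = rkhs0 V ip "schur_kernel S"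
  for V :: "(complex \<Rightarrow> 'b::chilbert) set" and ip and S :: "complex \<Rightarrow> 'a::chilbert \<Rightarrow> 'b" +
  assumes S: "S \<in> schur_class"
begin

lemma norm_eval_le_uniform:
  assumes f: "f \<in> V" and z: "cmod z \<le> r" "r < 1"
  shows "norm (f z) \<le> 1 / sqrt (1 - r\<^sup>2) * ip_norm ip f"
proof -
  have zd: "z \<in> disk" using z by simp
  have r: "(cmod z)\<^sup>2 \<le> r\<^sup>2" "r\<^sup>2 < 1"
    using z order_trans[OF norm_ge_zero z(1)] by (auto simp: power_mono power_less_one_iff)
  have "norm (f z) \<le> 1 / sqrt (1 - (cmod z)\<^sup>2) * ip_norm ip f"
    by (rule norm_eval_le[OF f zd schur_kernel_diag[OF S zd]]) (use r in simp)
  also have "\<dots> \<le> 1 / sqrt (1 - r\<^sup>2) * ip_norm ip f"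
    using r by (intro mult_right_mono divide_left_mono ip_norm_nonneg f) auto
  finally show ?thesis .
qed

text \<open>The weakly holomorphic elements form a closed subspace that contains the kernel functions.\<close>

lemma weakly_holomorphic:
  assumes f: "f \<in> V"
  shows "(\<lambda>z. cinner (f z) y) holomorphic_on disk"
proof -
  define M where "M = {f \<in> V. \<forall>y. (\<lambda>z. cinner (f z) y) holomorphic_on disk}"
  have M: "hilbert_on M fsc ip"
  proof (rule closed_subspace)
    show "M \<subseteq> V" by (auto simp: M_def)
    show "0 \<in> M" by (simp add: M_def zero_in)
    show "g + h \<in> M" if "g \<in> M" "h \<in> M" for g h
      using that by (auto simp: M_def add_in cinner_add_left intro!: holomorphic_intros)
    show "fsc c g \<in> M" if "g \<in> M" for c g
      using that by (auto simp: M_def sc_in fsc_def cinner_scaleC_left intro!: holomorphic_intros)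
    fix F g assume F: "\<And>n::nat. F n \<in> M" and g: "g \<in> V" and lim: "(\<lambda>n. ip_norm ip (F n - g)) \<longlonglongrightarrow> 0"
    have FV: "F n \<in> V" for n using F by (simp add: M_def)
    have "(\<lambda>z. cinner (g z) y) holomorphic_on disk" for y
    proof (rule holomorphic_uniform_sequence[OF open_ball])
      show "(\<lambda>z. cinner (F n z) y) holomorphic_on disk" for n using F by (simp add: M_def)
      fix x :: complex assume x: "x \<in> disk"
      \<comment> \<open>The closed ball of radius d around x lies in |z| \<le> r < 1, where
        evaluation is uniformly bounded. Norm convergence thus becomes uniform convergence
        there.\<close>
      define d where "d = (1 - cmod x) / 2"
      define r where "r = cmod x + d"
      have d: "0 < d" "r < 1" using x by (auto simp: d_def r_def field_simps)
      have cb: "cmod z \<le> r" if "z \<in> cball x d" for z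
        using that norm_triangle_ineq2[of z x] by (simp add: r_def dist_norm norm_minus_commute)
      have "uniform_limit (cball x d) (\<lambda>n z. cinner (F n z) y) (\<lambda>z. cinner (g z) y) sequentially"
        unfolding uniform_limit_iff
      proof (intro allI impI)
        fix e :: real assume e: "e > 0"
        have "(\<lambda>n. 1 / sqrt (1 - r\<^sup>2) * ip_norm ip (F n - g) * norm y) \<longlonglongrightarrow> 1 / sqrt (1 - r\<^sup>2) * 0 * norm y"
          by (intro tendsto_intros lim)
        then have "(\<lambda>n. 1 / sqrt (1 - r\<^sup>2) * ip_norm ip (F n - g) * norm y) \<longlonglongrightarrow> 0" by simp
        from order_tendstoD(2)[OF this e]
        show "\<forall>\<^sub>F n in sequentially. \<forall>z\<in>cball x d. dist (cinner (F n z) y) (cinner (g z) y) < e"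
        proof eventually_elim
          case (elim n)
          show ?case
          proof
            fix z assume z: "z \<in> cball x d"
            have "dist (cinner (F n z) y) (cinner (g z) y) = cmod (cinner ((F n - g) z) y)"
              by (simp add: dist_norm cinner_diff_left)
            also have "\<dots> \<le> norm ((F n - g) z) * norm y" by (rule Cauchy_Schwarz_cinner)
            also have "\<dots> \<le> (1 / sqrt (1 - r\<^sup>2) * ip_norm ip (F n - g)) * norm y"
              by (intro mult_right_mono norm_eval_le_uniform diff_in FV g cb z d) simp
            finally show "dist (cinner (F n z) y) (cinner (g z) y) < e" using elim by linarith
          qed
        qed
      qed
      moreover have "cball x d \<subseteq> disk" using cb d by force
      ultimately show "\<exists>d>0. cball x d \<subseteq> disk \<and> uniform_limit (cball x d) (\<lambda>n z. cinner (F n z) y) (\<lambda>z. cinner (g z) y) sequentially"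
        using d by blast
    qed
    then show "g \<in> M" using g by (simp add: M_def)
  qed
  have kM: "ext0 (\<lambda>z. schur_kernel S z \<zeta> w) \<in> M" if \<zeta>: "\<zeta> \<in> disk" for \<zeta> w
  proof -
    have nz: "1 - z * cnj \<zeta> \<noteq> 0" if z: "z \<in> disk" for z
    proof
      assume "1 - z * cnj \<zeta> = 0"
      then have "cmod z * cmod \<zeta> = 1" by (metis complex_mod_cnj eq_iff_diff_eq_0 norm_mult norm_one)
      moreover have "cmod z * cmod \<zeta> < 1" using z \<zeta> mult_strict_mono'[of "cmod z" 1 "cmod \<zeta>" 1] by simp
      ultimately show False by simp
    qed
    have "(\<lambda>z. cinner (ext0 (\<lambda>z. schur_kernel S z \<zeta> w) z) y) holomorphic_on disk" for y
    proof (rule holomorphic_transform)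
      show "(\<lambda>z. inverse (1 - z * cnj \<zeta>) * (cinner w y - cinner (S z (cadjoint (S \<zeta>) w)) y)) holomorphic_on disk"
        by (intro holomorphic_intros holomorphic_vec_cinner schur_class_holomorphic_vec S nz)
    qed (simp add: ext0_def schur_kernel_def cinner_scaleC_left cinner_diff_left)
    then show ?thesis using kernel_in[OF \<zeta>] by (simp add: M_def)
  qed
  have MV: "M \<subseteq> V" by (auto simp: M_def)
  \<comment> \<open>The projection of f onto M pairs with the kernel functions as f does, hence has
    the values of f.\<close>
  obtain p where p: "p \<in> M" "\<And>v. v \<in> M \<Longrightarrow> ip v f = ip v p" using projection[OF M MV f] by blast
  have "f = p"
  proof (rule fun_eqI[OF f])
    show "p \<in> V" using p MV by blast
    fix z :: complex assume z: "z \<in> disk"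
    show "f z = p z"
      by (rule cinner_eqI) (metis p(2)[OF kM[OF z]] reproducing'[OF f z] reproducing'[OF \<open>p \<in> V\<close> z])
  qed
  then show ?thesis using p(1) by (simp add: M_def)
qed

lemma holomorphic: "f \<in> V \<Longrightarrow> holomorphic_vec f"
  using norm_eval_le_uniform by (intro holomorphic_vec_if_weakly weakly_holomorphic) blast+

end

section \<open>The coisometry onto the de Branges-Rovnyak space\<close>

locale colligation_rkhs = colligation X0 U + E: schur_rkhs VE ipE \<E> +
  S: schur_rkhs VS ipS "redheffer (transfer_function X0 U) \<E>"
  for X0 :: "'x::chilbert set"
    and U :: "'x \<times> 'u::chilbert \<times> 'e::chilbert \<Rightarrow> 'x \<times> 'y::chilbert \<times> 'd::chilbert"
    and VE ipE and \<E> :: "complex \<Rightarrow> 'd \<Rightarrow> 'e" and VS ipS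
begin

definition "qsc c q = (c *\<^sub>C fst q, fsc c (snd q))" for q :: "'x \<times> (complex \<Rightarrow> 'e)"

definition "qip p q = cinner (fst p) (fst q) + ipE (snd p) (snd q)" for p :: "'x \<times> (complex \<Rightarrow> 'e)"

text \<open>The coisometry of the overview, with input u = 0, in the zero-extended form used for the
  function spaces.\<close>

definition W :: "'x \<times> (complex \<Rightarrow> 'e) \<Rightarrow> complex \<Rightarrow> 'y" where
  "W q = ext0 (\<lambda>z. loop_out (\<E> z) z (fst q) 0 (snd q z))"

sublocale Q: hilbert_on "X0 \<times> VE" qsc qip
proof -
  have "qsc = (\<lambda>c p. (c *\<^sub>C fst p, fsc c (snd p)))" "qip = (\<lambda>p q. cinner (fst p) (fst q) + ipE (snd p) (snd q))"
    by (auto simp: qsc_def qip_def fun_eq_iff)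
  then show "hilbert_on (X0 \<times> VE) qsc qip"
    using hilbert_on_prod[OF hilbert_on_closed_csubspace[OF csubspace_X0 closed_X0] E.hilbert_on_axioms] by simp
qed

lemma K: "z \<in> disk \<Longrightarrow> bounded_clinear (\<E> z)" "z \<in> disk \<Longrightarrow> norm (\<E> z d) \<le> norm d"
  using schur_class_bounded_clinear[OF E.S] schur_class_contraction[OF E.S] by auto

lemma W_apply: "z \<in> disk \<Longrightarrow> W q z = loop_out (\<E> z) z (fst q) 0 (snd q z)"
  by (simp add: W_def ext0_def)

lemma W_add:
  assumes "p \<in> X0 \<times> VE" "q \<in> X0 \<times> VE"
  shows "W (p + q) = W p + W q"
proof
  fix z
  show "W (p + q) z = (W p + W q) z"
  proof (cases "z \<in> disk")
    case z: True
    show ?thesis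
      using loop_out_add[OF K(1)[OF z] K(2)[OF z] z, of "fst p" "fst q" 0 0 "snd p z" "snd q z"] assms
      by (auto simp: W_def ext0_def)
  qed (simp add: W_def ext0_def)
qed

lemma W_scale:
  assumes "p \<in> X0 \<times> VE"
  shows "W (qsc c p) = fsc c (W p)"
proof
  fix z
  show "W (qsc c p) z = fsc c (W p) z"
  proof (cases "z \<in> disk")
    case z: True
    show ?thesis
      using loop_out_scale[OF K(1)[OF z] K(2)[OF z] z, of "fst p" c 0 "snd p z"] assms
      by (auto simp: W_def ext0_def qsc_def fsc_def)
  qed (simp add: W_def ext0_def fsc_def)
qed

lemma W_diff:
  assumes "p \<in> X0 \<times> VE" "q \<in> X0 \<times> VE"
  shows "W (p - q) = W p - W q"
  using W_add[OF Q.diff_in[OF assms] assms(2)] by simp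

lemma W_kernel:
  assumes \<zeta>: "\<zeta> \<in> disk"
  obtains \<kappa> where "\<kappa> \<in> X0 \<times> VE" "W \<kappa> = ext0 (\<lambda>z. schur_kernel (redheffer Sg \<E>) z \<zeta> y)"
    "\<And>q. q \<in> X0 \<times> VE \<Longrightarrow> qip q \<kappa> = cinner (W q \<zeta>) y"
proof -
  obtain k e' where k: "k \<in> X0"
    and pair: "\<And>x e0. x \<in> X0 \<Longrightarrow> cinner (loop_out (\<E> \<zeta>) \<zeta> x 0 e0) y = cinner x k + cinner e0 e'"
    and adj: "U (k, cadjoint (redheffer Sg \<E> \<zeta>) y, e') = (cnj \<zeta> *\<^sub>C k, y, cadjoint (\<E> \<zeta>) e')"
    using adjoint_loop[OF E.S \<zeta>, of y] by blast
  let ?\<kappa> = "(k, ext0 (\<lambda>z. schur_kernel \<E> z \<zeta> e'))"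
  show thesis
  proof
    show "?\<kappa> \<in> X0 \<times> VE" using k E.kernel_in[OF \<zeta>] by simp
    show "W ?\<kappa> = ext0 (\<lambda>z. schur_kernel (redheffer Sg \<E>) z \<zeta> y)"
    proof
      fix z
      show "W ?\<kappa> z = ext0 (\<lambda>z. schur_kernel (redheffer Sg \<E>) z \<zeta> y) z"
        using kernel_identity[OF E.S _ \<zeta> k adj, of z] by (simp add: W_def ext0_def)
    qed
    fix q assume "q \<in> X0 \<times> VE"
    then show "qip q ?\<kappa> = cinner (W q \<zeta>) y"
      using pair[of "fst q" "snd q \<zeta>"] E.reproducing[OF _ \<zeta>, of "snd q" e'] \<zeta>
      by (auto simp: qip_def W_def ext0_def simp del: mem_ball)
  qed
qed

text \<open>The initial space of the coisometry \<open>W\<close>, described without its adjoint.\<close>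

definition M :: "('x \<times> (complex \<Rightarrow> 'e)) set" where
  "M = {q \<in> X0 \<times> VE. W q \<in> VS \<and> (\<forall>q'\<in>X0 \<times> VE. W q' \<in> VS \<longrightarrow> ipS (W q) (W q') = qip q q')}"

lemma M_norm: "q \<in> M \<Longrightarrow> ip_norm ipS (W q) = ip_norm qip q"
  by (auto simp: M_def ip_norm_def)

text \<open>\<open>W\<close> is isometric on M, so the images of a convergent sequence have a limit
  in \<open>VS\<close>; the inner product identities pass to the limit.\<close>

lemma M_closed:
  assumes F: "\<And>n::nat. F n \<in> M" and q: "q \<in> X0 \<times> VE" and lim: "(\<lambda>n. ip_norm qip (F n - q)) \<longlonglongrightarrow> 0"
  shows "q \<in> M"
proof -
  have FQ: "\<And>n. F n \<in> X0 \<times> VE" and FV: "\<And>n. W (F n) \<in> VS"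
    and Fip: "\<And>n q'. q' \<in> X0 \<times> VE \<Longrightarrow> W q' \<in> VS \<Longrightarrow> ipS (W (F n)) (W q') = qip (F n) q'"
    using F by (auto simp: M_def)
  have nrm: "ip_norm ipS (W (F m) - W (F n)) = ip_norm qip (F m - F n)" for m n
  proof -
    have d: "W (F m) - W (F n) = W (F m - F n)" by (simp add: W_diff FQ)
    have "W (F m - F n) \<in> VS" unfolding d[symmetric] by (intro S.diff_in FV)
    then have "ipS (W (F m) - W (F n)) (W (F m - F n)) = qip (F m - F n) (F m - F n)"
      by (simp only: S.ip_diff_left FV FQ Fip Q.diff_in Q.ip_diff_left)
    then show ?thesis unfolding ip_norm_def d by simp
  qed
  have "\<exists>s\<in>VS. (\<lambda>n. ip_norm ipS (W (F n) - s)) \<longlonglongrightarrow> 0"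
    by (rule S.complete[OF FV]) (simp only: nrm, rule Q.ip_norm_Cauchy[OF FQ q lim])
  then obtain s where s: "s \<in> VS" "(\<lambda>n. ip_norm ipS (W (F n) - s)) \<longlonglongrightarrow> 0" by blast
  \<comment> \<open>Continuity of \<open>W\<close> into \<open>VS\<close> is still open, so the
    limit is identified pointwise: values of s are read off with kernel functions, values of
    \<open>W q\<close> with the vectors \<kappa>.\<close>
  have sW: "s = W q"
  proof
    fix z
    show "s z = W q z"
    proof (cases "z \<in> disk")
      case False
      then show ?thesis using S.supp[OF s(1)] by (simp add: W_def ext0_def)
    next
      case z: True
      have "cinner (s z) y = cinner (W q z) y" for y
      proof -
        obtain \<kappa> where \<kappa>: "\<kappa> \<in> X0 \<times> VE" "\<And>q. q \<in> X0 \<times> VE \<Longrightarrow> qip q \<kappa> = cinner (W q z) y"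
          using W_kernel[OF z, of y] by metis
        have "(\<lambda>n. qip (F n) \<kappa>) \<longlonglongrightarrow> qip q \<kappa>" by (rule Q.tendsto_ip_left[OF FQ q \<kappa>(1) lim])
        then have 1: "(\<lambda>n. cinner (W (F n) z) y) \<longlonglongrightarrow> cinner (W q z) y" by (simp add: \<kappa>(2) FQ q)
        have "(\<lambda>n. ipS (W (F n)) (ext0 (\<lambda>w. schur_kernel (redheffer Sg \<E>) w z y)))
            \<longlonglongrightarrow> ipS s (ext0 (\<lambda>w. schur_kernel (redheffer Sg \<E>) w z y))"
          by (rule S.tendsto_ip_left[OF FV s(1) S.kernel_in[OF z] s(2)])
        then have 2: "(\<lambda>n. cinner (W (F n) z) y) \<longlonglongrightarrow> cinner (s z) y"
          by (simp add: S.reproducing[OF _ z] FV s(1))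
        show ?thesis by (rule LIMSEQ_unique[OF 2 1])
      qed
      then have "cinner y (s z) = cinner y (W q z)" for y by (metis cinner_commute)
      then show ?thesis by (rule cinner_eqI)
    qed
  qed
  have "ipS (W q) (W q') = qip q q'" if q': "q' \<in> X0 \<times> VE" "W q' \<in> VS" for q'
  proof (rule LIMSEQ_unique)
    show "(\<lambda>n. ipS (W (F n)) (W q')) \<longlonglongrightarrow> ipS (W q) (W q')"
      using S.tendsto_ip_left[OF FV s(1) q'(2) s(2)] by (simp add: sW)
    show "(\<lambda>n. ipS (W (F n)) (W q')) \<longlonglongrightarrow> qip q q'"
      using Q.tendsto_ip_left[OF FQ q q'(1) lim] by (simp add: Fip q')
  qed
  then show ?thesis using q s(1) sW by (simp add: M_def)
qed

lemma M_sub: "M \<subseteq> X0 \<times> VE"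
  by (auto simp: M_def)

sublocale M: hilbert_on M qsc qip
proof (rule Q.closed_subspace[OF M_sub])
  have "W 0 = 0" using W_diff[OF Q.zero_in Q.zero_in] by simp
  then show "0 \<in> M" by (simp add: M_def Q.zero_in S.zero_in S.ip_zero_left Q.ip_zero_left)
  show "p + q \<in> M" if "p \<in> M" "q \<in> M" for p q
  proof -
    have p: "p \<in> X0 \<times> VE" "W p \<in> VS" "\<And>q'. q' \<in> X0 \<times> VE \<Longrightarrow> W q' \<in> VS \<Longrightarrow> ipS (W p) (W q') = qip p q'"
      and q: "q \<in> X0 \<times> VE" "W q \<in> VS" "\<And>q'. q' \<in> X0 \<times> VE \<Longrightarrow> W q' \<in> VS \<Longrightarrow> ipS (W q) (W q') = qip q q'"
      using that by (auto simp: M_def)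
    show ?thesis
      unfolding M_def mem_Collect_eq W_add[OF p(1) q(1)]
      using p q by (intro conjI ballI impI)
        (simp_all only: Q.add_in S.add_in S.ip_add_left Q.ip_add_left)
  qed
  show "qsc c p \<in> M" if "p \<in> M" for c p
  proof -
    have p: "p \<in> X0 \<times> VE" "W p \<in> VS" "\<And>q'. q' \<in> X0 \<times> VE \<Longrightarrow> W q' \<in> VS \<Longrightarrow> ipS (W p) (W q') = qip p q'"
      using that by (auto simp: M_def)
    show ?thesis
      unfolding M_def mem_Collect_eq W_scale[OF p(1)]
      using p by (intro conjI ballI impI)
        (simp_all only: Q.sc_in S.sc_in S.ip_sc_left Q.ip_sc_left)
  qed
qed (rule M_closed)

lemma kernel_in_M:
  assumes \<kappa>: "\<kappa> \<in> X0 \<times> VE" "W \<kappa> = ext0 (\<lambda>z. schur_kernel (redheffer Sg \<E>) z \<zeta> y)"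
    "\<And>q. q \<in> X0 \<times> VE \<Longrightarrow> qip q \<kappa> = cinner (W q \<zeta>) y" and \<zeta>: "\<zeta> \<in> disk"
  shows "\<kappa> \<in> M"
proof -
  have "ipS (W \<kappa>) (W q) = qip \<kappa> q" if q: "q \<in> X0 \<times> VE" "W q \<in> VS" for q
    using S.reproducing'[OF q(2) \<zeta>, of y] \<kappa>(3)[OF q(1)] Q.ip_commute[OF \<kappa>(1) q(1)] cinner_commute[of y "W q \<zeta>"]
    by (simp add: \<kappa>(2))
  then show ?thesis using \<kappa>(1) S.kernel_in[OF \<zeta>] by (simp add: M_def \<kappa>(2))
qed

text \<open>M contains all vectors \<kappa>, so q - p is orthogonal to them, which says that
  \<open>W (q - p)\<close> vanishes at every point. Hence \<open>W\<close> loses exactly the part of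
  q outside M, and its values lie in \<open>VS\<close> because those on M do.\<close>

lemma M_projection:
  assumes q: "q \<in> X0 \<times> VE"
  obtains p where "p \<in> M" "W p = W q" "\<And>v. v \<in> M \<Longrightarrow> qip v q = qip v p"
proof -
  obtain p where p: "p \<in> M" "\<And>v. v \<in> M \<Longrightarrow> qip v q = qip v p"
    using Q.projection[OF M.hilbert_on_axioms M_sub q] by blast
  have pQ: "p \<in> X0 \<times> VE" using p(1) M_sub by blast
  have "W p = W q"
  proof
    fix z
    show "W p z = W q z"
    proof (cases "z \<in> disk")
      case False
      then show ?thesis by (simp add: W_def ext0_def)
    next
      case z: True
      have "cinner y (W p z) = cinner y (W q z)" for y
      proof -
        obtain \<kappa> where \<kappa>: "\<kappa> \<in> X0 \<times> VE" "W \<kappa> = ext0 (\<lambda>w. schur_kernel (redheffer Sg \<E>) w z y)"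
          "\<And>q. q \<in> X0 \<times> VE \<Longrightarrow> qip q \<kappa> = cinner (W q z) y"
          using W_kernel[OF z, of y] by metis
        have "qip \<kappa> q = qip \<kappa> p" by (rule p(2)[OF kernel_in_M[OF \<kappa> z]])
        then have "qip q \<kappa> = qip p \<kappa>"
          using Q.ip_commute[OF q \<kappa>(1)] Q.ip_commute[OF pQ \<kappa>(1)] by simp
        then have "cinner (W q z) y = cinner (W p z) y" using \<kappa>(3) q pQ by simp
        then show ?thesis by (metis cinner_commute)
      qed
      then show ?thesis by (rule cinner_eqI)
    qed
  qed
  then show thesis using that p by blast
qed

lemma W_in: "q \<in> X0 \<times> VE \<Longrightarrow> W q \<in> VS"
  using M_projection[of q] by (metis (no_types, lifting) M_def mem_Collect_eq)

lemma qip_norm_M_projection: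
  assumes q: "q \<in> X0 \<times> VE" and p: "p \<in> M" "W p = W q" "\<And>v. v \<in> M \<Longrightarrow> qip v q = qip v p"
  shows "(ip_norm qip (q - p))\<^sup>2 = (ip_norm qip q)\<^sup>2 - (ip_norm ipS (W q))\<^sup>2"
proof -
  have pQ: "p \<in> X0 \<times> VE" using p(1) M_sub by blast
  have "Re (qip q p) = Re (qip p p)"
    using Q.ip_commute[OF q pQ] p(3)[OF p(1)] by simp
  then show ?thesis
    using Q.Re_ip_diff[OF q pQ] M_norm[OF p(1)] p(2) by (simp add: Q.ip_norm_sq q pQ Q.diff_in)
qed

lemma W_norm_le: "q \<in> X0 \<times> VE \<Longrightarrow> ip_norm ipS (W q) \<le> ip_norm qip q"
proof -
  assume q: "q \<in> X0 \<times> VE"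
  obtain p where p: "p \<in> M" "W p = W q" "\<And>v. v \<in> M \<Longrightarrow> qip v q = qip v p"
    using M_projection[OF q] by blast
  have "0 \<le> (ip_norm qip (q - p))\<^sup>2" by simp
  then have "(ip_norm ipS (W q))\<^sup>2 \<le> (ip_norm qip q)\<^sup>2"
    using qip_norm_M_projection[OF q p] by linarith
  then show ?thesis by (rule power2_le_imp_le[OF _ Q.ip_norm_nonneg[OF q]])
qed

text \<open>By Pythagoras, equal norms leave no room for a component orthogonal to M.\<close>

lemma isometric_imp_in_M:
  assumes q: "q \<in> X0 \<times> VE" and eq: "ip_norm ipS (W q) = ip_norm qip q"
  shows "q \<in> M"
proof -
  obtain p where p: "p \<in> M" "W p = W q" "\<And>v. v \<in> M \<Longrightarrow> qip v q = qip v p"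
    using M_projection[OF q] by blast
  have pQ: "p \<in> X0 \<times> VE" using p(1) M_sub by blast
  have "ip_norm qip (q - p) = 0" using qip_norm_M_projection[OF q p] eq by simp
  then have "q - p = 0" by (rule Q.ip_norm_eq_0[OF Q.diff_in[OF q pQ]])
  then show ?thesis using p(1) by simp
qed

lemma qip_norm_fst: "ip_norm qip (x, 0) = norm x"
  by (simp add: ip_norm_def qip_def E.ip_zero_left[OF E.zero_in] cinner_self)

lemma qip_norm_snd: "ip_norm qip (0, f) = ip_norm ipE f"
  by (simp add: ip_norm_def qip_def)

text \<open>The initial space contains \<open>X\<^sub>0 \<oplus> 0\<close>, so its complement lies in \<open>0 \<oplus> H\<close> and is the kernel
  of the multiplication operator.\<close>

lemma mult_isometric:
  assumes R: "X0 = closure R" and iso: "\<And>x. x \<in> R \<Longrightarrow> ip_norm ipS (W (x, 0)) = norm x"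
    and ker: "\<And>f. f \<in> VE \<Longrightarrow> W (0, f) = 0 \<Longrightarrow> f = 0" and f: "f \<in> VE"
  shows "ip_norm ipS (W (0, f)) = ip_norm ipE f"
proof -
  have 0: "0 \<in> X0" by (rule csubspace_zero[OF csubspace_X0])
  have X0M: "(x, 0) \<in> M" if x: "x \<in> X0" for x
  proof -
    obtain g where g: "\<forall>n. g n \<in> R" "g \<longlonglongrightarrow> x"
      using x unfolding R closure_sequential by (elim exE conjE)
    have gX: "g n \<in> X0" for n unfolding R using g(1) closure_subset by blast
    show ?thesis
    proof (rule M_closed)
      show "(g n, 0) \<in> M" for n
        by (rule isometric_imp_in_M) (use g(1) iso gX E.zero_in in \<open>auto simp: qip_norm_fst\<close>)
      show "(x, 0) \<in> X0 \<times> VE" using x E.zero_in by simp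
      have "(\<lambda>n. norm (g n - x)) \<longlonglongrightarrow> 0" using g(2) by (simp add: tendsto_norm_zero_iff LIM_zero_iff)
      then show "(\<lambda>n. ip_norm qip ((g n, 0) - (x, 0))) \<longlonglongrightarrow> 0" by (simp add: qip_norm_fst)
    qed
  qed
  have q: "(0, f) \<in> X0 \<times> VE" using 0 f by simp
  obtain p where p: "p \<in> M" "W p = W (0, f)" "\<And>v. v \<in> M \<Longrightarrow> qip v (0, f) = qip v p"
    using M_projection[OF q] by blast
  obtain x' f' where p_eq: "p = (x', f')" by fastforce
  have x'f': "x' \<in> X0" "f' \<in> VE" using p(1) M_sub p_eq by auto
  \<comment> \<open>Pairing with an element of M does not see the difference between (0, f) and its
    projection. The left side is 0 and the right side is the squared norm of x'.\<close>
  have "qip (x', 0) (0, f) = qip (x', 0) p" by (rule p(3)[OF X0M[OF x'f'(1)]])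
  then have "x' = 0" by (simp add: qip_def p_eq E.ip_zero_left f x'f')
  then have W0: "W (0, f - f') = 0"
    using W_diff[OF q, of p] p(2) p_eq x'f' 0 by simp
  have "f - f' = 0" by (rule ker[OF E.diff_in[OF f x'f'(2)] W0])
  then have "(0, f) \<in> M" using p(1) p_eq \<open>x' = 0\<close> by simp
  from M_norm[OF this] show ?thesis by (simp add: qip_norm_snd)
qed

end

section \<open>The colligation of an admissible data set\<close>

lemma unitary_onto_inv:
  assumes M: "csubspace M" and f: "unitary_onto M M' f"
  shows "unitary_onto M' M (inv_into M f)" "\<And>y. y \<in> M' \<Longrightarrow> f (inv_into M f y) = y" "inv_into M f 0 = 0"
proof -
  let ?g = "inv_into M f"
  note fp = f[unfolded unitary_onto_def]
  have im: "f ` M = M'" using fp by blast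
  have add: "f (x + y) = f x + f y" if "x \<in> M" "y \<in> M" for x y using fp that by blast
  have sc: "f (c *\<^sub>C x) = c *\<^sub>C f x" if "x \<in> M" for c x using fp that by blast
  have nrm: "norm (f x) = norm x" if "x \<in> M" for x using fp that by blast
  have inj: "inj_on f M"
  proof (rule inj_onI)
    fix x y assume xy: "x \<in> M" "y \<in> M" "f x = f y"
    have "f (x + (-1) *\<^sub>C y) = 0"
      using add[OF xy(1) csubspace_scaleC[OF M xy(2), of "-1"]] sc[OF xy(2), of "-1"] xy(3) by simp
    then have "norm (x - y) = 0" using nrm[OF csubspace_diff[OF M xy(1,2)]] by simp
    then show "x = y" by simp
  qed
  have gM: "?g y \<in> M" and fg: "f (?g y) = y" if "y \<in> M'" for y
    using that im inv_into_into f_inv_into_f by metis+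
  have gf: "?g (f x) = x" if "x \<in> M" for x by (rule inv_into_f_f[OF inj that])
  show "f (?g y) = y" if "y \<in> M'" for y by (rule fg[OF that])
  show "?g 0 = 0" using gf[OF csubspace_zero[OF M]] nrm[OF csubspace_zero[OF M]] by simp
  show "unitary_onto M' M ?g"
    unfolding unitary_onto_def
  proof (intro conjI ballI allI)
    fix x y assume xy: "x \<in> M'" "y \<in> M'"
    show "?g (x + y) = ?g x + ?g y"
      using gf[OF csubspace_add[OF M gM[OF xy(1)] gM[OF xy(2)]]] by (simp add: add gM fg xy)
  next
    fix c x assume x: "x \<in> M'"
    show "?g (c *\<^sub>C x) = c *\<^sub>C ?g x"
      using gf[OF csubspace_scaleC[OF M gM[OF x], of c]] by (simp add: sc gM fg x)
  next
    fix x assume x: "x \<in> M'"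
    show "norm (?g x) = norm x" using nrm[OF gM[OF x]] by (simp add: fg[OF x])
  next
    show "?g ` M' = M" unfolding im[symmetric] using gf by (force simp: image_iff)
  qed
qed

lemma unitary_onto_zero: "csubspace M \<Longrightarrow> unitary_onto M M' f \<Longrightarrow> f 0 = 0"
  unfolding unitary_onto_def by (metis csubspace_zero norm_eq_zero)

locale aip =
  fixes P T :: "'x::chilbert \<Rightarrow> 'x" and E :: "'x \<Rightarrow> 'y::chilbert" and N :: "'x \<Rightarrow> 'u::chilbert"
    and i :: "'x \<times> 'u \<Rightarrow> 'd::chilbert" and j :: "'x \<times> 'y \<Rightarrow> 'e::chilbert"
  assumes admissible: "aip_admissible P T E N"
    and unitary_i: "unitary_onto (aip_Delta P N) UNIV i"
    and unitary_j: "unitary_onto (aip_Delta_star P T E) UNIV j"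
begin

lemma psd_P: "positive_semidef P"
  and bounded_T: "bounded_clinear T" and bounded_E: "bounded_clinear E" and bounded_N: "bounded_clinear N"
  and Stein: "P x - cadjoint T (P (T x)) = cadjoint E (E x) - cadjoint N (N x)"
  using admissible by (auto simp: aip_admissible_def)

abbreviation "R \<equiv> psd_sqrt P"

lemma bounded_R: "bounded_clinear R"
  using positive_semidef_psd_sqrt[OF psd_P] by (simp add: positive_semidef_def)

lemma R_selfadjoint: "cinner (R x) y = cinner x (R y)"
  by (rule positive_semidef_selfadjoint[OF positive_semidef_psd_sqrt[OF psd_P]])

lemma norm_R: "(norm (R x))\<^sup>2 = Re (cinner x (P x))"
proof -
  have "complex_of_real ((norm (R x))\<^sup>2) = cinner x (P x)"
    using R_selfadjoint[of x "R x"] by (simp only: psd_sqrt_sq[OF psd_P] cinner_self)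
  then show ?thesis by (metis Re_complex_of_real)
qed

text \<open>By selfadjointness h is orthogonal to the range of the root, and h lies in the closure
  of that range.\<close>

lemma R_zero_imp:
  assumes h: "h \<in> aip_X0 P" "R h = 0" shows "h = 0"
proof -
  have "closed {v. cinner h v = 0}" by (intro closed_Collect_eq continuous_intros)
  moreover have "range R \<subseteq> {v. cinner h v = 0}" using h(2) by (auto simp flip: R_selfadjoint)
  ultimately have "closure (range R) \<subseteq> {v. cinner h v = 0}" by (simp add: closure_minimal)
  then show ?thesis using h(1) by (auto simp: aip_X0_def)
qed

text \<open>The Stein identity paired with x; this is the norm equality from which V is
  extended.\<close>

lemma isometric: "norm (R x, N x) = norm (R (T x), E x)"
proof -
  have "cinner x (P x) - cinner (T x) (P (T x)) = cinner (E x) (E x) - cinner (N x) (N x)"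
    using arg_cong[OF Stein[of x], of "cinner x"]
    by (simp add: cinner_diff_right flip: cadjoint[OF bounded_T] cadjoint[OF bounded_E] cadjoint[OF bounded_N])
  from arg_cong[OF this, of Re] have "(norm (R x, N x))\<^sup>2 = (norm (R (T x), E x))\<^sup>2"
    by (simp add: norm_Pair_sq norm_R cinner_self)
  then show ?thesis by simp
qed

lemma V: "unitary_onto (aip_DV P N) (aip_RV P T E) (aip_V P T E N)"
  "aip_V P T E N (R x, N x) = (R (T x), E x)"
proof -
  have "\<exists>V. unitary_onto (aip_DV P N) (aip_RV P T E) V \<and> (\<forall>x. V (R x, N x) = (R (T x), E x))"
    unfolding aip_DV_def aip_RV_def
    by (rule isometry_extension[OF bounded_clinear_Pair[OF bounded_R bounded_N]
          bounded_clinear_Pair[OF bounded_clinear_compose[OF bounded_R bounded_T] bounded_E] isometric])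
  from someI_ex[OF this, folded aip_V_def]
  show "unitary_onto (aip_DV P N) (aip_RV P T E) (aip_V P T E N)"
    "aip_V P T E N (R x, N x) = (R (T x), E x)" by auto
qed

lemma X0: "csubspace (aip_X0 P)" "closed (aip_X0 P)"
  by (auto simp: aip_X0_def intro: csubspace_closure csubspace_range bounded_R)

lemma R_in: "R x \<in> aip_X0 P"
  unfolding aip_X0_def by (rule subsetD[OF closure_subset rangeI])

lemma DV: "csubspace (aip_DV P N)" "closed (aip_DV P N)" "aip_DV P N \<subseteq> aip_X0 P \<times> UNIV"
proof -
  show "csubspace (aip_DV P N)" unfolding aip_DV_def
    by (rule csubspace_closure[OF csubspace_range[OF bounded_clinear_Pair[OF bounded_R bounded_N]]])
  show "aip_DV P N \<subseteq> aip_X0 P \<times> UNIV" unfolding aip_DV_def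
    by (rule closure_minimal) (auto simp: R_in intro: closed_Times X0)
qed (simp add: aip_DV_def)

lemma RV: "csubspace (aip_RV P T E)" "closed (aip_RV P T E)" "aip_RV P T E \<subseteq> aip_X0 P \<times> UNIV"
proof -
  show "csubspace (aip_RV P T E)" unfolding aip_RV_def
    by (rule csubspace_closure[OF csubspace_range[OF bounded_clinear_Pair[OF
            bounded_clinear_compose[OF bounded_R bounded_T] bounded_E]]])
  show "aip_RV P T E \<subseteq> aip_X0 P \<times> UNIV" unfolding aip_RV_def
    by (rule closure_minimal) (auto simp: R_in intro: closed_Times X0)
qed (simp add: aip_RV_def)

lemma Delta: "csubspace (aip_Delta P N)" "csubspace (aip_Delta_star P T E)"
  by (auto simp: aip_Delta_def aip_Delta_star_def intro!: csubspace_Int csubspace_Times_UNIV csubspace_orth_compl X0)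

section \<open>The unitary operator of the data as a colligation\<close>

abbreviation "pDV \<equiv> orth_proj (aip_DV P N)"
abbreviation "jinv \<equiv> inv_into (aip_Delta_star P T E) j"
abbreviation "VV \<equiv> aip_V P T E N"
abbreviation "UU \<equiv> aip_U P T E N i j"

lemma U_eq: "UU (h, u, e) = (fst (VV (pDV (h, u)) + jinv e), snd (VV (pDV (h, u)) + jinv e), i ((h, u) - pDV (h, u)))"
  by (simp add: aip_U_def Let_def)

lemma pDV: "pDV w \<in> aip_DV P N" by (rule orth_proj[OF DV(1,2)])

lemma rDV: "w \<in> aip_X0 P \<times> UNIV \<Longrightarrow> w - pDV w \<in> aip_Delta P N"
  unfolding aip_Delta_def
  using orth_proj[OF DV(1,2), of w] DV(3) csubspace_diff[OF csubspace_Times_UNIV[OF X0(1)], of w "pDV w"] by blast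

lemma jinv: "unitary_onto UNIV (aip_Delta_star P T E) jinv" "j (jinv e) = e" "jinv 0 = 0"
  using unitary_onto_inv[OF Delta(2) unitary_j] by auto

lemma jinv_in: "jinv e \<in> aip_Delta_star P T E"
  using jinv(1) unfolding unitary_onto_def by blast

lemma VV_in: "p \<in> aip_DV P N \<Longrightarrow> VV p \<in> aip_RV P T E"
  using V(1) unfolding unitary_onto_def by blast

text \<open>Uniqueness of the projection lets \<open>aip_U\<close> be evaluated on any decomposition
  along \<open>aip_DV\<close> and \<open>aip_Delta\<close>. Sums and multiples of decompositions are
  decompositions, which is how linearity is obtained below.\<close>

lemma U_of_decomposition:
  assumes p: "p \<in> aip_DV P N" and \<delta>: "\<delta> \<in> aip_Delta P N" and hu: "(h, u) = p + \<delta>"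
  shows "UU (h, u, e) = (fst (VV p + jinv e), snd (VV p + jinv e), i \<delta>)"
proof -
  have "pDV (h, u) = p"
    by (rule orth_proj_unique[OF DV(1,2) p]) (use \<delta> hu in \<open>simp add: aip_Delta_def\<close>)
  moreover have "(h, u) - p = \<delta>" using hu by simp
  ultimately show ?thesis unfolding U_eq by simp
qed

text \<open>Vectors (R x, N x) lie in the domain of V, so both defect signals are 0. These
  trajectories are the test vectors for other signals of the colligation, and iterating them
  produces the observability series.\<close>

lemma U_trajectory: "UU (R x, N x, 0) = (R (T x), E x, 0)"
proof -
  have "(R x, N x) \<in> aip_DV P N" unfolding aip_DV_def by (rule subsetD[OF closure_subset rangeI])
  from U_of_decomposition[OF this csubspace_zero[OF Delta(1)], of "R x" "N x" 0]
  show ?thesis by (simp add: V(2) jinv(3) unitary_onto_zero[OF Delta(1) unitary_i])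
qed

sublocale colligation "aip_X0 P" UU
proof
  show "csubspace (aip_X0 P)" "closed (aip_X0 P)" by (rule X0)+
  fix h h' :: 'x and a a' :: "'u \<times> 'e"
  obtain u e u' e' where a: "a = (u, e)" "a' = (u', e')" by fastforce
  have V_add: "VV (p + p') = VV p + VV p'" if "p \<in> aip_DV P N" "p' \<in> aip_DV P N" for p p'
    using V(1) that unfolding unitary_onto_def by blast
  have i_add: "i (p + p') = i p + i p'" if "p \<in> aip_Delta P N" "p' \<in> aip_Delta P N" for p p'
    using unitary_i that unfolding unitary_onto_def by blast
  have j_add: "jinv (p + p') = jinv p + jinv p'" for p p'
    using jinv(1) unfolding unitary_onto_def by blast
  have V_sc: "VV (c *\<^sub>C p) = c *\<^sub>C VV p" if "p \<in> aip_DV P N" for p c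
    using V(1) that unfolding unitary_onto_def by blast
  have i_sc: "i (c *\<^sub>C p) = c *\<^sub>C i p" if "p \<in> aip_Delta P N" for p c
    using unitary_i that unfolding unitary_onto_def by blast
  have j_sc: "jinv (c *\<^sub>C p) = c *\<^sub>C jinv p" for p c
    using jinv(1) unfolding unitary_onto_def by blast
  have split: "w = pDV w + (w - pDV w)" for w by simp
  \<comment> \<open>The component in the copy of Delta depends on (h, u) alone, so e does not reach
    it.\<close>
  show "snd (snd (UU (0, 0, e))) = 0" for e
    using U_of_decomposition[OF csubspace_zero[OF DV(1)] csubspace_zero[OF Delta(1)], of 0 0 e]
      unitary_onto_zero[OF Delta(1) unitary_i]
    by (simp add: zero_prod_def)
  show "\<exists>h\<in>aip_X0 P. \<exists>a. UU (h, a) = (k, b)" if k: "k \<in> aip_X0 P" for k b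
  proof -
    obtain y d where b: "b = (y, d)" by fastforce
    let ?p = "orth_proj (aip_RV P T E) (k, y)"
    have pR: "?p \<in> aip_RV P T E" "(k, y) - ?p \<in> orth_compl (aip_RV P T E)" by (rule orth_proj[OF RV(1,2)])+
    have "(k, y) \<in> aip_X0 P \<times> UNIV" "?p \<in> aip_X0 P \<times> UNIV" using k pR(1) RV(3) by blast+
    from csubspace_diff[OF csubspace_Times_UNIV[OF X0(1)] this]
    have rest: "(k, y) - ?p \<in> aip_Delta_star P T E" using pR(2) by (simp add: aip_Delta_star_def)
    have "?p \<in> VV ` aip_DV P N" using V(1) pR(1) unfolding unitary_onto_def by simp
    then obtain p where p: "p \<in> aip_DV P N" "VV p = ?p" unfolding image_iff by metis
    have "d \<in> i ` aip_Delta P N" using unitary_i unfolding unitary_onto_def by simp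
    then obtain \<delta> where \<delta>: "\<delta> \<in> aip_Delta P N" "i \<delta> = d" unfolding image_iff by metis
    obtain h u where hu: "(h, u) = p + \<delta>" by (metis surj_pair)
    have "p \<in> aip_X0 P \<times> UNIV" "\<delta> \<in> aip_X0 P \<times> UNIV" using p(1) DV(3) \<delta>(1) by (auto simp: aip_Delta_def)
    then have "h \<in> aip_X0 P" using csubspace_add[OF csubspace_Times_UNIV[OF X0(1)]] hu by (metis mem_Sigma_iff)
    moreover have "jinv (j ((k, y) - ?p)) = (k, y) - ?p"
    proof -
      have "jinv (j w) = w" if w: "w \<in> aip_Delta_star P T E" for w
      proof -
        have "w \<in> jinv ` UNIV" using jinv(1) w unfolding unitary_onto_def by simp
        then show ?thesis using jinv(2) by force
      qed
      then show ?thesis using rest by blast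
    qed
    then have "UU (h, u, j ((k, y) - ?p)) = (k, y, d)"
      using U_of_decomposition[OF p(1) \<delta>(1) hu, of "j ((k, y) - ?p)"] by (simp add: p(2) \<delta>(2))
    ultimately show ?thesis unfolding b by blast
  qed
  assume h: "h \<in> aip_X0 P"
  have hu: "(h, u) \<in> aip_X0 P \<times> UNIV" using h by simp
  note dec = U_of_decomposition[OF pDV rDV[OF hu] split]
  show "UU (c *\<^sub>C (h, a)) = c *\<^sub>C UU (h, a)" for c
  proof -
    have "(c *\<^sub>C h, c *\<^sub>C u) = c *\<^sub>C pDV (h, u) + c *\<^sub>C ((h, u) - pDV (h, u))"
      by (simp flip: scaleC_add_right)
    note U_of_decomposition[OF csubspace_scaleC[OF DV(1) pDV] csubspace_scaleC[OF Delta(1) rDV[OF hu]] this, of "c *\<^sub>C e"]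
    moreover have "VV (c *\<^sub>C pDV (h, u)) + jinv (c *\<^sub>C e) = c *\<^sub>C (VV (pDV (h, u)) + jinv e)"
      by (simp only: V_sc[OF pDV] j_sc scaleC_add_right)
    ultimately have "UU (c *\<^sub>C h, c *\<^sub>C u, c *\<^sub>C e) =
        (fst (c *\<^sub>C (VV (pDV (h, u)) + jinv e)), snd (c *\<^sub>C (VV (pDV (h, u)) + jinv e)), c *\<^sub>C i ((h, u) - pDV (h, u)))"
      by (simp only: i_sc[OF rDV[OF hu]])
    then show ?thesis unfolding a U_eq scaleC_Pair by (simp only: scaleC_prod_def fst_conv snd_conv)
  qed
  have VpX: "VV (pDV w) \<in> aip_X0 P \<times> UNIV" "jinv e \<in> aip_X0 P \<times> UNIV" for w
    using subsetD[OF RV(3) VV_in[OF pDV]] jinv_in[of e] unfolding aip_Delta_star_def by blast+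
  show "fst (UU (h, a)) \<in> aip_X0 P"
    using csubspace_add[OF X0(1)] VpX(1)[of "(h, u)"] VpX(2) unfolding a U_eq by (auto simp: mem_Times_iff)
  show "norm (UU (h, a)) = norm (h, a)"
  proof -
    have orth: "cinner (VV (pDV (h, u))) (jinv e) = 0"
    proof -
      have "cinner (jinv e) (VV (pDV (h, u))) = 0"
        using jinv_in[of e] VV_in[OF pDV] by (auto simp: aip_Delta_star_def orth_compl_def)
      then show ?thesis using cinner_commute[of "VV (pDV (h, u))" "jinv e"] by simp
    qed
    have orth': "cinner (pDV (h, u)) ((h, u) - pDV (h, u)) = 0"
    proof -
      have "cinner ((h, u) - pDV (h, u)) (pDV (h, u)) = 0"
        using rDV[OF hu] pDV[of "(h, u)"] by (auto simp: aip_Delta_def orth_compl_def)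
      then show ?thesis using cinner_commute[of "pDV (h, u)" "(h, u) - pDV (h, u)"] by simp
    qed
    have nV: "norm (VV (pDV (h, u))) = norm (pDV (h, u))" using V(1) pDV unfolding unitary_onto_def by blast
    have nj: "norm (jinv e) = norm e" using jinv(1) unfolding unitary_onto_def by blast
    have ni: "norm (i ((h, u) - pDV (h, u))) = norm ((h, u) - pDV (h, u))"
      using unitary_i rDV[OF hu] unfolding unitary_onto_def by blast
    define q where "q = VV (pDV (h, u)) + jinv e"
    have "(norm (UU (h, a)))\<^sup>2 = (norm (fst q))\<^sup>2 + (norm (snd q))\<^sup>2 + (norm (i ((h, u) - pDV (h, u))))\<^sup>2"
      unfolding a U_eq q_def by (simp add: norm_Pair_sq)
    also have "\<dots> = (norm q)\<^sup>2 + (norm ((h, u) - pDV (h, u)))\<^sup>2"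
      using norm_Pair_sq[of "fst q" "snd q"] by (simp add: ni)
    also have "(norm q)\<^sup>2 = (norm (pDV (h, u)))\<^sup>2 + (norm e)\<^sup>2"
      unfolding q_def norm_add_orth[OF orth] by (simp add: nV nj)
    also have "(norm (pDV (h, u)))\<^sup>2 + (norm e)\<^sup>2 + (norm ((h, u) - pDV (h, u)))\<^sup>2
        = (norm (pDV (h, u) + ((h, u) - pDV (h, u))))\<^sup>2 + (norm e)\<^sup>2"
      unfolding norm_add_orth[OF orth'] by simp
    also have "\<dots> = (norm (h, a))\<^sup>2" unfolding a by (simp add: norm_Pair_sq)
    finally show ?thesis by simp
  qed
  assume h': "h' \<in> aip_X0 P"
  have hu': "(h', u') \<in> aip_X0 P \<times> UNIV" using h' by simp
  note dec' = U_of_decomposition[OF pDV rDV[OF hu'] split]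
  show "UU ((h, a) + (h', a')) = UU (h, a) + UU (h', a')"
  proof -
    have "(h + h', u + u') = (pDV (h, u) + pDV (h', u')) + (((h, u) - pDV (h, u)) + ((h', u') - pDV (h', u')))"
      by simp
    note U_of_decomposition[OF csubspace_add[OF DV(1) pDV pDV] csubspace_add[OF Delta(1) rDV[OF hu] rDV[OF hu']] this, of "e + e'"]
    moreover have "VV (pDV (h, u) + pDV (h', u')) + jinv (e + e') = (VV (pDV (h, u)) + jinv e) + (VV (pDV (h', u')) + jinv e')"
      by (simp only: V_add[OF pDV pDV] j_add add_ac)
    ultimately have "UU (h + h', u + u', e + e') =
        (fst ((VV (pDV (h, u)) + jinv e) + (VV (pDV (h', u')) + jinv e')),
         snd ((VV (pDV (h, u)) + jinv e) + (VV (pDV (h', u')) + jinv e')),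
         i ((h, u) - pDV (h, u)) + i ((h', u') - pDV (h', u')))"
      by (simp only: i_add[OF rDV[OF hu] rDV[OF hu']])
    then show ?thesis unfolding a U_eq add_Pair by (simp only: fst_add snd_add)
  qed
qed

section \<open>Vanishing outputs and injectivity of the Redheffer transform\<close>

abbreviation "X\<^sub>0 \<equiv> aip_X0 P"

text \<open>Pairing with the trajectories of the data turns a vanishing output into \<open>T\<^sup>* P\<^sup>1\<^sup>/\<^sup>2 h(z) = z P\<^sup>1\<^sup>/\<^sup>2 h(z)\<close>.\<close>

lemma zero_output:
  assumes T: "inj (cadjoint T)" and h: "holomorphic_vec h"
    and U: "\<And>z. z \<in> disk \<Longrightarrow> h z \<in> X\<^sub>0 \<and> UU (z *\<^sub>C h z, 0, e z) = (h z, 0, d z)" and z: "z \<in> disk"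
  shows "e z = 0" "d z = 0"
proof -
  have "R (h z) = 0"
  proof (rule holomorphic_eigenvector_zero[OF _ bounded_T T _ z])
    show "holomorphic_vec (\<lambda>z. R (h z))"
      using h has_cderiv_clinear[OF bounded_R] unfolding holomorphic_vec_iff by blast
    fix w x assume w: "w \<in> disk"
    have "w *\<^sub>C h w \<in> X\<^sub>0" using U[OF w] csubspace_scaleC[OF X0(1)] by blast
    \<comment> \<open>All other terms of the pairing drop out: u and y vanish on the one side, the
      defect signals of the trajectory on the other.\<close>
    from U_inner[OF conjunct2[OF U[OF w]] U_trajectory[of x] this R_in]
    show "cinner (R (h w)) (T x) = w * cinner (R (h w)) x"
      by (simp add: cinner_scaleC_left R_selfadjoint)
  qed
  then have h0: "h z = 0" using R_zero_imp U[OF z] by blast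
  have U0: "UU (0, 0, e z) = (0, 0, d z)" using U[OF z] by (simp add: h0)
  then show d: "d z = 0" using U_D22[of "e z"] by simp
  show "e z = 0" using U_energy[OF U0 csubspace_zero[OF X0(1)]] d by simp
qed

text \<open>A vector d orthogonal to the range is run backwards through U together with y = 0.
  Orthogonality makes the resulting input u' vanish, and pairing with trajectories gives w = conj(z)
  T' w for w = R k, where T' is the adjoint of T. For |z| times the norm of T below 1 this forces w
  = 0, so k = 0, and then d = 0 because D22 vanishes.\<close>

lemma dense_range_block21:
  assumes z: "z \<in> disk" and T: "cmod z * onorm T < 1"
  shows "closure (range (block21 Sg z)) = UNIV"
proof (rule closure_csubspace_eq_UNIV)
  have add: "block21 Sg z (u + v) = block21 Sg z u + block21 Sg z v" for u v
    using transfer_function_add[OF z, of "(u, 0)" "(v, 0)"] by (simp add: block21_def)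
  have sc: "block21 Sg z (c *\<^sub>C u) = c *\<^sub>C block21 Sg z u" for c u
    using transfer_function_scaleC[OF z, of c "(u, 0)"] by (simp add: block21_def scaleC_prod_def)
  have "0 \<in> range (block21 Sg z)" using sc[of 0 0] by (metis rangeI scaleC_zero_left)
  then show "csubspace (range (block21 Sg z))"
    unfolding csubspace_def by (auto simp flip: add sc)
  fix d assume "\<And>m. m \<in> range (block21 Sg z) \<Longrightarrow> cinner m d = 0"
  then have d: "cinner (block21 Sg z u) d = 0" for u by blast
  obtain k a where ka: "k \<in> X\<^sub>0" "UU (k, a) = (cnj z *\<^sub>C k, (0, d))"
    using adjoint_state_ex[OF z] by blast
  obtain u' e' where a: "a = (u', e')" by fastforce
  note U1 = ka(2)[unfolded a]
  have "cinner u u' = 0" for u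
  proof -
    obtain h where h: "h \<in> X\<^sub>0" "UU (z *\<^sub>C h, u, 0) = (h, Sg z (u, 0))" using transfer_function_ex[OF z] by meson
    have "UU (z *\<^sub>C h, u, 0) = (h, fst (Sg z (u, 0)), block21 Sg z u)" using h(2) by (simp add: block21_def)
    from U_inner[OF this U1 csubspace_scaleC[OF X0(1) h(1)] ka(1)]
    show ?thesis by (simp add: d cinner_scaleC_left cinner_scaleC_right)
  qed
  then have u': "u' = 0" by (metis cinner_eq_zero_iff)
  define w where "w = R k"
  have "cinner x w = z * cinner (T x) w" for x
    using U_inner[OF U_trajectory[of x] U1 R_in ka(1)]
    by (simp add: u' w_def R_selfadjoint cinner_scaleC_right)
  from this[of w] have "(norm w)\<^sup>2 = cmod (z * cinner (T w) w)"
    by (metis abs_of_nonneg cinner_self norm_of_real zero_le_power2)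
  also have "\<dots> \<le> cmod z * ((onorm T * norm w) * norm w)"
    unfolding norm_mult
    by (intro mult_left_mono order_trans[OF Cauchy_Schwarz_cinner] mult_right_mono
        onorm[OF bounded_clinear_bounded_linear[OF bounded_T]]) auto
  finally have le: "(norm w)\<^sup>2 \<le> (cmod z * onorm T) * (norm w)\<^sup>2" by (simp add: power2_eq_square mult_ac)
  have "w = 0"
  proof (rule ccontr)
    assume "w \<noteq> 0"
    then have "(cmod z * onorm T) * (norm w)\<^sup>2 < 1 * (norm w)\<^sup>2" using T by (intro mult_strict_right_mono) auto
    then show False using le by linarith
  qed
  then have "k = 0" using R_zero_imp[OF ka(1)] by (simp add: w_def)
  then show "d = 0" using U1 u' U_D22[of e'] by simp
qed

theorem redheffer_injective:
  assumes T: "inj (cadjoint T)"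
  shows "inj_on (redheffer Sg) schur_class"
proof (rule inj_onI)
  fix \<E>1 \<E>2 :: "complex \<Rightarrow> 'd \<Rightarrow> 'e"
  assume E: "\<E>1 \<in> schur_class" "\<E>2 \<in> schur_class" and eq: "redheffer Sg \<E>1 = redheffer Sg \<E>2"
  note K1 = schur_class_bounded_clinear[OF E(1)] schur_class_contraction[OF E(1)]
  note K2 = schur_class_bounded_clinear[OF E(2)] schur_class_contraction[OF E(2)]
  have 0: "0 \<in> X\<^sub>0" by (rule csubspace_zero[OF X0(1)])
  \<comment> \<open>Equal transforms give equal outputs, so the difference of the loops for the two
    parameters with the same u has zero input and zero output. It is a closed loop for neither
    parameter, which is why \<open>zero_output\<close> leaves the relation between e and d
    open.\<close>
  have agree: "\<E>1 z d = \<E>2 z d" if z: "z \<in> disk" and l: "loop (\<E>1 z) z 0 u 0 h e y d" for z u h e y d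
  proof -
    have "\<forall>z\<in>disk. \<exists>h e y d. loop (\<E>1 z) z 0 u 0 h e y d" using loop_ex[OF K1 _ 0] by blast
    then obtain h1 e1 y1 d1 where l1: "\<And>z. z \<in> disk \<Longrightarrow> loop (\<E>1 z) z 0 u 0 (h1 z) (e1 z) (y1 z) (d1 z)" by metis
    have "\<forall>z\<in>disk. \<exists>h e y d. loop (\<E>2 z) z 0 u 0 h e y d" using loop_ex[OF K2 _ 0] by blast
    then obtain h2 e2 y2 d2 where l2: "\<And>z. z \<in> disk \<Longrightarrow> loop (\<E>2 z) z 0 u 0 (h2 z) (e2 z) (y2 z) (d2 z)" by metis
    have hol0: "holomorphic_vec (\<lambda>z::complex. 0::'e)"
      by (auto simp: holomorphic_vec_def intro!: exI[of _ 0])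
    have h: "holomorphic_vec (\<lambda>z. h1 z - h2 z)"
      by (rule holomorphic_vec_diff[OF loop_holomorphic(1)[OF E(1) hol0 l1] loop_holomorphic(1)[OF E(2) hol0 l2]])
    have U: "h1 z - h2 z \<in> X\<^sub>0 \<and> UU (z *\<^sub>C (h1 z - h2 z), 0, e1 z - e2 z) = (h1 z - h2 z, 0, d1 z - d2 z)"
      if z: "z \<in> disk" for z
    proof -
      have 1: "UU (z *\<^sub>C h1 z, u, e1 z) = (h1 z, y1 z, d1 z)" "h1 z \<in> X\<^sub>0"
        and 2: "UU (z *\<^sub>C h2 z, u, e2 z) = (h2 z, y2 z, d2 z)" "h2 z \<in> X\<^sub>0"
        using l1[OF z] l2[OF z] by (auto simp: loop_def)
      have "y1 z = y2 z" using redheffer_eq[OF E(1) z l1[OF z]] redheffer_eq[OF E(2) z l2[OF z]] eq by simp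
      then show ?thesis
        using U_diff[OF 1(1) 2(1) csubspace_scaleC[OF X0(1) 1(2)] csubspace_scaleC[OF X0(1) 2(2)]]
          csubspace_diff[OF X0(1) 1(2) 2(2)] by (simp add: scaleC_diff_right)
    qed
    have "e1 z = e2 z" "d1 z = d2 z" using zero_output[OF T h U z] by simp_all
    moreover have "d = d1 z" by (rule loop_unique(4)[OF K1[OF z] z l l1[OF z]])
    moreover have "e1 z = \<E>1 z (d1 z)" "e2 z = \<E>2 z (d2 z)" using l1[OF z] l2[OF z] by (simp_all add: loop_def)
    ultimately show ?thesis by simp
  qed
  have small: "\<E>1 z d = \<E>2 z d" if z: "z \<in> disk" and zT: "cmod z * onorm T < 1" for z d
  proof -
    \<comment> \<open>The part of d that the input has to supply, since a loop satisfies d =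
      \<open>\<Sigma>21\<close> u + \<open>\<Sigma>22\<close> \<E>1 d. Inputs whose
      \<open>\<Sigma>21\<close>-images approach s produce signals that approach d, because the
      feedback part contracts by |z|.\<close>
    define s where "s = d - block22 Sg z (\<E>1 z d)"
    have "s \<in> closure (range (block21 Sg z))" using dense_range_block21[OF z zT] by simp
    then obtain u where u: "(\<lambda>n::nat. block21 Sg z (u n)) \<longlonglongrightarrow> s" by (rule closure_rangeE)
    have "\<forall>n. \<exists>h e y d. loop (\<E>1 z) z 0 (u n) 0 h e y d" using loop_ex[OF K1[OF z] z 0] by blast
    then obtain h e y d' where l: "\<And>n. loop (\<E>1 z) z 0 (u n) 0 (h n) (e n) (y n) (d' n)" by metis
    have bd: "norm (d' n - d) \<le> norm (block21 Sg z (u n) - s) / (1 - cmod z)" for n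
    proof -
      have "d' n = block21 Sg z (u n) + block22 Sg z (\<E>1 z (d' n))"
        using loop_transfer(2,3)[OF z l[of n]] by simp
      then have "d' n - d = (block21 Sg z (u n) - s) + block22 Sg z (\<E>1 z (d' n - d))"
        by (simp add: s_def bounded_clinear_diff[OF K1(1)[OF z]] block22_diff[OF z])
      then have "norm (d' n - d) \<le> norm (block21 Sg z (u n) - s) + norm (block22 Sg z (\<E>1 z (d' n - d)))"
        by (metis norm_triangle_ineq)
      also have "norm (block22 Sg z (\<E>1 z (d' n - d))) \<le> cmod z * norm (d' n - d)"
        by (rule order_trans[OF block22_bound[OF z] mult_left_mono[OF K1(2)[OF z]]]) simp
      finally have "norm (d' n - d) * (1 - cmod z) \<le> norm (block21 Sg z (u n) - s)" by (simp add: algebra_simps)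
      then show ?thesis using z by (simp add: field_simps)
    qed
    have "(\<lambda>n. norm (block21 Sg z (u n) - s) / (1 - cmod z)) \<longlonglongrightarrow> norm (s - s) / (1 - cmod z)"
      by (intro tendsto_intros u) (use z in auto)
    then have "(\<lambda>n. norm (block21 Sg z (u n) - s) / (1 - cmod z)) \<longlonglongrightarrow> 0" by simp
    then have "(\<lambda>n. d' n - d) \<longlonglongrightarrow> 0"
      by (rule Lim_null_comparison[rotated]) (use bd in simp)
    then have lim: "d' \<longlonglongrightarrow> d" by (rule LIM_zero_cancel)
    have "(\<lambda>n. \<E>1 z (d' n)) \<longlonglongrightarrow> \<E>1 z d" "(\<lambda>n. \<E>2 z (d' n)) \<longlonglongrightarrow> \<E>2 z d"
      by (rule bounded_clinear_tendsto[OF K1(1)[OF z] lim], rule bounded_clinear_tendsto[OF K2(1)[OF z] lim])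
    moreover have "\<E>1 z (d' n) = \<E>2 z (d' n)" for n by (rule agree[OF z l])
    ultimately show ?thesis using LIMSEQ_unique by simp
  qed
  \<comment> \<open>Small enough for the density lemma on all of \<open>ball 0 \<rho>\<close>, and
    at most 1; the \<open>+ 1\<close> covers T = 0.\<close>
  define \<rho> where "\<rho> = 1 / (onorm T + 1)"
  have T0: "0 \<le> onorm T" by (rule onorm_pos_le[OF bounded_clinear_bounded_linear[OF bounded_T]])
  then have \<rho>: "0 < \<rho>" "\<rho> \<le> 1" "\<rho> * onorm T < 1" by (auto simp: \<rho>_def field_simps)
  have sub: "ball 0 \<rho> \<subseteq> disk" using \<rho>(2) by (rule subset_ball)
  have all: "\<E>1 z d = \<E>2 z d" if z: "z \<in> disk" for z d
  proof -
    have "cinner (\<E>1 z d - \<E>2 z d) v = 0" for v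
    proof (rule analytic_continuation[where U = "ball 0 \<rho>" and S = disk and \<xi> = 0
          and f = "\<lambda>z. cinner (\<E>1 z d - \<E>2 z d) v" and w = z])
      show "(\<lambda>z. cinner (\<E>1 z d - \<E>2 z d) v) holomorphic_on disk"
        by (rule holomorphic_vec_cinner[OF holomorphic_vec_diff[OF schur_class_holomorphic_vec[OF E(1)]
              schur_class_holomorphic_vec[OF E(2)]]])
      show "(0::complex) islimpt ball 0 \<rho>" using \<rho>(1) by (simp add: islimpt_ball)
      fix w :: complex assume w: "w \<in> ball 0 \<rho>"
      have "cmod w * onorm T \<le> \<rho> * onorm T" using w T0 by (intro mult_right_mono) auto
      then have "cmod w * onorm T < 1" using \<rho>(3) by linarith
      then show "cinner (\<E>1 w d - \<E>2 w d) v = 0" using small[OF subsetD[OF sub w]] by simp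
    qed (use z sub in auto)
    then have "\<E>1 z d - \<E>2 z d = 0" by (metis cinner_eq_zero_iff)
    then show ?thesis by simp
  qed
  show "\<E>1 = \<E>2"
  proof (rule extensionalityI[of _ disk])
    show "\<E>1 \<in> extensional disk" "\<E>2 \<in> extensional disk" using E by (auto simp: schur_class_def)
    show "\<E>1 z = \<E>2 z" if "z \<in> disk" for z using all[OF that] by (rule ext)
  qed
qed

text \<open>The trajectory of x under the data, weighted by powers of z and summed, is a closed loop
  with vanishing defect signals, whatever K is. Admissibility gives convergence of the input and
  output series; convergence of the state series is derived from energy conservation, since T itself
  may have large norm.\<close>

lemma observability_loop:
  assumes z: "z \<in> disk" and K: "bounded_clinear K"
  obtains k where "loop K z (R x) (observability N T x z) 0 k 0 (observability E T x z) 0"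
proof -
  define a b y where "a n = R ((T ^^ n) x)" and "b n = N ((T ^^ n) x)" and "y n = E ((T ^^ n) x)" for n
  have traj: "UU (a n, b n, 0) = (a (Suc n), y n, 0)" for n
    using U_trajectory[of "(T ^^ n) x"] by (simp add: a_def b_def y_def)
  have aX: "a n \<in> X\<^sub>0" for n by (simp add: a_def R_in)
  have anx: "norm (a (Suc n)) \<le> norm (a n) + norm (b n)" for n
    using U_bound(1)[OF traj aX] by simp
  have sum_b: "summable (\<lambda>n. w ^ n *\<^sub>C b n)" and sum_y: "summable (\<lambda>n. w ^ n *\<^sub>C y n)" if "w \<in> disk" for w
    using admissible that unfolding aip_admissible_def analytic_output_pair_def b_def y_def by blast+
  \<comment> \<open>Boundedness of the weighted terms at a radius between |z| and 1 gives geometric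
    convergence at z.\<close>
  define r where "r = (1 + cmod z) / 2"
  have r: "0 < r" "r < 1" "cmod z < r" using z norm_ge_zero[of z] by (auto simp: r_def field_simps add_pos_nonneg)
  have "complex_of_real r \<in> disk" using r by simp
  from summable_LIMSEQ_zero[OF sum_b[OF this]]
  have "Bseq (\<lambda>n. complex_of_real r ^ n *\<^sub>C b n)" by (rule convergent_imp_Bseq[OF convergentI])
  then obtain C where C: "0 < C" "\<And>n. norm (complex_of_real r ^ n *\<^sub>C b n) \<le> C" by (auto simp: Bseq_def)
  have bC: "r ^ n * norm (b n) \<le> C" for n using C(2)[of n] r by (simp add: norm_power)
  \<comment> \<open>An upper bound for \<open>norm (a 0)\<close> that the recursion t \<mapsto> r t
    + r C does not exceed; r C / (1 - r) is the fixed point of this recursion.\<close>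
  define L where "L = norm (a 0) + r * C / (1 - r)"
  have L: "r * L + r * C \<le> L"
  proof -
    have "(1 - r) * L = (1 - r) * norm (a 0) + r * C" using r by (simp add: L_def distrib_left)
    then show ?thesis using mult_nonneg_nonneg[of "1 - r" "norm (a 0)"] r by (simp add: left_diff_distrib)
  qed
  have aL: "r ^ n * norm (a n) \<le> L" for n
  proof (induction n)
    case 0
    show ?case using r C by (simp add: L_def)
  next
    case (Suc n)
    have "r ^ Suc n * norm (a (Suc n)) \<le> r ^ Suc n * (norm (a n) + norm (b n))"
      using anx r by (intro mult_left_mono) auto
    also have "\<dots> = r * (r ^ n * norm (a n)) + r * (r ^ n * norm (b n))" by (simp add: algebra_simps)
    also have "\<dots> \<le> r * L + r * C" using Suc bC r by (intro add_mono mult_left_mono) auto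
    finally show ?case using L by linarith
  qed
  have "summable (\<lambda>n. z ^ n *\<^sub>C a (Suc n))"
  proof (rule summable_comparison_test')
    show "summable (\<lambda>n. L / r * (cmod z / r) ^ n)"
      using r by (intro summable_mult summable_geometric) simp
    show "norm (z ^ n *\<^sub>C a (Suc n)) \<le> L / r * (cmod z / r) ^ n" for n
    proof -
      have "norm (a (Suc n)) \<le> L / r ^ Suc n" using aL[of "Suc n"] r by (simp add: field_simps)
      then have "cmod z ^ n * norm (a (Suc n)) \<le> cmod z ^ n * (L / r ^ Suc n)" by (intro mult_left_mono) auto
      also have "\<dots> = L / r * (cmod z / r) ^ n" by (simp add: power_divide mult_ac)
      finally show ?thesis by (simp add: norm_power)
    qed
  qed
  from summable_sums[OF this] obtain k where k: "(\<lambda>n. z ^ n *\<^sub>C a (Suc n)) sums k" by blast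
  define A B A' Y where "A m = (\<Sum>n<m. z ^ n *\<^sub>C a n)" and "B m = (\<Sum>n<m. z ^ n *\<^sub>C b n)"
    and "A' m = (\<Sum>n<m. z ^ n *\<^sub>C a (Suc n))" and "Y m = (\<Sum>n<m. z ^ n *\<^sub>C y n)" for m
  have AX: "A m \<in> X\<^sub>0" for m
    unfolding A_def by (induction m) (auto intro!: csubspace_add csubspace_scaleC csubspace_zero X0 aX)
  have UA: "UU (A m, B m, 0) = (A' m, Y m, 0)" for m
  proof (induction m)
    case 0
    show ?case using U_zero by (simp add: A_def B_def A'_def Y_def zero_prod_def)
  next
    case (Suc m)
    show ?case
      using U_add[OF Suc U_scale[OF traj aX, of "z ^ m"] AX csubspace_scaleC[OF X0(1) aX]]
      by (simp add: A_def B_def A'_def Y_def)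
  qed
  have A'k: "A' \<longlonglongrightarrow> k" using k by (simp add: A'_def[abs_def] sums_def)
  have Bu: "B \<longlonglongrightarrow> observability N T x z" and Yy: "Y \<longlonglongrightarrow> observability E T x z"
    using summable_sums[OF sum_b[OF z]] summable_sums[OF sum_y[OF z]] z
    unfolding sums_def B_def[abs_def] Y_def[abs_def] observability_def b_def y_def by simp_all
  \<comment> \<open>Index shift: the states entering U are the initial state plus z times the states
    leaving it.\<close>
  have "A (Suc m) = R x + z *\<^sub>C A' m" for m
    by (induction m) (simp_all add: A_def A'_def a_def scaleC_add_right scaleC_scaleC)
  then have "(\<lambda>m. A (Suc m)) \<longlonglongrightarrow> R x + z *\<^sub>C k"
    by (simp only:) (intro tendsto_intros A'k)
  then have lim: "A \<longlonglongrightarrow> R x + z *\<^sub>C k" by (rule LIMSEQ_imp_Suc)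
  have "UU (R x + z *\<^sub>C k, observability N T x z, 0) = (k, observability E T x z, 0)"
    by (rule U_tendsto[OF AX lim tendsto_Pair[OF Bu tendsto_const] UA A'k tendsto_Pair[OF Yy tendsto_const]])
  moreover have "k \<in> X\<^sub>0"
    by (rule closed_sequentially[OF X0(2) _ A'k]) (rule U_mem[OF UA AX])
  ultimately have "loop K z (R x) (observability N T x z) 0 k 0 (observability E T x z) 0"
    using R_in by (simp add: loop_def bounded_clinear_zero[OF K])
  then show thesis by (rule that)
qed

text \<open>Superposition: removing from the output of the observability loop the response to its
  input leaves the response to the initial state R x alone.\<close>

lemma M_FS_eq:
  assumes \<E>: "\<E> \<in> schur_class" and z: "z \<in> disk"
  shows "M_FS T E N (redheffer Sg \<E>) x z = loop_out (\<E> z) z (R x) 0 0"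
proof -
  note K = schur_class_bounded_clinear[OF \<E> z] schur_class_contraction[OF \<E> z]
  obtain k where "loop (\<E> z) z (R x) (observability N T x z) 0 k 0 (observability E T x z) 0"
    by (rule observability_loop[OF z K(1)])
  from loop_out_eq[OF K z this]
  have "observability E T x z = loop_out (\<E> z) z (R x) 0 0 + redheffer Sg \<E> z (observability N T x z)"
    using loop_out_add[OF K z R_in[of x] csubspace_zero[OF X0(1)], of 0 "observability N T x z" 0 0]
    by (simp add: redheffer_loop_out[OF \<E> z])
  then show ?thesis using z by (simp add: M_FS_def)
qed

lemma loop_out_eq_0_imp:
  assumes T: "inj (cadjoint T)" and \<E>: "\<E> \<in> schur_class" and f: "holomorphic_vec f"
    and zero: "\<And>z. z \<in> disk \<Longrightarrow> loop_out (\<E> z) z 0 0 (f z) = 0" and z: "z \<in> disk"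
  shows "f z = 0"
proof -
  note K = schur_class_bounded_clinear[OF \<E>] schur_class_contraction[OF \<E>]
  have "\<forall>z\<in>disk. \<exists>h e d. loop (\<E> z) z 0 0 (f z) h e 0 d"
    using loop_out[OF K _ csubspace_zero[OF X0(1)]] zero by metis
  then obtain h e d where l: "\<And>z. z \<in> disk \<Longrightarrow> loop (\<E> z) z 0 0 (f z) (h z) (e z) 0 (d z)" by metis
  have h: "holomorphic_vec h" by (rule loop_holomorphic(1)[OF \<E> f l])
  have U: "h z \<in> X\<^sub>0 \<and> UU (z *\<^sub>C h z, 0, e z) = (h z, 0, d z)" if "z \<in> disk" for z
    using l[OF that] unfolding loop_def by auto
  have "e z = 0" "d z = 0" using zero_output[OF T h U z] by simp_all
  then show ?thesis using l[OF z] bounded_clinear_zero[OF K(1)[OF z]] by (simp add: loop_def)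
qed

theorem redheffer_G_rkhs:
  assumes T: "inj (cadjoint T)" and \<E>: "\<E> \<in> schur_class"
    and HE: "is_rkhs (schur_kernel \<E>) H\<^sub>\<E> ip\<^sub>\<E>" and HS: "is_rkhs (schur_kernel (redheffer Sg \<E>)) H\<^sub>S ip\<^sub>S"
  defines "G \<equiv> redheffer_G Sg \<E>" and "F \<equiv> M_FS T E N (redheffer Sg \<E>)"
  shows "mult_op G \<in> H\<^sub>\<E> \<rightarrow> H\<^sub>S"
    and "{f \<in> H\<^sub>\<E>. mult_op G f = (\<lambda>z\<in>disk. 0)} = {\<lambda>z\<in>disk. 0}"
    and "P = (\<lambda>x. ip_adjoint ip\<^sub>S F (F x)) \<Longrightarrow> f \<in> H\<^sub>\<E> \<Longrightarrow> ip_norm ip\<^sub>S (mult_op G f) = ip_norm ip\<^sub>\<E> f"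
proof -
  interpret SE: schur_rkhs "ext0 ` H\<^sub>\<E>" "rip ip\<^sub>\<E>" \<E>
    by (intro schur_rkhs.intro rkhs0_if_is_rkhs HE schur_rkhs_axioms.intro \<E>)
  interpret SS: schur_rkhs "ext0 ` H\<^sub>S" "rip ip\<^sub>S" "redheffer Sg \<E>"
    by (intro schur_rkhs.intro rkhs0_if_is_rkhs HS schur_rkhs_axioms.intro redheffer_schur_class \<E>)
  interpret C: colligation_rkhs X\<^sub>0 UU "ext0 ` H\<^sub>\<E>" "rip ip\<^sub>\<E>" \<E> "ext0 ` H\<^sub>S" "rip ip\<^sub>S" ..
  have 0: "0 \<in> X\<^sub>0" by (rule csubspace_zero[OF X0(1)])
  have fhE: "function_hilbert_space H\<^sub>\<E> ip\<^sub>\<E>" and fhS: "function_hilbert_space H\<^sub>S ip\<^sub>S"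
    using HE HS by (auto simp: is_rkhs_def)
  have extE: "f \<in> extensional disk" if "f \<in> H\<^sub>\<E>" for f using fhE that unfolding function_hilbert_space_def by blast
  have extS: "f \<in> extensional disk" if "f \<in> H\<^sub>S" for f using fhS that unfolding function_hilbert_space_def by blast
  have resE: "restrict (ext0 f) disk = f" if "f \<in> H\<^sub>\<E>" for f
    using extE[OF that] by (simp add: restrict_ext0 extensional_restrict)
  have resS: "restrict g disk \<in> H\<^sub>S" if "g \<in> ext0 ` H\<^sub>S" for g
    using that extS by (auto simp: restrict_ext0 extensional_restrict)
  have multW: "mult_op G f = restrict (C.W (0, ext0 f)) disk" for f
    unfolding mult_op_def
    by (rule restrict_ext) (simp add: C.W_def ext0_def G_def redheffer_G_loop_out[OF \<E>])
  have FW: "F x = restrict (C.W (R x, 0)) disk" for x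
  proof (rule extensionalityI[of _ disk])
    show "F x \<in> extensional disk" by (simp add: F_def M_FS_def)
    show "F x z = restrict (C.W (R x, 0)) disk z" if z: "z \<in> disk" for z
      using M_FS_eq[OF \<E> z, of x] z by (simp add: F_def C.W_def ext0_def)
  qed simp
  have RQ: "(R x, 0) \<in> X\<^sub>0 \<times> ext0 ` H\<^sub>\<E>" for x using R_in SE.zero_in by simp
  show "mult_op G \<in> H\<^sub>\<E> \<rightarrow> H\<^sub>S"
  proof
    fix f assume "f \<in> H\<^sub>\<E>"
    then have "(0, ext0 f) \<in> X\<^sub>0 \<times> ext0 ` H\<^sub>\<E>" using 0 by simp
    from resS[OF C.W_in[OF this]] show "mult_op G f \<in> H\<^sub>S" by (simp only: multW)
  qed
  have ker: "f = 0" if f: "f \<in> ext0 ` H\<^sub>\<E>" and W0: "\<And>z. z \<in> disk \<Longrightarrow> C.W (0, f) z = 0" for f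
  proof (rule SE.fun_eqI[OF f SE.zero_in])
    show "f z = 0 z" if z: "z \<in> disk" for z
      using loop_out_eq_0_imp[OF T \<E> SE.holomorphic[OF f] _ z] W0 by (simp add: C.W_apply)
  qed
  have zeroE: "(\<lambda>z\<in>disk. 0) \<in> H\<^sub>\<E>" using fhE unfolding function_hilbert_space_def by blast
  show "{f \<in> H\<^sub>\<E>. mult_op G f = (\<lambda>z\<in>disk. 0)} = {\<lambda>z\<in>disk. 0}"
  proof (intro equalityI subsetI)
    fix f assume "f \<in> {f \<in> H\<^sub>\<E>. mult_op G f = (\<lambda>z\<in>disk. 0)}"
    then have f: "f \<in> H\<^sub>\<E>" and eq: "restrict (C.W (0, ext0 f)) disk = (\<lambda>z\<in>disk. 0)" by (auto simp: multW)
    have "ext0 f = 0"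
    proof (rule ker)
      show "ext0 f \<in> ext0 ` H\<^sub>\<E>" using f by (rule imageI)
      show "C.W (0, ext0 f) z = 0" if "z \<in> disk" for z
        using fun_cong[OF eq, of z] that by (simp add: restrict_def)
    qed
    then have "restrict (ext0 f) disk = restrict 0 disk" by simp
    then show "f \<in> {\<lambda>z\<in>disk. 0}" unfolding resE[OF f] by (simp add: restrict_def fun_eq_iff)
  next
    fix f :: "complex \<Rightarrow> 'e" assume "f \<in> {\<lambda>z\<in>disk. 0}"
    then have f: "f = (\<lambda>z\<in>disk. 0)" by simp
    have "ext0 f = 0" by (rule ext) (simp add: ext0_def f)
    then have "C.W (0, ext0 f) = 0"
      using C.W_diff[OF C.Q.zero_in C.Q.zero_in] by (simp add: zero_prod_def)
    then have "mult_op G f = (\<lambda>z\<in>disk. 0)"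
      unfolding multW by (intro restrict_ext) simp
    moreover have "f \<in> H\<^sub>\<E>" unfolding f by (rule zeroE)
    ultimately show "f \<in> {f \<in> H\<^sub>\<E>. mult_op G f = (\<lambda>z\<in>disk. 0)}" by blast
  qed
  assume Peq: "P = (\<lambda>x. ip_adjoint ip\<^sub>S F (F x))" and f: "f \<in> H\<^sub>\<E>"
  have Fip: "ip\<^sub>S (F v) (F x) = rip ip\<^sub>S (C.W (R v, 0)) (C.W (R x, 0))" for v x by (simp only: FW)
  \<comment> \<open>\<open>ip_adjoint\<close> is a definite description, so the representing vector
    has to be produced by Riesz; the functional is bounded because \<open>W\<close> is a
    contraction.\<close>
  have adj: "ip\<^sub>S (F v) (F x) = cinner v (P x)" for v x
  proof -
    have "\<exists>p\<in>UNIV. \<forall>v\<in>UNIV. ip\<^sub>S (F v) (F x) = cinner v p"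
    proof (rule Riesz_chilbert)
      fix v w :: 'x and c
      note WV = C.W_in[OF RQ]
      have "C.W (R (v + w), 0) = C.W (R v, 0) + C.W (R w, 0)"
        using C.W_add[OF RQ RQ, of v w] by (simp add: bounded_clinear_add[OF bounded_R])
      then show "ip\<^sub>S (F (v + w)) (F x) = ip\<^sub>S (F v) (F x) + ip\<^sub>S (F w) (F x)"
        unfolding Fip using SS.ip_add_left[OF WV WV WV] by simp
      have "fsc c (0 :: complex \<Rightarrow> 'e) = 0" by (simp add: fsc_def fun_eq_iff)
      then have "C.W (R (c *\<^sub>C v), 0) = fsc c (C.W (R v, 0))"
        using C.W_scale[OF RQ, of c v] by (simp add: C.qsc_def bounded_clinear_scaleC[OF bounded_R])
      then show "ip\<^sub>S (F (c *\<^sub>C v)) (F x) = c * ip\<^sub>S (F v) (F x)"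
        unfolding Fip using SS.ip_sc_left[OF WV WV] by simp
      have "cmod (ip\<^sub>S (F v) (F x)) \<le> ip_norm (rip ip\<^sub>S) (C.W (R v, 0)) * ip_norm (rip ip\<^sub>S) (C.W (R x, 0))"
        unfolding Fip by (rule SS.Cauchy_Schwarz[OF WV WV])
      also have "\<dots> \<le> norm (R v) * ip_norm (rip ip\<^sub>S) (C.W (R x, 0))"
        using C.W_norm_le[OF RQ, of v] by (intro mult_right_mono SS.ip_norm_nonneg WV) (simp add: C.qip_norm_fst)
      also have "\<dots> \<le> (onorm R * norm v) * ip_norm (rip ip\<^sub>S) (C.W (R x, 0))"
        by (intro mult_right_mono SS.ip_norm_nonneg WV onorm bounded_clinear_bounded_linear bounded_R)
      finally show "cmod (ip\<^sub>S (F v) (F x)) \<le> onorm R * ip_norm (rip ip\<^sub>S) (C.W (R x, 0)) * norm v"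
        by (simp only: mult_ac)
    qed auto
    then obtain p where p: "\<forall>v. ip\<^sub>S (F v) (F x) = cinner v p" by blast
    have "\<forall>v. ip\<^sub>S (F v) (F x) = cinner v (ip_adjoint ip\<^sub>S F (F x))"
      unfolding ip_adjoint_def
    proof (rule theI[of _ p])
      show "q = p" if "\<forall>v. ip\<^sub>S (F v) (F x) = cinner v q" for q
        by (rule cinner_eqI) (metis p that)
    qed (fact p)
    then show ?thesis by (metis Peq)
  qed
  \<comment> \<open>With P equal to the product of the adjoint of F with F, the squared norm of
    \<open>F x\<close> is the form of P at x, which is also the squared norm of R x.\<close>
  have iso: "ip_norm (rip ip\<^sub>S) (C.W (h, 0)) = norm h" if h: "h \<in> range R" for h
  proof -
    obtain x where x: "h = R x" using h by blast
    have "(ip_norm (rip ip\<^sub>S) (C.W (R x, 0)))\<^sup>2 = (norm (R x))\<^sup>2"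
      unfolding SS.ip_norm_sq[OF C.W_in[OF RQ]] Fip[symmetric] adj norm_R ..
    then show ?thesis unfolding x using SS.ip_norm_nonneg[OF C.W_in[OF RQ]] by simp
  qed
  have "ip_norm (rip ip\<^sub>S) (C.W (0, ext0 f)) = ip_norm (rip ip\<^sub>\<E>) (ext0 f)"
    by (rule C.mult_isometric[OF aip_X0_def iso]) (use f ker in auto)
  then show "ip_norm ip\<^sub>S (mult_op G f) = ip_norm ip\<^sub>\<E> f"
    by (simp add: ip_norm_def multW resE[OF f])
qed

end

theorem theorem4p5:
  fixes P T :: "'x::chilbert \<Rightarrow> 'x"
    and E :: "'x \<Rightarrow> 'y::chilbert"
    and N :: "'x \<Rightarrow> 'u::chilbert"
    and i :: "'x \<times> 'u \<Rightarrow> 'd::chilbert"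
    and j :: "'x \<times> 'y \<Rightarrow> 'e::chilbert"
    and Sg :: "complex \<Rightarrow> 'u \<times> 'e \<Rightarrow> 'y \<times> 'd"
  assumes "aip_admissible P T E N"
    and "unitary_onto (aip_Delta P N) UNIV i"
    and "unitary_onto (aip_Delta_star P T E) UNIV j"
    and "Sg = aip_Sigma P T E N i j"
    and "inj (cadjoint T)"
  shows "redheffer Sg \<in> schur_class \<rightarrow> schur_class \<and>
    inj_on (redheffer Sg) schur_class \<and>
    (\<forall>\<E>\<in>schur_class. \<forall>S G H\<^sub>\<E> ip\<^sub>\<E> H\<^sub>S ip\<^sub>S.
      S = redheffer Sg \<E> \<longrightarrow> G = redheffer_G Sg \<E> \<longrightarrow>
      is_rkhs (schur_kernel \<E>) H\<^sub>\<E> ip\<^sub>\<E> \<longrightarrow> is_rkhs (schur_kernel S) H\<^sub>S ip\<^sub>S \<longrightarrow>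
        mult_op G \<in> H\<^sub>\<E> \<rightarrow> H\<^sub>S \<and>
        {f \<in> H\<^sub>\<E>. mult_op G f = (\<lambda>z\<in>disk. 0)} = {\<lambda>z\<in>disk. 0} \<and>
        (P = (\<lambda>x. ip_adjoint ip\<^sub>S (M_FS T E N S) (M_FS T E N S x)) \<longrightarrow>
          (\<forall>f\<in>H\<^sub>\<E>. ip_norm ip\<^sub>S (mult_op G f) = ip_norm ip\<^sub>\<E> f)))"
proof -
  interpret aip P T E N i j by (rule aip.intro) fact+
  have Sg: "Sg = transfer_function X\<^sub>0 UU" by (simp add: assms(4) aip_Sigma_def)
  show ?thesis
    unfolding Sg
  proof (intro conjI ballI allI impI, goal_cases)
    case 1
    show ?case by (rule funcsetI) (rule redheffer_schur_class)
  next
    case 2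
    show ?case by (rule redheffer_injective[OF assms(5)])
  next
    case (3 \<E> S G H\<^sub>\<E> ip\<^sub>\<E> H\<^sub>S ip\<^sub>S)
    then show ?case by (simp only:) (rule redheffer_G_rkhs(1)[OF assms(5)])
  next
    case (4 \<E> S G H\<^sub>\<E> ip\<^sub>\<E> H\<^sub>S ip\<^sub>S)
    then show ?case by (simp only:) (rule redheffer_G_rkhs(2)[OF assms(5)])
  next
    case (5 \<E> S G H\<^sub>\<E> ip\<^sub>\<E> H\<^sub>S ip\<^sub>S f)
    show ?case
      unfolding \<open>G = _\<close>
      by (rule redheffer_G_rkhs(3)[OF assms(5) 5(1,4) 5(5)[unfolded 5(2)] 5(6)[unfolded 5(2)] 5(7)])
  qed
qed

end
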